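(* Let $(u,v)$ be any nontrivial progressive wave solution, with initial condition $(U,V)\in L^{2,1}_{\mathcal{E}}\times L^{2,1}_{\mathcal{E}}$ and parameters $(\lambda,\mu,\alpha)$, $\lambda,\mu\in\mathbb{R}$, $\alpha\in\mathbb{C}\setminus\{0\}$, of the system $$i\partial_t u=\Pi(|v|^2u),\qquad i\partial_t v=-\Pi(|u|^2v).\qquad(\ast)$$ Then: (i) $M(U)=M(V)$; (ii) $\mathrm{Re}\big(\overline{\alpha}Q_-(U,V)\big)=0$; (iii) $\mathrm{Im}\big(\overline{\alpha}Q_-(U,V)\big)\neq0$; (iv) for any $K\geq0$, $\theta,\theta_1,\theta_2\in\mathbb{R}$ and $\beta\in\mathbb{C}$, and for $1\le j\le4$, the couple $(U_j,V_j)\in L^{2,1}_{\mathcal{E}}\times L^{2,1}_{\mathcal{E}}$ is also the initial condition of a progressive wave solution to $(\ast)$, with parameters $(\lambda_j,\mu_j,\alpha_j)$, where $$(U_1,V_1)=(Ke^{i\theta_1}U,Ke^{i\theta_2}V),\quad\alpha_1=K^2\alpha,\quad\lambda_1=K^2\lambda,\quad\mu_1=K^2\mu;$$ $$(U_2,V_2)=L_\theta(U,V),\quad\alpha_2=\alpha e^{-i\theta},\quad\lambda_2=\lambda,\quad\mu_2=\mu;$$ $$(U_3,V_3)=R_\beta(U,V),\quad\alpha_3=\alpha,\quad\lambda_3=\lambda+2\,\mathrm{Im}(\beta\overline{\alpha}),\quad\mu_3=\mu+2\,\mathrm{Im}(\beta\overline{\alpha});$$ $$(U_4,V_4)=(V,U),\quad\alpha_4=-\alpha,\quad\lambda_4=-\mu,\quad\mu_4=-\lambda;$$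 (v) the speed $\alpha$ is given by the formula $$\alpha=\frac{i}{M(U)}\int_{\mathbb{C}}|V|^2\,\partial_{\overline z}(|U|^2)\,dL;$$ (vi) $\displaystyle|\alpha|\leq\frac{M(U)}{2\sqrt2\,\pi}$; (vii) the parameters $\lambda,\mu,\alpha$ are related by $$(\lambda-\mu)M(U)-2i\,\overline{\alpha}\,Q_-(U,V)=2\mathcal{H}(U,V).$$
   Context: $L$ (as a measure) is Lebesgue measure on $\mathbb{C}$ and $\langle z\rangle=(1+|z|^2)^{1/2}$; $\partial_{\overline z}=\frac12(\partial_x+i\partial_y)$ for $z=x+iy$. The Bargmann-Fock space is $\mathcal{E}=\{u(z)=e^{-|z|^2/2}f(z):\ f \text{ entire holomorphic}\}\cap L^2(\mathbb{C})$, and $L^{2,1}_{\mathcal{E}}=\{u\in\mathcal{E}:\ \langle z\rangle u\in L^2(\mathbb{C})\}$. $\Pi$ is the orthogonal projection onto $\mathcal{E}$, given by $[\Pi u](z)=\frac1\pi e^{-|z|^2/2}\int_{\mathbb{C}}e^{\overline{w}z-|w|^2/2}u(w)\,dL(w)$. A progressive wave of $(\ast)$ with initial condition $(U,V)$ and parameters $(\lambda,\mu,\alpha)\in\mathbb{R}^2\times\mathbb{C}$ is a solution of the form $$\big(u(t,z),v(t,z)\big)=\Big(e^{-i\lambda t}U(z+\alpha t)e^{\frac12(\overline{z}\alpha-z\overline{\alpha})t},\ e^{-i\mu t}V(z+\alpha t)e^{\frac12(\overline{z}\alpha-z\overline{\alpha})t}\Big).$$ It is nontrivial if $(U,V)\neq(0,0)$.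 Notation: $M(U)=\int_{\mathbb{C}}|U|^2dL$; $Q_-(U,V)=\int_{\mathbb{C}}z\big(|U(z)|^2-|V(z)|^2\big)dL(z)$; $\mathcal{H}(U,V)=\int_{\mathbb{C}}|U|^2|V|^2dL$; for $\theta\in\mathbb{R}$, $L_\theta(U,V)(z)=\big(U(e^{i\theta}z),V(e^{i\theta}z)\big)$; for $\beta\in\mathbb{C}$, $R_\beta(U,V)(z)=\big(U(z+\beta)e^{\frac12(\overline z\beta-z\overline\beta)},V(z+\beta)e^{\frac12(\overline z\beta-z\overline\beta)}\big)$. *)

theory Defs
  imports "HOL-Analysis.Analysis"
begin

text \<open>Elements of \<open>L\<^sup>2\<close> are represented by functions, not by classes modulo null sets. This is harmless
  here: every element of the Bargmann-Fock space has exactly one continuous representative, the one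
  of the form \<open>exp (- |z|\<^sup>2 / 2) f z\<close>.\<close>

definition L2 :: "(complex \<Rightarrow> complex) set" where
  "L2 = {u \<in> borel_measurable lborel. integrable lborel (\<lambda>z. (cmod (u z))\<^sup>2)}"

definition bargmann_fock :: "(complex \<Rightarrow> complex) set" where
  "bargmann_fock =
     {u. \<exists>f. f holomorphic_on UNIV \<and> u = (\<lambda>z. of_real (exp (- (cmod z)\<^sup>2 / 2)) * f z)} \<inter> L2"

definition bracket :: "complex \<Rightarrow> real" where
  "bracket z = sqrt (1 + (cmod z)\<^sup>2)"

definition L21 :: "(complex \<Rightarrow> complex) set" where
  "L21 = {u \<in> bargmann_fock. (\<lambda>z. of_real (bracket z) * u z) \<in> L2}"

definition fock_proj :: "(complex \<Rightarrow> complex) \<Rightarrow> complex \<Rightarrow> complex" where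
  "fock_proj u z =
     of_real (exp (- (cmod z)\<^sup>2 / 2) / pi) *
     (LINT w|lborel. exp (cnj w * z - of_real ((cmod w)\<^sup>2 / 2)) * u w)"

definition dbar :: "(complex \<Rightarrow> complex) \<Rightarrow> complex \<Rightarrow> complex" where
  "dbar F z = (1/2) *
     (vector_derivative (\<lambda>x::real. F (Complex x (Im z))) (at (Re z)) +
      \<i> * vector_derivative (\<lambda>y::real. F (Complex (Re z) y)) (at (Im z)))"

text \<open>Global solutions with values in the Bargmann-Fock space, the time derivative being taken
  pointwise in \<open>z\<close>.\<close>

definition solution :: "(real \<Rightarrow> complex \<Rightarrow> complex) \<Rightarrow> (real \<Rightarrow> complex \<Rightarrow> complex) \<Rightarrow> bool" where
  "solution u v \<longleftrightarrow>
     (\<forall>t. u t \<in> bargmann_fock \<and> v t \<in> bargmann_fock) \<and>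
     (\<forall>t z.
        (\<lambda>s. u s z) differentiable (at t) \<and>
        (\<lambda>s. v s z) differentiable (at t) \<and>
        \<i> * vector_derivative (\<lambda>s. u s z) (at t) =
          fock_proj (\<lambda>w. of_real ((cmod (v t w))\<^sup>2) * u t w) z \<and>
        \<i> * vector_derivative (\<lambda>s. v s z) (at t) =
          - fock_proj (\<lambda>w. of_real ((cmod (u t w))\<^sup>2) * v t w) z)"

type_synonym couple = "(complex \<Rightarrow> complex) \<times> (complex \<Rightarrow> complex)"

definition progressive_wave ::
  "(real \<Rightarrow> complex \<Rightarrow> complex) \<Rightarrow> (real \<Rightarrow> complex \<Rightarrow> complex) \<Rightarrow> couple \<Rightarrow> real \<Rightarrow> real \<Rightarrow> complex \<Rightarrow> bool"
where
  "progressive_wave u v W lam \<mu> \<alpha> \<longleftrightarrow>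
     solution u v \<and>
     (\<forall>t z. u t z = exp (- \<i> * of_real (lam * t)) * fst W (z + \<alpha> * of_real t) *
                    exp ((1/2) * (cnj z * \<alpha> - z * cnj \<alpha>) * of_real t)) \<and>
     (\<forall>t z. v t z = exp (- \<i> * of_real (\<mu> * t)) * snd W (z + \<alpha> * of_real t) *
                    exp ((1/2) * (cnj z * \<alpha> - z * cnj \<alpha>) * of_real t))"

definition wave_initial :: "couple \<Rightarrow> real \<Rightarrow> real \<Rightarrow> complex \<Rightarrow> bool" where
  "wave_initial W lam \<mu> \<alpha> \<longleftrightarrow>
     W \<in> L21 \<times> L21 \<and> (\<exists>u v. progressive_wave u v W lam \<mu> \<alpha>)"

definition mass :: "(complex \<Rightarrow> complex) \<Rightarrow> real" where
  "mass U = (LINT z|lborel. (cmod (U z))\<^sup>2)"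

definition Q_minus :: "(complex \<Rightarrow> complex) \<Rightarrow> (complex \<Rightarrow> complex) \<Rightarrow> complex" where
  "Q_minus U V = (LINT z|lborel. z * of_real ((cmod (U z))\<^sup>2 - (cmod (V z))\<^sup>2))"

definition energy :: "(complex \<Rightarrow> complex) \<Rightarrow> (complex \<Rightarrow> complex) \<Rightarrow> real" where
  "energy U V = (LINT z|lborel. (cmod (U z))\<^sup>2 * (cmod (V z))\<^sup>2)"

definition L_rotate :: "real \<Rightarrow> couple \<Rightarrow> couple" where
  "L_rotate \<theta> W =
     ((\<lambda>z. fst W (exp (\<i> * of_real \<theta>) * z)), (\<lambda>z. snd W (exp (\<i> * of_real \<theta>) * z)))"

definition R_translate :: "complex \<Rightarrow> couple \<Rightarrow> couple" where
  "R_translate \<beta> W =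
     ((\<lambda>z. fst W (z + \<beta>) * exp ((1/2) * (cnj z * \<beta> - z * cnj \<beta>))),
      (\<lambda>z. snd W (z + \<beta>) * exp ((1/2) * (cnj z * \<beta> - z * cnj \<beta>))))"

end

theory Submission
  imports Defs "HOL-Complex_Analysis.Complex_Analysis" "HOL-Probability.Distributions"
begin

text \<open>Write \<open>U = e f\<close>, \<open>V = e g\<close> with \<open>e z = exp (- |z|\<^sup>2 / 2)\<close> and \<open>f\<close>, \<open>g\<close> entire, and let
  \<open>T f = \<alpha> f' - cnj \<alpha> z f\<close> be the infinitesimal magnetic translation. The time derivative of the ansatz
  at \<open>t = 0\<close> turns the system into the stationary pair
  \<open>e (lam f + \<i> T f) = \<Pi> (|V|\<^sup>2 U)\<close> and \<open>e (\<mu> g + \<i> T g) = - \<Pi> (|U|\<^sup>2 V)\<close>.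

  Everything except (iv) and (vi) is obtained by testing these equations against entire functions
  \<open>h\<close>: the reproducing formula of the Bargmann-Fock space removes \<open>\<Pi>\<close> from the right-hand
  side (\<open>fock_proj_pairing\<close>), and on the left-hand side multiplication by \<open>z\<close> and differentiation are
  adjoint to each other for the Gaussian weight. Both equations have the same shape, with a real density
  \<open>\<rho>\<close> equal to \<open>|V|\<^sup>2\<close> or \<open>- |U|\<^sup>2\<close>, so that the tests are made once, in the locale
  \<open>wave_component\<close>, with four choices of \<open>h\<close>:

  \<^item> \<open>h = f\<close> gives the energy balance, and the difference of the two components is (vii) once (i) and (ii)
    are known;

  \<^item> \<open>h = f'\<close> and \<open>h = z f\<close>, subtracted, give \<open>\<integral> \<rho> \<partial>\<^bsub>zbar\<^esub>(|U|\<^sup>2) = - \<i> \<alpha> M(U)\<close>, because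
    \<open>[T, z] = \<alpha>\<close>. This is (v). Adding the formulas of the two components produces the integral of
    \<open>\<partial>\<^bsub>zbar\<^esub>(|U|\<^sup>2 |V|\<^sup>2)\<close>, which is zero, and (i) follows since \<open>\<alpha> \<noteq> 0\<close>;

  \<^item> \<open>h = z f'\<close> generates rotations. The sum over the components is the angular derivative of
    \<open>|U|\<^sup>2 |V|\<^sup>2\<close>, which integrates to zero, and what remains is (ii);

  \<^item> \<open>h = z f\<close> alone gives a second moment of \<open>y = Im (cnj \<alpha> z)\<close>. If \<open>Q_minus U V\<close> vanished, both densities
    would have the same mean of \<open>y\<close>, and the moment and energy identities together would say that
    \<open>y\<close> has variance zero for \<open>|U|\<^sup>2 + |V|\<^sup>2\<close>. No density is carried by a line, hence (iii).

  For (vi), the two expressions of \<open>\<alpha>\<close> given by the components add up to an integral of \<open>f g\<close> against the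
  Wronskian \<open>f' g - f g'\<close>. These are the value and the derivative at \<open>w = 0\<close> of \<open>f (z + w) g (z - w)\<close>,
  and Bessel's inequality for the orthogonal functions \<open>1\<close> and \<open>w\<close> bounds their product by an integral over \<open>w\<close>;
  integrated over \<open>z\<close>, it is a multiple of \<open>M(U) M(V)\<close>. The resulting bound is half of the one in (vi).

  For (iv), the scaling, the rotation, the magnetic translation and the exchange \<open>(u (t), v (t)) \<mapsto> (v (-t), u (-t))\<close>
  map solutions to solutions, by the covariance of \<open>\<Pi>\<close>; the new parameters are read off.

  Membership in \<open>L21\<close> only controls \<open>z f\<close> and \<open>f'\<close>, while the tests with \<open>z f\<close> and \<open>z f'\<close> formally use higher moments.
  Integrations by parts are therefore carried out for a Gaussian weight that decays slightly faster and
  passed to the limit, which asks integrability only of the combination that is finally integrated.\<close>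

section \<open>Lebesgue measure on the plane\<close>

lemma measurable_Complex [measurable (raw)]:
  assumes "f \<in> borel_measurable M" "g \<in> borel_measurable M"
  shows "(\<lambda>x. Complex (f x) (g x)) \<in> borel_measurable M"
  unfolding Complex_eq using assms by measurable

lemma lborel_complex_eq_distr:
  "(lborel :: complex measure) = distr (lborel \<Otimes>\<^sub>M lborel) borel (\<lambda>p. Complex (fst p) (snd p))"
proof (rule lborel_eqI)
  fix l u :: complex
  assume le: "\<And>b. b \<in> Basis \<Longrightarrow> l \<bullet> b \<le> u \<bullet> b"
  have le': "Re l \<le> Re u" "Im l \<le> Im u"
    using le[of 1] le[of \<i>] by (auto simp: Basis_complex_def)
  have eq: "(\<lambda>p. Complex (fst p) (snd p)) -` box l u \<inter> space (lborel \<Otimes>\<^sub>M lborel) =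
      box (Re l) (Re u) \<times> box (Im l) (Im u)"
    by (auto simp: box_def Basis_complex_def space_pair_measure)
  have "emeasure (distr (lborel \<Otimes>\<^sub>M lborel) borel (\<lambda>p. Complex (fst p) (snd p))) (box l u) =
      emeasure (lborel \<Otimes>\<^sub>M lborel) (box (Re l) (Re u) \<times> box (Im l) (Im u))"
    by (subst emeasure_distr) (auto simp: eq)
  also have "\<dots> = (\<Prod>b\<in>Basis. (u - l) \<bullet> b)"
    using le' by (simp add: lborel.emeasure_pair_measure_Times Basis_complex_def ennreal_mult inner_diff_left)
  finally show "emeasure (distr (lborel \<Otimes>\<^sub>M lborel) borel (\<lambda>p. Complex (fst p) (snd p))) (box l u) =
      (\<Prod>b\<in>Basis. (u - l) \<bullet> b)" .
qed simp

lemma nn_integral_lborel_complex: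
  fixes f :: "complex \<Rightarrow> ennreal"
  assumes [measurable]: "f \<in> borel_measurable borel"
  shows "(\<integral>\<^sup>+z. f z \<partial>lborel) = (\<integral>\<^sup>+x. \<integral>\<^sup>+y. f (Complex x y) \<partial>lborel \<partial>lborel)"
    and "(\<integral>\<^sup>+z. f z \<partial>lborel) = (\<integral>\<^sup>+y. \<integral>\<^sup>+x. f (Complex x y) \<partial>lborel \<partial>lborel)"
proof -
  have *: "(\<integral>\<^sup>+z. f z \<partial>lborel) = (\<integral>\<^sup>+p. f (Complex (fst p) (snd p)) \<partial>(lborel \<Otimes>\<^sub>M lborel))"
    by (subst lborel_complex_eq_distr, subst nn_integral_distr) auto
  show "(\<integral>\<^sup>+z. f z \<partial>lborel) = (\<integral>\<^sup>+x. \<integral>\<^sup>+y. f (Complex x y) \<partial>lborel \<partial>lborel)"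
    unfolding * by (subst lborel.nn_integral_fst[symmetric]) auto
  show "(\<integral>\<^sup>+z. f z \<partial>lborel) = (\<integral>\<^sup>+y. \<integral>\<^sup>+x. f (Complex x y) \<partial>lborel \<partial>lborel)"
    unfolding * by (subst lborel_pair.nn_integral_snd[symmetric]) auto
qed

lemma nn_integral_shear:
  fixes f :: "complex \<Rightarrow> ennreal"
  assumes [measurable]: "f \<in> borel_measurable borel"
  shows "(\<integral>\<^sup>+z. f (Complex (Re z + a * Im z) (Im z)) \<partial>lborel) = (\<integral>\<^sup>+z. f z \<partial>lborel)"
    and "(\<integral>\<^sup>+z. f (Complex (Re z) (Im z + a * Re z)) \<partial>lborel) = (\<integral>\<^sup>+z. f z \<partial>lborel)"
proof -
  have "(\<integral>\<^sup>+x. f (Complex (x + a * y) y) \<partial>lborel) = (\<integral>\<^sup>+x. f (Complex x y) \<partial>lborel)" for y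
    using nn_integral_real_affine[of "\<lambda>x. f (Complex x y)" 1 "a * y"] by (simp add: add.commute)
  then show "(\<integral>\<^sup>+z. f (Complex (Re z + a * Im z) (Im z)) \<partial>lborel) = (\<integral>\<^sup>+z. f z \<partial>lborel)"
    by (simp add: nn_integral_lborel_complex(2))
  have "(\<integral>\<^sup>+y. f (Complex x (y + a * x)) \<partial>lborel) = (\<integral>\<^sup>+y. f (Complex x y) \<partial>lborel)" for x
    using nn_integral_real_affine[of "\<lambda>y. f (Complex x y)" 1 "a * x"] by (simp add: add.commute)
  then show "(\<integral>\<^sup>+z. f (Complex (Re z) (Im z + a * Re z)) \<partial>lborel) = (\<integral>\<^sup>+z. f z \<partial>lborel)"
    by (simp add: nn_integral_lborel_complex(1))
qed

lemma nn_integral_scaled: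
  fixes f :: "complex \<Rightarrow> ennreal"
  assumes [measurable]: "f \<in> borel_measurable borel" and "a \<noteq> 0"
  shows "(\<integral>\<^sup>+z. f z \<partial>lborel) = ennreal (a\<^sup>2) * (\<integral>\<^sup>+z. f (b + a *\<^sub>R z) \<partial>lborel)"
  by (subst lborel_affine[OF assms(2), of b])
     (simp add: nn_integral_density nn_integral_distr nn_integral_cmult)

text \<open>A rotation other than the half turn is a product of three shears, and shears preserve Lebesgue
  measure by Tonelli's theorem and the translation invariance of the measure on the line.\<close>

lemma nn_integral_rotate:
  fixes f :: "complex \<Rightarrow> ennreal"
  assumes [measurable]: "f \<in> borel_measurable borel" and c: "cmod c = 1"
  shows "(\<integral>\<^sup>+z. f (c * z) \<partial>lborel) = (\<integral>\<^sup>+z. f z \<partial>lborel)"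
proof (cases "Re c = -1")
  case True
  with c have "Im c = 0" by (simp add: cmod_def)
  with True have "c = -1" by (simp add: complex_eq_iff)
  then show ?thesis using nn_integral_scaled[of f "-1" 0] by simp
next
  case False
  have sq: "(Re c)\<^sup>2 + (Im c)\<^sup>2 = 1" using c by (simp add: cmod_def)
  have "(Re c)\<^sup>2 \<le> 1" using sq by (smt (verit) zero_le_power2)
  then have k: "1 + Re c > 0" using False by (simp add: abs_le_square_iff[symmetric] abs_square_le_1)
  \<comment> \<open>Minus the tangent of half the angle of rotation.\<close>
  define t where "t = - Im c / (1 + Re c)"
  have t: "t * (1 + Re c) = - Im c" using k by (simp add: t_def)
  have ts: "1 + t * Im c = Re c"
    using k sq by (simp add: t_def field_simps power2_eq_square)
  have eq: "c * z = (let w = Complex (Re z + t * Im z) (Im z); w' = Complex (Re w) (Im w + Im c * Re w)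
      in Complex (Re w' + t * Im w') (Im w'))" for z
  proof -
    have 1: "Im z + Im c * (Re z + t * Im z) = Im (c * z)"
      using ts by (simp add: algebra_simps) (metis distrib_left mult.assoc mult.commute mult.right_neutral)
    have 2: "(Re z + t * Im z) + t * Im (c * z) = Re (c * z)"
    proof -
      have "(Re z + t * Im z) + t * Im (c * z) = (1 + t * Im c) * Re z + (t * (1 + Re c)) * Im z"
        by (simp add: algebra_simps)
      also have "\<dots> = Re (c * z)" unfolding ts t by simp
      finally show ?thesis .
    qed
    show ?thesis unfolding complex_eq_iff[of "c * z"] using 2 by (simp only: Let_def complex.sel 1)
  qed
  have "(\<integral>\<^sup>+z. f (c * z) \<partial>lborel) =
    (\<integral>\<^sup>+z. (\<lambda>w. (\<lambda>w'. f (Complex (Re w' + t * Im w') (Im w'))) (Complex (Re w) (Im w + Im c * Re w)))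
        (Complex (Re z + t * Im z) (Im z)) \<partial>lborel)"
    by (simp only: eq Let_def)
  also have "\<dots> = (\<integral>\<^sup>+z. f z \<partial>lborel)"
    by (subst nn_integral_shear(1), measurable, subst nn_integral_shear(2), measurable,
        subst nn_integral_shear(1), measurable)
  finally show ?thesis .
qed

lemma lborel_eq_distr_if_nn_integral:
  fixes T :: "complex \<Rightarrow> complex"
  assumes [measurable]: "T \<in> borel_measurable borel"
    and inv: "\<And>f :: complex \<Rightarrow> ennreal. f \<in> borel_measurable borel \<Longrightarrow>
      (\<integral>\<^sup>+z. f (T z) \<partial>lborel) = (\<integral>\<^sup>+z. f z \<partial>lborel)"
  shows "distr lborel borel T = lborel"
proof (rule measure_eqI)
  fix A assume "A \<in> sets (distr lborel borel T)"
  then have [measurable]: "A \<in> sets borel" by simp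
  show "emeasure (distr lborel borel T) A = emeasure lborel A"
    using inv[of "indicator A"] nn_integral_distr[of T lborel borel "indicator A"] by simp
qed simp

lemma lborel_distr_rotate:
  assumes "cmod c = 1" shows "distr lborel borel ((*) c) = lborel"
  by (rule lborel_eq_distr_if_nn_integral) (use nn_integral_rotate[OF _ assms] in auto)

lemma
  fixes F :: "complex \<Rightarrow> 'a::{banach, second_countable_topology}"
  assumes [measurable]: "F \<in> borel_measurable borel"
  shows integrable_translate: "integrable lborel (\<lambda>z. F (z + b)) \<longleftrightarrow> integrable lborel F"
    and integral_translate: "(LINT z|lborel. F (z + b)) = (LINT z|lborel. F z)"
    and integrable_rotate: "cmod c = 1 \<Longrightarrow> integrable lborel (\<lambda>z. F (c * z)) \<longleftrightarrow> integrable lborel F"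
    and integral_rotate: "cmod c = 1 \<Longrightarrow> (LINT z|lborel. F (c * z)) = (LINT z|lborel. F z)"
proof -
  show "integrable lborel (\<lambda>z. F (z + b)) \<longleftrightarrow> integrable lborel F"
    using integrable_distr_eq[of "(+) b" lborel borel F] by (simp add: lborel_distr_plus add.commute)
  show "(LINT z|lborel. F (z + b)) = (LINT z|lborel. F z)"
    using integral_distr[of "(+) b" lborel borel F] by (simp add: lborel_distr_plus add.commute)
  show "integrable lborel (\<lambda>z. F (c * z)) \<longleftrightarrow> integrable lborel F" if "cmod c = 1"
    using integrable_distr_eq[of "(*) c" lborel borel F] by (simp add: lborel_distr_rotate[OF that])
  show "(LINT z|lborel. F (c * z)) = (LINT z|lborel. F z)" if "cmod c = 1"
    using integral_distr[of "(*) c" lborel borel F] by (simp add: lborel_distr_rotate[OF that])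
qed

lemma nn_integral_gaussian_real:
  assumes c: "c > 0"
  shows "(\<integral>\<^sup>+x. ennreal (exp (- c * x\<^sup>2)) \<partial>lborel) = ennreal (sqrt (pi / c))"
proof -
  define s where "s = sqrt (1 / (2 * c))"
  have s: "s > 0" "2 * s\<^sup>2 = 1 / c" using c by (auto simp: s_def)
  have eq: "exp (- c * x\<^sup>2) = sqrt (pi / c) * normal_density 0 s x" for x
  proof -
    have "2 * pi * s\<^sup>2 = pi / c" using s(2) by (simp add: mult.assoc mult.left_commute)
    moreover have "x\<^sup>2 / (2 * s\<^sup>2) = c * x\<^sup>2" using s(2) by simp
    ultimately show ?thesis using c unfolding normal_density_def by (simp add: minus_divide_left[symmetric])
  qed
  have "(\<integral>\<^sup>+x. ennreal (exp (- c * x\<^sup>2)) \<partial>lborel) =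
      (\<integral>\<^sup>+x. ennreal (sqrt (pi / c) * normal_density 0 s x) \<partial>lborel)" by (simp only: eq)
  also have "\<dots> = ennreal (LINT x|lborel. sqrt (pi / c) * normal_density 0 s x)"
    using c s by (intro nn_integral_eq_integral) (auto intro!: integrable_mult_right)
  also have "\<dots> = ennreal (sqrt (pi / c))" using s by simp
  finally show ?thesis .
qed

lemma
  assumes c: "c > 0"
  shows integrable_gaussian: "integrable lborel (\<lambda>z::complex. exp (- c * (cmod z)\<^sup>2))"
    and integral_gaussian: "(LINT z|lborel. exp (- c * (cmod (z::complex))\<^sup>2)) = pi / c"
proof -
  have "(\<integral>\<^sup>+z. ennreal (exp (- c * (cmod (z::complex))\<^sup>2)) \<partial>lborel) =
      (\<integral>\<^sup>+x. \<integral>\<^sup>+y. ennreal (exp (- c * x\<^sup>2)) * ennreal (exp (- c * y\<^sup>2)) \<partial>lborel \<partial>lborel)"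
    by (subst nn_integral_lborel_complex(1))
       (auto simp: cmod_def algebra_simps exp_add[symmetric] ennreal_mult[symmetric])
  also have "\<dots> = (\<integral>\<^sup>+x. ennreal (exp (- c * x\<^sup>2)) * ennreal (sqrt (pi / c)) \<partial>lborel)"
    by (subst nn_integral_cmult, simp, subst nn_integral_gaussian_real[OF c], rule refl)
  also have "\<dots> = ennreal (sqrt (pi / c)) * ennreal (sqrt (pi / c))"
    by (subst nn_integral_multc, simp, subst nn_integral_gaussian_real[OF c], rule refl)
  also have "\<dots> = ennreal (pi / c)"
    using c by (simp add: ennreal_mult[symmetric])
  finally have *: "(\<integral>\<^sup>+z. ennreal (exp (- c * (cmod (z::complex))\<^sup>2)) \<partial>lborel) = ennreal (pi / c)" .
  have hb: "has_bochner_integral lborel (\<lambda>z::complex. exp (- c * (cmod z)\<^sup>2)) (pi / c)"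
    by (rule has_bochner_integral_nn_integral) (use c * in auto)
  show "integrable lborel (\<lambda>z::complex. exp (- c * (cmod z)\<^sup>2))"
    "(LINT z|lborel. exp (- c * (cmod (z::complex))\<^sup>2)) = pi / c"
    using hb by (auto simp: has_bochner_integral_iff)
qed

text \<open>Cauchy's formula at the centre of the circle, written as an integral over the angle.\<close>

lemma circle_mean_value:
  assumes "h holomorphic_on UNIV"
  shows "((\<lambda>t. h (exp (2 * of_real pi * \<i> * of_real t) * z)) has_integral h 0) {0..1}"
proof (cases "z = 0")
  case True
  then show ?thesis using has_integral_const_real[of "h 0" 0 1] by simp
next
  case False
  have h: "(\<lambda>w. h (w * z)) holomorphic_on cball 0 1"
    by (intro holomorphic_on_compose_gen[OF _ assms, unfolded o_def] holomorphic_intros) auto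
  have "((\<lambda>u. h (u * z) / (u - 0)) has_contour_integral (2 * of_real pi * \<i> * h (0 * z))) (circlepath 0 1)"
    by (rule Cauchy_integral_circlepath_simple[OF h]) auto
  then have "((\<lambda>t. h (exp (2 * of_real pi * \<i> * of_real t) * z) * (2 * of_real pi * \<i>)) has_integral
      (2 * of_real pi * \<i> * h 0)) {0..1}"
    unfolding has_contour_integral vector_derivative_circlepath
    unfolding circlepath by (simp add: algebra_simps)
  from has_integral_mult_left[OF this, of "1 / (2 * of_real pi * \<i>)"] show ?thesis by simp
qed

section \<open>Entire functions of Gaussian growth and integration by parts\<close>

definition gauss :: "real \<Rightarrow> complex \<Rightarrow> real" where
  "gauss c z = exp (- c * (cmod z)\<^sup>2)"

lemma gauss_pos [simp]: "gauss c z > 0" and gauss_nonneg [simp]: "gauss c z \<ge> 0"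
  and gauss_nz [simp]: "gauss c z \<noteq> 0"
  by (simp_all add: gauss_def)

lemma gauss_mult: "gauss c z * gauss d z = gauss (c + d) z"
  by (simp add: gauss_def exp_add[symmetric] algebra_simps)

lemma continuous_on_gauss [continuous_intros]: "continuous_on S f \<Longrightarrow> continuous_on S (\<lambda>x. gauss c (f x))"
  unfolding gauss_def by (intro continuous_intros)

lemma measurable_gauss [measurable (raw)]:
  assumes "f \<in> borel_measurable M" shows "(\<lambda>x. gauss c (f x)) \<in> borel_measurable M"
  using assms unfolding gauss_def by measurable

lemma measurable_cnj [measurable (raw)]:
  assumes "f \<in> borel_measurable M" shows "(\<lambda>x. cnj (f x)) \<in> borel_measurable M"
  using measurable_compose[OF assms borel_measurable_continuous_onI[of cnj]] by (simp add: continuous_intros)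

lemma of_real_gauss: "complex_of_real (gauss c z) = exp (- of_real c * z * cnj z)"
  by (simp add: gauss_def exp_of_real[symmetric] complex_norm_square[symmetric] mult.assoc)

lemma integrable_gauss: "c > 0 \<Longrightarrow> integrable lborel (gauss c)"
  and integral_gauss: "c > 0 \<Longrightarrow> (LINT z|lborel. gauss c z) = pi / c"
  using integrable_gaussian integral_gaussian by (simp_all add: gauss_def[abs_def])

text \<open>Averaging over the rotations of the plane replaces \<open>h z\<close> by its mean over the circle of radius
  \<open>|z|\<close>, which is \<open>h 0\<close>; the weight is radial.\<close>

lemma entire_gaussian_mean:
  assumes h: "h holomorphic_on UNIV" and c: "c > 0"
    and int: "integrable lborel (\<lambda>z. h z * of_real (gauss c z))"
  shows "(LINT z|lborel. h z * of_real (gauss c z)) = of_real (pi / c) * h 0"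
proof -
  define E where "E t = exp (2 * of_real pi * \<i> * of_real t :: complex)" for t :: real
  have E: "cmod (E t) = 1" for t by (simp add: E_def)
  have conth: "continuous_on UNIV h" using h holomorphic_on_imp_continuous_on by blast
  have [measurable]: "h \<in> borel_measurable borel" by (intro borel_measurable_continuous_onI conth)
  have [measurable]: "E \<in> borel_measurable borel"
    unfolding E_def by (intro borel_measurable_continuous_onI continuous_intros)
  define k where "k t z = indicator {0..1} t *\<^sub>R (h (E t * z) * of_real (gauss c z))" for t z
  let ?I = "LINT z|lborel. h z * of_real (gauss c z)"
  have g: "gauss c (E t * z) = gauss c z" for t z by (simp add: gauss_def norm_mult E)
  have rot: "(LINT z|lborel. F (E t * z)) = (LINT z|lborel. F z)"
      "integrable lborel (\<lambda>z. F (E t * z)) = integrable lborel F"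
    if "F \<in> borel_measurable borel" for F :: "complex \<Rightarrow> 'b::{banach, second_countable_topology}" and t
    using integral_rotate[OF that E] integrable_rotate[OF that E] by auto
  have int_t: "integrable lborel (\<lambda>z. h (E t * z) * of_real (gauss c z))" for t
    using int rot(2)[of "\<lambda>z. h z * of_real (gauss c z)" t] by (simp add: g)
  have I_t: "(LINT z|lborel. h (E t * z) * of_real (gauss c z)) = ?I" for t
    using rot(1)[of "\<lambda>z. h z * of_real (gauss c z)" t] by (simp add: g)
  have N_t: "(LINT z|lborel. norm (h (E t * z) * of_real (gauss c z))) =
      (LINT z|lborel. norm (h z * of_real (gauss c z)))" for t
    using rot(1)[of "\<lambda>z. norm (h z * of_real (gauss c z))" t] by (simp add: g)
  have int2: "integrable (lborel \<Otimes>\<^sub>M lborel) (\<lambda>(t, z). k t z)"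
  proof (rule lborel_pair.Fubini_integrable)
    show "(\<lambda>(t, z). k t z) \<in> borel_measurable (lborel \<Otimes>\<^sub>M lborel)"
      unfolding k_def by measurable
    have "(LINT z|lborel. norm (k t z)) =
        indicator {0..1} t *\<^sub>R (LINT z|lborel. norm (h z * of_real (gauss c z)))" for t
      unfolding k_def norm_scaleR using N_t[of t] by simp
    then show "integrable lborel (\<lambda>t. LINT z|lborel. norm (case (t, z) of (t, z) \<Rightarrow> k t z))"
      by (simp add: integrable_mult_left[OF integrable_real_indicator])
    show "AE t in lborel. integrable lborel (\<lambda>z. case (t, z) of (t, z) \<Rightarrow> k t z)"
      unfolding k_def using int_t by simp
  qed
  have "(LINT t|lborel. LINT z|lborel. k t z) = (LINT t|lborel. indicator {0..1::real} t *\<^sub>R ?I)"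
    unfolding k_def using I_t by simp
  also have "\<dots> = ?I" by simp
  finally have 1: "(LINT t|lborel. LINT z|lborel. k t z) = ?I" .
  have inner: "(LINT t|lborel. k t z) = h 0 * of_real (gauss c z)" for z
  proof -
    have cont: "continuous_on {0..1} (\<lambda>t. h (E t * z))"
      unfolding E_def
      by (intro continuous_on_compose2[OF conth] continuous_intros) auto
    have "((\<lambda>t. h (E t * z)) has_integral h 0) {0..1}"
      unfolding E_def by (rule circle_mean_value[OF h])
    then have "integral {0..1} (\<lambda>t. h (E t * z)) = h 0" by (rule integral_unique)
    then have "(LINT t|lborel. indicator {0..1} t *\<^sub>R h (E t * z)) = h 0"
      using set_borel_integral_eq_integral(2)[OF borel_integrable_atLeastAtMost'[OF cont]]
      by (simp add: set_lebesgue_integral_def)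
    moreover have "k t z = (indicator {0..1} t *\<^sub>R h (E t * z)) * of_real (gauss c z)" for t
      by (simp add: k_def)
    ultimately show ?thesis by (simp del: mult_scaleR_left)
  qed
  have "(LINT z|lborel. LINT t|lborel. k t z) = (LINT z|lborel. h 0 * of_real (gauss c z))"
    by (simp only: inner)
  also have "\<dots> = of_real (pi / c) * h 0"
    using integral_gauss[OF c] by (simp add: mult.commute)
  finally have 2: "(LINT z|lborel. LINT t|lborel. k t z) = of_real (pi / c) * h 0" .
  show ?thesis using lborel_pair.Fubini_integral[OF int2] 1 2 by simp
qed

text \<open>Elements of the Bargmann-Fock space have growth \<open>1/2\<close>. The class is a bookkeeping device: exponents add under products,
  any larger exponent absorbs a derivative, a translation or a polynomial factor, and two functions whose
  exponents add up to less than \<open>c\<close> can be paired for the weight \<open>gauss c\<close>.\<close>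

definition gauss_growth :: "real \<Rightarrow> (complex \<Rightarrow> complex) \<Rightarrow> bool" where
  "gauss_growth s h \<longleftrightarrow> h holomorphic_on UNIV \<and> (\<exists>C. \<forall>z. cmod (h z) \<le> C * exp (s * (cmod z)\<^sup>2))"

lemma gauss_growth_holomorphic: "gauss_growth s h \<Longrightarrow> h holomorphic_on UNIV"
  by (simp add: gauss_growth_def)

lemma gauss_growthI: "h holomorphic_on UNIV \<Longrightarrow> (\<And>z. cmod (h z) \<le> C * exp (s * (cmod z)\<^sup>2)) \<Longrightarrow> gauss_growth s h"
  by (auto simp: gauss_growth_def)

lemma gauss_growthE:
  assumes "gauss_growth s h"
  obtains C where "C \<ge> 0" "\<And>z. cmod (h z) \<le> C * exp (s * (cmod z)\<^sup>2)"
proof -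
  obtain C where C: "\<And>z. cmod (h z) \<le> C * exp (s * (cmod z)\<^sup>2)" using assms by (auto simp: gauss_growth_def)
  have "0 \<le> C" using order_trans[OF norm_ge_zero C[of 0]] by simp
  then show thesis using C that by blast
qed

lemma gauss_growth_mono:
  assumes "gauss_growth s h" "s \<le> t" shows "gauss_growth t h"
proof -
  obtain C where C: "C \<ge> 0" "\<And>z. cmod (h z) \<le> C * exp (s * (cmod z)\<^sup>2)" using gauss_growthE[OF assms(1)] by blast
  have "cmod (h z) \<le> C * exp (t * (cmod z)\<^sup>2)" for z
    using C(1) assms(2) by (intro order_trans[OF C(2)] mult_left_mono) (auto intro!: mult_right_mono)
  then show ?thesis using gauss_growth_holomorphic[OF assms(1)] by (rule gauss_growthI[rotated])
qed

lemma gauss_growth_const: "0 \<le> s \<Longrightarrow> gauss_growth s (\<lambda>_. a)"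
  using mult_left_mono[of 1 "exp (s * (cmod z)\<^sup>2)" "cmod a" for z]
  by (intro gauss_growthI[of _ "cmod a"]) simp_all

lemma gauss_growth_mult:
  assumes "gauss_growth s a" "gauss_growth t b" shows "gauss_growth (s + t) (\<lambda>z. a z * b z)"
proof -
  obtain C where C: "C \<ge> 0" "\<And>z. cmod (a z) \<le> C * exp (s * (cmod z)\<^sup>2)" using gauss_growthE[OF assms(1)] by blast
  obtain D where D: "D \<ge> 0" "\<And>z. cmod (b z) \<le> D * exp (t * (cmod z)\<^sup>2)" using gauss_growthE[OF assms(2)] by blast
  have "cmod (a z * b z) \<le> (C * D) * exp ((s + t) * (cmod z)\<^sup>2)" for z
    using mult_mono[OF C(2)[of z] D(2)[of z]] C(1)
    by (simp add: norm_mult distrib_right exp_add mult_ac)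
  then show ?thesis
    by (intro gauss_growthI[of _ "C * D"] holomorphic_intros gauss_growth_holomorphic[OF assms(1)]
        gauss_growth_holomorphic[OF assms(2)])
qed

lemma gauss_growth_add:
  assumes "gauss_growth s a" "gauss_growth s b" shows "gauss_growth s (\<lambda>z. a z + b z)"
proof -
  obtain C where C: "C \<ge> 0" "\<And>z. cmod (a z) \<le> C * exp (s * (cmod z)\<^sup>2)" using gauss_growthE[OF assms(1)] by blast
  obtain D where D: "D \<ge> 0" "\<And>z. cmod (b z) \<le> D * exp (s * (cmod z)\<^sup>2)" using gauss_growthE[OF assms(2)] by blast
  have "cmod (a z + b z) \<le> (C + D) * exp (s * (cmod z)\<^sup>2)" for z
    using norm_triangle_mono[OF C(2)[of z] D(2)[of z]] by (simp add: distrib_right)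
  then show ?thesis
    by (intro gauss_growthI[of _ "C + D"] holomorphic_intros gauss_growth_holomorphic[OF assms(1)]
        gauss_growth_holomorphic[OF assms(2)])
qed

lemma gauss_growth_cmult: "gauss_growth s h \<Longrightarrow> gauss_growth s (\<lambda>z. a * h z)"
  using gauss_growth_mult[OF gauss_growth_const[of 0 a], of s h] by simp

lemma gauss_growth_ident:
  assumes s: "s > 0" shows "gauss_growth s (\<lambda>z. z)"
proof (rule gauss_growthI[of _ "1 + 1 / s"])
  fix z :: complex
  have "cmod z \<le> 1 + (cmod z)\<^sup>2" using power2_diff[of "cmod z" "1/2"] zero_le_power2[of "cmod z - 1/2"]
    by (simp add: power2_eq_square)
  also have "\<dots> \<le> (1 + 1 / s) * (1 + s * (cmod z)\<^sup>2)" using s by (simp add: field_simps)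
  also have "\<dots> \<le> (1 + 1 / s) * exp (s * (cmod z)\<^sup>2)"
    using s by (intro mult_left_mono exp_ge_add_one_self) auto
  finally show "cmod z \<le> (1 + 1 / s) * exp (s * (cmod z)\<^sup>2)" .
qed (intro holomorphic_intros)

text \<open>The price of translating a Gaussian bound: the exponent increases by an arbitrarily small amount.\<close>

lemma square_add_le:
  fixes x y s t :: real
  assumes "0 \<le> s" "s < t" shows "s * (x + y)\<^sup>2 \<le> t * x\<^sup>2 + (s + s\<^sup>2 / (t - s)) * y\<^sup>2"
proof -
  define d where "d = t - s"
  have d: "d > 0" and t: "t = s + d" using assms by (simp_all add: d_def)
  have "0 \<le> (d * x - s * y)\<^sup>2 / d" using d by simp
  also have "\<dots> = d * x\<^sup>2 - 2 * s * x * y + s\<^sup>2 / d * y\<^sup>2"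
    using d by (simp add: field_simps power2_eq_square)
  finally show ?thesis unfolding t by (simp add: power2_sum algebra_simps)
qed

lemma gauss_growth_shift_bound:
  assumes h: "gauss_growth s h" and st: "0 \<le> s" "s < t"
  shows "\<exists>C. \<forall>z w. cmod w \<le> R \<longrightarrow> cmod (h (z + w)) \<le> C * exp (t * (cmod z)\<^sup>2)"
proof -
  obtain C where C: "C \<ge> 0" "\<And>z. cmod (h z) \<le> C * exp (s * (cmod z)\<^sup>2)" using gauss_growthE[OF h] by blast
  define K where "K = (s + s\<^sup>2 / (t - s)) * R\<^sup>2"
  have "cmod (h (z + w)) \<le> (C * exp K) * exp (t * (cmod z)\<^sup>2)" if "cmod w \<le> R" for z w
  proof -
    have "s * (cmod (z + w))\<^sup>2 \<le> s * (cmod z + R)\<^sup>2"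
      using st that by (intro mult_left_mono power_mono) (auto intro: order_trans[OF norm_triangle_ineq])
    also have "\<dots> \<le> t * (cmod z)\<^sup>2 + K" unfolding K_def by (rule square_add_le[OF st])
    finally have "exp (s * (cmod (z + w))\<^sup>2) \<le> exp (t * (cmod z)\<^sup>2 + K)" by simp
    then have "C * exp (s * (cmod (z + w))\<^sup>2) \<le> C * exp (t * (cmod z)\<^sup>2 + K)" by (rule mult_left_mono[OF _ C(1)])
    also have "C * exp (t * (cmod z)\<^sup>2 + K) = C * exp K * exp (t * (cmod z)\<^sup>2)" by (simp add: exp_add)
    finally show ?thesis using C(2)[of "z + w"] by linarith
  qed
  then show ?thesis by blast
qed

lemma gauss_growth_shift:
  assumes "gauss_growth s h" "0 \<le> s" "s < t" shows "gauss_growth t (\<lambda>z. h (z + w))"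
proof -
  obtain C where "\<forall>z w'. cmod w' \<le> cmod w \<longrightarrow> cmod (h (z + w')) \<le> C * exp (t * (cmod z)\<^sup>2)"
    using gauss_growth_shift_bound[OF assms, where R="cmod w"] by blast
  then have "\<And>z. cmod (h (z + w)) \<le> C * exp (t * (cmod z)\<^sup>2)" by blast
  then show ?thesis
    by (intro gauss_growthI[of _ C]
        holomorphic_on_compose_gen[OF _ gauss_growth_holomorphic[OF assms(1)], unfolded o_def] holomorphic_intros) auto
qed

lemma gauss_growth_uminus:
  assumes "gauss_growth s h" shows "gauss_growth s (\<lambda>z. h (- z))"
proof -
  obtain C where C: "\<And>z. cmod (h z) \<le> C * exp (s * (cmod z)\<^sup>2)" using gauss_growthE[OF assms] by blast
  show ?thesis
  proof (rule gauss_growthI[of _ C])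
    show "(\<lambda>z. h (- z)) holomorphic_on UNIV"
      by (intro holomorphic_on_compose_gen[OF _ gauss_growth_holomorphic[OF assms], unfolded o_def] holomorphic_intros) auto
  qed (use C[of "- z" for z] in auto)
qed

lemma gauss_growth_deriv:
  assumes h: "gauss_growth s h" and st: "0 \<le> s" "s < t" shows "gauss_growth t (deriv h)"
proof -
  obtain C where C: "\<forall>z w. cmod w \<le> 1 \<longrightarrow> cmod (h (z + w)) \<le> C * exp (t * (cmod z)\<^sup>2)"
    using gauss_growth_shift_bound[OF assms, where R=1] by blast
  have hol: "h holomorphic_on UNIV" using h by (rule gauss_growth_holomorphic)
  show ?thesis
  proof (rule gauss_growthI[of _ C])
    show "deriv h holomorphic_on UNIV" using hol by (intro holomorphic_deriv) auto
    fix z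
    have "cmod ((deriv ^^ 1) h z) \<le> fact 1 * (C * exp (t * (cmod z)\<^sup>2)) / 1 ^ 1"
    proof (rule Cauchy_inequality)
      show "h holomorphic_on ball z 1" using hol holomorphic_on_subset by blast
      show "continuous_on (cball z 1) h" using hol holomorphic_on_imp_continuous_on holomorphic_on_subset by blast
      fix x assume "cmod (z - x) = 1"
      then have "cmod (x - z) \<le> 1" by (simp add: norm_minus_commute)
      with C[rule_format, of "x - z" z] show "cmod (h x) \<le> C * exp (t * (cmod z)\<^sup>2)" by simp
    qed simp
    then show "cmod (deriv h z) \<le> C * exp (t * (cmod z)\<^sup>2)" by simp
  qed
qed

lemma entire_measurable:
  "h holomorphic_on UNIV \<Longrightarrow> h \<in> borel_measurable borel"
  by (intro borel_measurable_continuous_onI holomorphic_on_imp_continuous_on)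

lemma gauss_growth_integrable:
  assumes a: "gauss_growth s a" and b: "gauss_growth t b" and c: "s + t < c"
  shows "integrable lborel (\<lambda>z. a z * cnj (b z) * of_real (gauss c z))"
proof -
  obtain C where C: "C \<ge> 0" "\<And>z. cmod (a z) \<le> C * exp (s * (cmod z)\<^sup>2)" using gauss_growthE[OF a] by blast
  obtain D where D: "D \<ge> 0" "\<And>z. cmod (b z) \<le> D * exp (t * (cmod z)\<^sup>2)" using gauss_growthE[OF b] by blast
  have [measurable]: "a \<in> borel_measurable borel" "b \<in> borel_measurable borel"
    using a b by (auto intro!: entire_measurable gauss_growth_holomorphic)
  have bound: "cmod (a z * cnj (b z) * of_real (gauss c z)) \<le> cmod (of_real (C * D * gauss (c - s - t) z))" for z
  proof -
    have "cmod (a z) * cmod (b z) \<le> (C * D) * exp ((s + t) * (cmod z)\<^sup>2)"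
      using mult_mono[OF C(2)[of z] D(2)[of z]] C(1) by (simp add: distrib_right exp_add mult_ac)
    then have "cmod (a z) * cmod (b z) * gauss c z \<le> (C * D) * exp ((s + t) * (cmod z)\<^sup>2) * gauss c z"
      by (rule mult_right_mono) simp
    also have "\<dots> = C * D * gauss (c - s - t) z"
      by (simp add: gauss_def exp_add[symmetric] algebra_simps)
    finally show ?thesis using C(1) D(1) by (simp add: norm_mult)
  qed
  have "integrable lborel (\<lambda>z. complex_of_real (C * D * gauss (c - s - t) z))"
    using c by (intro integrable_of_real integrable_mult_right integrable_gauss) simp
  moreover have "(\<lambda>z. a z * cnj (b z) * of_real (gauss c z)) \<in> borel_measurable lborel" by measurable
  ultimately show ?thesis by (rule Bochner_Integration.integrable_bound[OF _ _ AE_I2[OF bound]])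
qed

text \<open>Integrating \<open>G (z + e) - G z\<close> gives zero by translation invariance. It is also the integral over \<open>t\<close> in \<open>{0..1}\<close>
  of \<open>D (z + t e)\<close>, whose integral over \<open>z\<close> does not depend on \<open>t\<close>.\<close>

lemma integral_directional_derivative_eq_0:
  fixes G D :: "complex \<Rightarrow> complex"
  assumes G: "integrable lborel G" and D: "integrable lborel D" and contD: "continuous_on UNIV D"
    and deriv: "\<And>z. ((\<lambda>t. G (z + of_real t * e)) has_vector_derivative D z) (at 0)"
  shows "(LINT z|lborel. D z) = 0"
proof -
  have [measurable]: "D \<in> borel_measurable borel" using contD by (rule borel_measurable_continuous_onI)
  have [measurable]: "G \<in> borel_measurable borel" using G by (simp add: borel_measurable_integrable)
  define k where "k t z = indicator {0..1} t *\<^sub>R D (z + of_real t * e)" for t :: real and z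
  have int2: "integrable (lborel \<Otimes>\<^sub>M lborel) (\<lambda>(t, z). k t z)"
  proof (rule lborel_pair.Fubini_integrable)
    show "(\<lambda>(t, z). k t z) \<in> borel_measurable (lborel \<Otimes>\<^sub>M lborel)"
      unfolding k_def by measurable
    have "(LINT z|lborel. norm (k t z)) = indicator {0..1} t *\<^sub>R (LINT z|lborel. norm (D z))" for t
      unfolding k_def norm_scaleR using integral_translate[of "\<lambda>z. norm (D z)" "of_real t * e"] by simp
    then show "integrable lborel (\<lambda>t. LINT z|lborel. norm (case (t, z) of (t, z) \<Rightarrow> k t z))"
      by (simp add: integrable_mult_left[OF integrable_real_indicator])
    show "AE t in lborel. integrable lborel (\<lambda>z. case (t, z) of (t, z) \<Rightarrow> k t z)"
      unfolding k_def using D by (simp add: integrable_translate)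
  qed
  have "(LINT t|lborel. LINT z|lborel. k t z) = (LINT t|lborel. indicator {0..1::real} t *\<^sub>R (LINT z|lborel. D z))"
    unfolding k_def using integral_translate[of D] by simp
  then have 1: "(LINT t|lborel. LINT z|lborel. k t z) = (LINT z|lborel. D z)" by simp
  have FTC: "(LINT t|lborel. k t z) = G (z + e) - G z" for z
  proof -
    have der: "((\<lambda>t. G (z + of_real t * e)) has_vector_derivative D (z + of_real s * e)) (at s)" for s
    proof -
      have "((\<lambda>t. G (z + of_real s * e + of_real t * e)) \<circ> (\<lambda>t. t - s) has_vector_derivative 1 *\<^sub>R D (z + of_real s * e)) (at s)"
        by (rule vector_diff_chain_at) (auto intro!: derivative_eq_intros simp: deriv)
      then show ?thesis by (simp add: o_def algebra_simps)
    qed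
    have "continuous_on {0..1} (\<lambda>t. D (z + of_real t * e))"
      by (rule continuous_on_compose2[OF contD]) (auto intro!: continuous_intros)
    then have "(LINT t|lborel. indicator {0..1} t *\<^sub>R D (z + of_real t * e)) =
        G (z + of_real 1 * e) - G (z + of_real 0 * e)"
      by (intro integral_FTC_atLeastAtMost has_vector_derivative_at_within[OF der]) simp_all
    then show ?thesis by (simp add: k_def)
  qed
  have "(LINT z|lborel. LINT t|lborel. k t z) = (LINT z|lborel. G (z + e)) - (LINT z|lborel. G z)"
    unfolding FTC using G by (intro Bochner_Integration.integral_diff) (simp_all add: integrable_translate)
  also have "\<dots> = 0" by (simp add: integral_translate)
  finally show ?thesis using 1 lborel_pair.Fubini_integral[OF int2] by simp
qed

text \<open>The two summands are the Wirtinger derivatives of \<open>a (cnj b) gauss c\<close>, of which only the first differentiates \<open>a\<close> and only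
  the second differentiates \<open>b\<close>.\<close>

lemma has_vector_derivative_gaussian_product:
  assumes hol: "a holomorphic_on UNIV" "b holomorphic_on UNIV"
  shows "((\<lambda>t. a (z + of_real t * e) * cnj (b (z + of_real t * e)) * of_real (gauss c (z + of_real t * e)))
    has_vector_derivative
      (e * ((deriv a z - of_real c * cnj z * a z) * cnj (b z) * of_real (gauss c z)) +
       cnj e * (a z * cnj (deriv b z - of_real c * cnj z * b z) * of_real (gauss c z)))) (at 0)"
proof -
  have lin: "((\<lambda>t. z + of_real t * e) has_vector_derivative e) (at 0)"
    by (auto intro!: derivative_eq_intros)
  have h: "((\<lambda>t. h (z + of_real t * e)) has_vector_derivative (e * deriv h z)) (at 0)"
    if "h holomorphic_on UNIV" for h
    using field_vector_diff_chain_at[OF lin, of h "deriv h z"] holomorphic_derivI[OF that open_UNIV, of z]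
    by (simp add: o_def)
  have cnj': "((\<lambda>t. cnj (h t)) has_vector_derivative cnj h') (at 0)"
    if "(h has_vector_derivative h') (at 0)" for h :: "real \<Rightarrow> complex" and h'
    using bounded_linear.has_vector_derivative[OF bounded_linear_cnj that] .
  have "((\<lambda>t. - of_real c * ((z + of_real t * e) * cnj (z + of_real t * e))) has_vector_derivative
      - of_real c * (z * cnj e + e * cnj z)) (at 0)"
    by (auto intro!: derivative_eq_intros lin cnj'[OF lin])
  from field_vector_diff_chain_at[OF this DERIV_exp]
  have g: "((\<lambda>t. of_real (gauss c (z + of_real t * e))) has_vector_derivative
      - of_real c * (z * cnj e + e * cnj z) * of_real (gauss c z)) (at 0)"
    unfolding of_real_gauss by (simp add: o_def mult.assoc)
  show ?thesis
      by (rule has_vector_derivative_eq_rhs[OF has_vector_derivative_mult[OF has_vector_derivative_mult[OF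
          h[OF hol(1)] cnj'[OF h[OF hol(2)]]] g]])
       (simp add: algebra_simps)
qed

text \<open>For the weight \<open>gauss c\<close>, differentiation and multiplication by \<open>c z\<close> are adjoint to each other on entire functions.\<close>

lemma gauss_growth_integration_by_parts:
  assumes a: "gauss_growth s a" and b: "gauss_growth t b" and st: "0 \<le> s" "0 \<le> t" "s + t < c"
  shows "(LINT z|lborel. (deriv a z - of_real c * cnj z * a z) * cnj (b z) * of_real (gauss c z)) = 0"
proof -
  define G where "G z = a z * cnj (b z) * of_real (gauss c z)" for z
  define D1 where "D1 z = (deriv a z - of_real c * cnj z * a z) * cnj (b z) * of_real (gauss c z)" for z
  define D2 where "D2 z = a z * cnj (deriv b z - of_real c * cnj z * b z) * of_real (gauss c z)" for z
  define r where "r = (c - s - t) / 3"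
  have r: "r > 0" "s + t + 2 * r < c" using st by (auto simp: r_def field_simps)
  have hol: "a holomorphic_on UNIV" "b holomorphic_on UNIV" using a b gauss_growth_holomorphic by auto
  have cont: "continuous_on UNIV a" "continuous_on UNIV b" "continuous_on UNIV (deriv a)" "continuous_on UNIV (deriv b)"
    using hol by (auto intro!: holomorphic_on_imp_continuous_on holomorphic_deriv)
  have da: "gauss_growth (s + r) (deriv a)" and db: "gauss_growth (t + r) (deriv b)"
    using gauss_growth_deriv[OF a, of "s + r"] gauss_growth_deriv[OF b, of "t + r"] st r by auto
  have za: "gauss_growth (r + s) (\<lambda>z. z * a z)" and zb: "gauss_growth (r + t) (\<lambda>z. z * b z)"
    by (intro gauss_growth_mult gauss_growth_ident a b r)+
  have iG: "integrable lborel G"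
    unfolding G_def by (rule gauss_growth_integrable[OF a b st(3)])
  have i1: "integrable lborel D1"
  proof -
    have "integrable lborel (\<lambda>z. deriv a z * cnj (b z) * of_real (gauss c z)
        - of_real c * (a z * cnj (z * b z) * of_real (gauss c z)))"
      using r by (intro Bochner_Integration.integrable_diff integrable_mult_right gauss_growth_integrable[OF da b]
          gauss_growth_integrable[OF a zb]) auto
    then show ?thesis by (simp add: D1_def[abs_def] algebra_simps)
  qed
  have i2: "integrable lborel D2"
  proof -
    have "integrable lborel (\<lambda>z. a z * cnj (deriv b z) * of_real (gauss c z)
        - of_real c * (z * a z * cnj (b z) * of_real (gauss c z)))"
      using r by (intro Bochner_Integration.integrable_diff integrable_mult_right gauss_growth_integrable[OF a db]
          gauss_growth_integrable[OF za b]) auto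
    then show ?thesis by (simp add: D2_def[abs_def] algebra_simps)
  qed
  have contD: "continuous_on UNIV D1" "continuous_on UNIV D2"
    unfolding D1_def D2_def using cont by (auto intro!: continuous_intros)
  have dG: "((\<lambda>t. G (z + of_real t * e)) has_vector_derivative (e * D1 z + cnj e * D2 z)) (at 0)" for e z
    unfolding G_def D1_def D2_def by (rule has_vector_derivative_gaussian_product[OF hol])
  have "(LINT z|lborel. e * D1 z + cnj e * D2 z) = 0" for e
    by (rule integral_directional_derivative_eq_0[OF iG _ _ dG])
       (use i1 i2 contD in \<open>auto intro!: continuous_intros\<close>)
  then have *: "e * (LINT z|lborel. D1 z) + cnj e * (LINT z|lborel. D2 z) = 0" for e
    using i1 i2 by simp
  \<comment> \<open>The directions 1 and i separate the two Wirtinger derivatives.\<close>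
  from *[of 1] *[of \<i>] have "(LINT z|lborel. D1 z) = 0"
    by (simp add: complex_eq_iff)
  then show ?thesis by (simp add: D1_def)
qed

lemma integrable_dominated:
  fixes f :: "'a \<Rightarrow> 'b::{banach, second_countable_topology}" and g :: "'a \<Rightarrow> real"
  assumes "f \<in> borel_measurable M" "integrable M g" "\<And>x. norm (f x) \<le> g x"
  shows "integrable M f"
  using assms(2,1) by (rule Bochner_Integration.integrable_bound) (auto intro!: AE_I2 order_trans[OF assms(3)])

section \<open>The Bargmann-Fock space\<close>

lemma gauss_growth_exp:
  assumes s: "s > 0" shows "gauss_growth s (\<lambda>z. exp (a * z))"
proof (rule gauss_growthI[of _ "exp ((cmod a)\<^sup>2 / (4 * s))"])
  fix z
  have "0 \<le> (2 * s * cmod z - cmod a)\<^sup>2 / (4 * s)" using s by simp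
  also have "\<dots> = s * (cmod z)\<^sup>2 - cmod a * cmod z + (cmod a)\<^sup>2 / (4 * s)"
    using s by (simp add: field_simps power2_eq_square)
  finally have "Re (a * z) \<le> (cmod a)\<^sup>2 / (4 * s) + s * (cmod z)\<^sup>2"
    using complex_Re_le_cmod[of "a * z"] by (simp add: norm_mult)
  then show "cmod (exp (a * z)) \<le> exp ((cmod a)\<^sup>2 / (4 * s)) * exp (s * (cmod z)\<^sup>2)"
    by (simp add: exp_add[symmetric])
qed (intro holomorphic_intros)

lemma gauss_shift:
  "complex_of_real (gauss 1 (z + w)) = of_real (gauss 1 z) * of_real (gauss 1 w) * exp (- w * cnj z) * exp (- cnj w * z)"
  unfolding of_real_gauss by (simp add: exp_add[symmetric] algebra_simps)

text \<open>The magnetic translation by \<open>w\<close> moves the point of evaluation to the origin, where the formula is the mean value property.\<close>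

lemma fock_reproducing:
  assumes h: "gauss_growth s h" and s: "0 \<le> s" "s < 1"
  shows "(LINT z|lborel. h z * exp (w * cnj z) * of_real (gauss 1 z)) = of_real pi * h w"
proof -
  have hol: "h holomorphic_on UNIV" using h by (rule gauss_growth_holomorphic)
  have [measurable]: "h \<in> borel_measurable borel" using hol by (rule entire_measurable)
  define F where "F z = h z * exp (w * cnj z) * of_real (gauss 1 z)" for z
  have [measurable]: "F \<in> borel_measurable borel" unfolding F_def by measurable
  have F: "integrable lborel F"
    using gauss_growth_integrable[OF h gauss_growth_exp[of "(1 - s) / 2" "cnj w"], of 1] s
    by (simp add: F_def[abs_def] exp_cnj field_simps)
  have shift: "h (z + w) * exp (- cnj w * z) * of_real (gauss 1 z) = F (z + w)" for z
  proof -
    have "exp (w * cnj (z + w)) * of_real (gauss 1 w) * exp (- w * cnj z) = 1"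
      unfolding of_real_gauss by (simp add: exp_add[symmetric] algebra_simps)
    then show ?thesis unfolding F_def gauss_shift by (simp add: algebra_simps)
  qed
  have "(LINT z|lborel. h (z + w) * exp (- cnj w * z) * of_real (gauss 1 z)) = of_real (pi / 1) * (h (0 + w) * exp (- cnj w * 0))"
  proof (rule entire_gaussian_mean)
    show "(\<lambda>z. h (z + w) * exp (- cnj w * z)) holomorphic_on UNIV"
      by (intro holomorphic_intros holomorphic_on_compose_gen[OF _ hol, unfolded o_def]) auto
    show "integrable lborel (\<lambda>z. h (z + w) * exp (- cnj w * z) * of_real (gauss 1 z))"
      unfolding shift using F by (simp add: integrable_translate)
  qed simp
  then have "(LINT z|lborel. F (z + w)) = of_real pi * h w" unfolding shift by simp
  then have "(LINT z|lborel. F z) = of_real pi * h w" by (simp only: integral_translate[OF \<open>F \<in> borel_measurable borel\<close>])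
  then show ?thesis by (simp add: F_def)
qed

text \<open>The predicate \<open>fock f\<close> says that \<open>exp (- |z|\<^sup>2 / 2) f z\<close> belongs to the Bargmann-Fock space. Working with the entire factor
  keeps the Gaussian weight explicit in every integral.\<close>

definition fock :: "(complex \<Rightarrow> complex) \<Rightarrow> bool" where
  "fock f \<longleftrightarrow> f holomorphic_on UNIV \<and> integrable lborel (\<lambda>z. (cmod (f z))\<^sup>2 * gauss 1 z)"

lemma fock_holomorphic: "fock f \<Longrightarrow> f holomorphic_on UNIV"
  and fock_integrable_square: "fock f \<Longrightarrow> integrable lborel (\<lambda>z. (cmod (f z))\<^sup>2 * gauss 1 z)"
  by (simp_all add: fock_def)

text \<open>The mean value property holds for every entire function that is integrable against the Gaussian, so it can be applied to the square of
  the magnetic translate of \<open>f\<close>. All growth bounds on elements of the space come from here.\<close>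

lemma fock_pointwise_bound:
  assumes f: "fock f"
  shows "(cmod (f w))\<^sup>2 * gauss 1 w \<le> (LINT z|lborel. (cmod (f z))\<^sup>2 * gauss 1 z) / pi"
proof -
  have hol: "f holomorphic_on UNIV" using f by (rule fock_holomorphic)
  have [measurable]: "f \<in> borel_measurable borel" using hol by (rule entire_measurable)
  define k where "k z = (f (z + w) * exp (- cnj w * z))\<^sup>2" for z
  let ?G = "\<lambda>z. (cmod (f z))\<^sup>2 * gauss 1 z"
  have norm: "norm (k z * of_real (gauss 1 z)) = ?G (z + w) * exp ((cmod w)\<^sup>2)" for z
  proof -
    have "(cmod (z + w))\<^sup>2 = (cmod z)\<^sup>2 + (cmod w)\<^sup>2 + 2 * Re (cnj w * z)"
      unfolding cmod_power2 by (simp add: power2_eq_square algebra_simps)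
    then have "(exp (- Re (cnj w * z)))\<^sup>2 * gauss 1 z = gauss 1 (z + w) * exp ((cmod w)\<^sup>2)"
      unfolding gauss_def power2_eq_square by (simp add: exp_add[symmetric])
    then show ?thesis by (simp add: k_def norm_mult norm_power power_mult_distrib mult.assoc)
  qed
  have i0: "integrable lborel (\<lambda>z. norm (k z * of_real (gauss 1 z)))"
    unfolding norm using fock_integrable_square[OF f] integrable_translate[of ?G w] by simp
  have i: "integrable lborel (\<lambda>z. k z * of_real (gauss 1 z))"
    by (rule integrable_norm_cancel[OF i0]) (unfold k_def, measurable)
  have "k holomorphic_on UNIV" unfolding k_def
    by (intro holomorphic_intros holomorphic_on_compose_gen[OF _ hol, unfolded o_def]) auto
  from entire_gaussian_mean[OF this zero_less_one i]
  have "pi * (cmod (f w))\<^sup>2 = norm (LINT z|lborel. k z * of_real (gauss 1 z))"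
    by (simp add: k_def norm_mult norm_power)
  also have "\<dots> \<le> (LINT z|lborel. norm (k z * of_real (gauss 1 z)))" by (rule integral_norm_bound)
  also have "\<dots> = (LINT z|lborel. ?G z) * exp ((cmod w)\<^sup>2)"
    unfolding norm by (simp add: integral_translate[of ?G])
  finally have "pi * (cmod (f w))\<^sup>2 * gauss 1 w \<le> (LINT z|lborel. ?G z) * exp ((cmod w)\<^sup>2) * gauss 1 w"
    by (intro mult_right_mono) auto
  also have "\<dots> = (LINT z|lborel. ?G z)" by (simp add: gauss_def exp_minus)
  finally show ?thesis by (simp add: field_simps)
qed

lemma fock_bounded:
  assumes f: "fock f"
  obtains C where "C \<ge> 0" "\<And>z. cmod (f z) * gauss (1/2) z \<le> C"
proof -
  define C where "C = (LINT z|lborel. (cmod (f z))\<^sup>2 * gauss 1 z) / pi"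
  have "(cmod (f z) * gauss (1/2) z)\<^sup>2 \<le> C" for z
    using fock_pointwise_bound[OF f, of z] gauss_mult[of "1/2" z "1/2"]
    by (simp add: C_def power_mult_distrib power2_eq_square[of "gauss _ _"])
  then have "cmod (f z) * gauss (1/2) z \<le> sqrt C" for z by (rule real_le_rsqrt)
  moreover have "0 \<le> sqrt C" using calculation[of 0] by (rule order_trans[rotated]) simp
  ultimately show thesis by (rule that[rotated])
qed

lemma fock_gauss_growth:
  assumes f: "fock f" shows "gauss_growth (1/2) f"
proof -
  obtain C where C: "\<And>z. cmod (f z) * gauss (1/2) z \<le> C" using fock_bounded[OF f] by blast
  have "cmod (f z) \<le> C * exp (1/2 * (cmod z)\<^sup>2)" for z
    using mult_right_mono[OF C[of z], of "exp (1/2 * (cmod z)\<^sup>2)"]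
    by (simp add: gauss_def mult.assoc exp_add[symmetric])
  then show ?thesis by (rule gauss_growthI[OF fock_holomorphic[OF f]])
qed

lemma fock_add: assumes a: "fock a" and b: "fock b" shows "fock (\<lambda>z. a z + b z)"
proof -
  have [measurable]: "a \<in> borel_measurable borel" "b \<in> borel_measurable borel"
    using a b by (auto intro: entire_measurable fock_holomorphic)
  have "integrable lborel (\<lambda>z. 2 * ((cmod (a z))\<^sup>2 * gauss 1 z) + 2 * ((cmod (b z))\<^sup>2 * gauss 1 z))"
    using a b by (intro Bochner_Integration.integrable_add integrable_mult_right fock_integrable_square)
  moreover have "norm ((cmod (a z + b z))\<^sup>2 * gauss 1 z) \<le>
      (2 * ((cmod (a z))\<^sup>2 * gauss 1 z) + 2 * ((cmod (b z))\<^sup>2 * gauss 1 z))" for z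
  proof -
    have "(cmod (a z + b z))\<^sup>2 \<le> (cmod (a z) + cmod (b z))\<^sup>2" by (intro power_mono norm_triangle_ineq) simp
    also have "\<dots> \<le> 2 * (cmod (a z))\<^sup>2 + 2 * (cmod (b z))\<^sup>2"
      using zero_le_power2[of "cmod (a z) - cmod (b z)"] by (simp add: power2_eq_square algebra_simps)
    finally show ?thesis using mult_right_mono[of _ _ "gauss 1 z"] by (fastforce simp: algebra_simps abs_mult)
  qed
  ultimately have "integrable lborel (\<lambda>z. (cmod (a z + b z))\<^sup>2 * gauss 1 z)"
    by (rule integrable_dominated[rotated]) simp
  then show ?thesis using a b by (simp add: fock_def holomorphic_intros)
qed

lemma integrable_fock_mult_bounded:
  assumes a: "fock a" and b: "fock b"
    and r: "r \<in> borel_measurable borel" "\<And>z. cmod (r z) \<le> C"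
  shows "integrable lborel (\<lambda>z. r z * (a z * cnj (b z) * of_real (gauss 1 z)))"
proof -
  have [measurable]: "a \<in> borel_measurable borel" "b \<in> borel_measurable borel" "r \<in> borel_measurable borel"
    using a b r by (auto intro: entire_measurable fock_holomorphic)
  have C: "0 \<le> C" using order_trans[OF norm_ge_zero r(2)[of 0]] .
  have "integrable lborel (\<lambda>z. C * ((cmod (a z))\<^sup>2 * gauss 1 z) + C * ((cmod (b z))\<^sup>2 * gauss 1 z))"
    using a b by (intro Bochner_Integration.integrable_add integrable_mult_right fock_integrable_square)
  moreover have "norm (r z * (a z * cnj (b z) * of_real (gauss 1 z))) \<le>
      (C * ((cmod (a z))\<^sup>2 * gauss 1 z) + C * ((cmod (b z))\<^sup>2 * gauss 1 z))" for z
  proof -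
    have "cmod (a z) * cmod (b z) \<le> (cmod (a z))\<^sup>2 + (cmod (b z))\<^sup>2"
      using sum_squares_bound[of "cmod (a z)" "cmod (b z)"] norm_ge_zero[of "a z"] norm_ge_zero[of "b z"]
        mult_nonneg_nonneg[of "cmod (a z)" "cmod (b z)"] by linarith
    then have "cmod (r z) * ((cmod (a z) * cmod (b z)) * gauss 1 z) \<le> C * (((cmod (a z))\<^sup>2 + (cmod (b z))\<^sup>2) * gauss 1 z)"
      using r(2)[of z] C by (intro mult_mono) auto
    then show ?thesis using C by (simp add: norm_mult algebra_simps)
  qed
  ultimately show ?thesis
    by (rule integrable_dominated[rotated]) simp
qed

lemma integrable_fock_mult:
  assumes "fock a" "fock b"
  shows "integrable lborel (\<lambda>z. a z * cnj (b z) * of_real (gauss 1 z))"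
  using integrable_fock_mult_bounded[OF assms, of "\<lambda>_. 1" 1] by simp

text \<open>Multiplying by \<open>gauss (1 / (n + 1))\<close> turns the weight \<open>gauss c\<close> into a strictly better one; the limit in \<open>n\<close> recovers the
  integral.\<close>

lemma gauss_damping:
  fixes k :: "complex \<Rightarrow> 'a :: {banach, second_countable_topology}"
  assumes k: "integrable lborel k"
  shows "(\<lambda>n. LINT z|lborel. gauss (1 / real (Suc n)) z *\<^sub>R k z) \<longlonglongrightarrow> (LINT z|lborel. k z)"
proof (rule integral_dominated_convergence[where w="\<lambda>z. norm (k z)"])
  have [measurable]: "k \<in> borel_measurable borel" using k by (simp add: borel_measurable_integrable)
  show "k \<in> borel_measurable lborel" "\<And>n. (\<lambda>z. gauss (1 / real (Suc n)) z *\<^sub>R k z) \<in> borel_measurable lborel"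
    by measurable
  show "AE z in lborel. (\<lambda>n. gauss (1 / real (Suc n)) z *\<^sub>R k z) \<longlonglongrightarrow> k z"
  proof (rule AE_I2)
    fix z
    have "(\<lambda>n. gauss (1 / real (Suc n)) z) \<longlonglongrightarrow> exp (- 0 * (cmod z)\<^sup>2)"
      unfolding gauss_def by (intro tendsto_intros LIMSEQ_inverse_real_of_nat[unfolded inverse_eq_divide])
    then have "(\<lambda>n. gauss (1 / real (Suc n)) z *\<^sub>R k z) \<longlonglongrightarrow> exp (- 0 * (cmod z)\<^sup>2) *\<^sub>R k z"
      by (intro tendsto_intros)
    then show "(\<lambda>n. gauss (1 / real (Suc n)) z *\<^sub>R k z) \<longlonglongrightarrow> k z" by simp
  qed
  show "AE z in lborel. norm (gauss (1 / real (Suc n)) z *\<^sub>R k z) \<le> norm (k z)" for n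
    by (rule AE_I2) (auto simp: gauss_def intro!: mult_left_le_one_le)
qed (use k in simp)

text \<open>The case where the growth of \<open>a\<close> and \<open>b\<close> is only just not integrable for the weight \<open>gauss c\<close>. The identity for \<open>c + \<epsilon>\<close> has the error term
  \<open>\<epsilon> \<integral> cnj z a (cnj b) gauss (c + \<epsilon>)\<close>, and \<open>\<epsilon> |z| gauss \<epsilon> z \<le> sqrt \<epsilon>\<close>. Only one real linear combination
  of the real and imaginary parts of the integrand is assumed to be integrable, since cancellations occur in that combination alone.\<close>

lemma integration_by_parts_limit:
  assumes a: "\<And>s. c / 2 < s \<Longrightarrow> gauss_growth s a" and b: "\<And>s. c / 2 < s \<Longrightarrow> gauss_growth s b" and c: "0 < c"
    and i0: "integrable lborel (\<lambda>z. a z * cnj (b z) * of_real (gauss c z))"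
    and i1: "integrable lborel (\<lambda>z. Re (g * ((deriv a z - of_real c * cnj z * a z) * cnj (b z))) * gauss c z)"
  shows "(LINT z|lborel. Re (g * ((deriv a z - of_real c * cnj z * a z) * cnj (b z))) * gauss c z) = 0"
proof -
  define X where "X z = (deriv a z - of_real c * cnj z * a z) * cnj (b z)" for z
  define Y where "Y z = a z * cnj (b z) * of_real (gauss c z)" for z
  define e where "e n = 1 / real (Suc n)" for n
  have e: "e n > 0" for n by (simp add: e_def)
  have hol: "a holomorphic_on UNIV" "b holomorphic_on UNIV"
    using a[of c] b[of c] c gauss_growth_holomorphic by auto
  have [measurable]: "a \<in> borel_measurable borel" "b \<in> borel_measurable borel" "deriv a \<in> borel_measurable borel"
    using hol by (auto intro!: entire_measurable holomorphic_deriv)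
  have iXn: "integrable lborel (\<lambda>z. X z * of_real (gauss (c + e n) z))"
    and step: "cmod (LINT z|lborel. X z * of_real (gauss (c + e n) z)) \<le> sqrt (e n) * (LINT z|lborel. cmod (Y z))" for n
  proof -
    define d where "d = e n / 5"
    have d: "d > 0" "e n = 5 * d" using e[of n] by (auto simp: d_def)
    have ga: "gauss_growth (c/2 + d) a" and gb: "gauss_growth (c/2 + d) b" using a b d by auto
    have gza: "gauss_growth (d + (c/2 + d)) (\<lambda>z. z * b z)"
      by (intro gauss_growth_mult gauss_growth_ident gb d)
    have gda: "gauss_growth (c/2 + 2*d) (deriv a)"
      using gauss_growth_deriv[OF ga, of "c/2 + 2*d"] c d by simp
    have iX: "integrable lborel (\<lambda>z. (deriv a z - of_real (c + e n) * cnj z * a z) * cnj (b z) * of_real (gauss (c + e n) z))"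
      and iz: "integrable lborel (\<lambda>z. of_real (e n) * (a z * cnj (z * b z) * of_real (gauss (c + e n) z)))"
    proof -
      have "integrable lborel (\<lambda>z. deriv a z * cnj (b z) * of_real (gauss (c + e n) z)
          - of_real (c + e n) * (a z * cnj (z * b z) * of_real (gauss (c + e n) z)))"
        using d by (intro Bochner_Integration.integrable_diff integrable_mult_right gauss_growth_integrable[OF gda gb]
          gauss_growth_integrable[OF ga gza]) auto
      then show "integrable lborel (\<lambda>z. (deriv a z - of_real (c + e n) * cnj z * a z) * cnj (b z) * of_real (gauss (c + e n) z))"
        by (simp add: algebra_simps)
      show "integrable lborel (\<lambda>z. of_real (e n) * (a z * cnj (z * b z) * of_real (gauss (c + e n) z)))"
        using d by (intro integrable_mult_right gauss_growth_integrable[OF ga gza]) auto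
    qed
    have split: "X z * of_real (gauss (c + e n) z) =
      (deriv a z - of_real (c + e n) * cnj z * a z) * cnj (b z) * of_real (gauss (c + e n) z)
        + of_real (e n) * (a z * cnj (z * b z) * of_real (gauss (c + e n) z))" for z
      by (simp add: X_def algebra_simps)
    show "integrable lborel (\<lambda>z. X z * of_real (gauss (c + e n) z))"
      unfolding split by (rule Bochner_Integration.integrable_add[OF iX iz])
    have "(LINT z|lborel. X z * of_real (gauss (c + e n) z)) =
      (LINT z|lborel. (deriv a z - of_real (c + e n) * cnj z * a z) * cnj (b z) * of_real (gauss (c + e n) z)
        + of_real (e n) * (a z * cnj (z * b z) * of_real (gauss (c + e n) z)))"
      by (simp only: split)
    also have "\<dots> = (LINT z|lborel. of_real (e n) * (a z * cnj (z * b z) * of_real (gauss (c + e n) z)))"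
      using gauss_growth_integration_by_parts[OF ga gb, of "c + e n"] c d
      by (subst Bochner_Integration.integral_add[OF iX iz]) simp
    finally have "cmod (LINT z|lborel. X z * of_real (gauss (c + e n) z)) \<le>
        (LINT z|lborel. cmod (of_real (e n) * (a z * cnj (z * b z) * of_real (gauss (c + e n) z))))"
      by (simp only: integral_norm_bound)
    also have "\<dots> \<le> (LINT z|lborel. sqrt (e n) * cmod (Y z))"
    proof (rule integral_mono)
      show "integrable lborel (\<lambda>z. cmod (of_real (e n) * (a z * cnj (z * b z) * of_real (gauss (c + e n) z))))"
        using iz by (rule integrable_norm)
      show "integrable lborel (\<lambda>z. sqrt (e n) * cmod (Y z))"
        using i0 by (intro integrable_mult_right integrable_norm) (simp add: Y_def[abs_def])
      fix z
      have "sqrt (e n) * cmod z \<le> 1 + (sqrt (e n) * cmod z)\<^sup>2"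
        using zero_le_power2[of "sqrt (e n) * cmod z - 1/2"] by (simp add: power2_eq_square algebra_simps)
      also have "\<dots> = 1 + e n * (cmod z)\<^sup>2" using e[of n] by (simp add: power_mult_distrib)
      also have "\<dots> \<le> exp (e n * (cmod z)\<^sup>2)" by (rule exp_ge_add_one_self)
      finally have "sqrt (e n) * (sqrt (e n) * cmod z) * gauss (e n) z \<le> sqrt (e n) * exp (e n * (cmod z)\<^sup>2) * gauss (e n) z"
        using e[of n] by (intro mult_right_mono mult_left_mono) auto
      also have "\<dots> = sqrt (e n)" by (simp add: gauss_def mult.assoc exp_add[symmetric])
      also have "sqrt (e n) * (sqrt (e n) * cmod z) = e n * cmod z"
        using e[of n] by (simp add: mult.assoc[symmetric])
      finally have "e n * cmod z * gauss (e n) z \<le> sqrt (e n)" .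
      then have "(e n * cmod z * gauss (e n) z) * cmod (Y z) \<le> sqrt (e n) * cmod (Y z)"
        by (rule mult_right_mono) simp
      then show "cmod (of_real (e n) * (a z * cnj (z * b z) * of_real (gauss (c + e n) z))) \<le> sqrt (e n) * cmod (Y z)"
        using e[of n] by (simp add: Y_def norm_mult gauss_mult[symmetric] mult_ac)
    qed
    finally show "cmod (LINT z|lborel. X z * of_real (gauss (c + e n) z)) \<le> sqrt (e n) * (LINT z|lborel. cmod (Y z))" by simp
  qed
  have "(\<lambda>n. sqrt (e n) * (LINT z|lborel. cmod (Y z))) \<longlonglongrightarrow> sqrt 0 * (LINT z|lborel. cmod (Y z))"
    unfolding e_def by (intro tendsto_intros LIMSEQ_inverse_real_of_nat[unfolded inverse_eq_divide])
  then have "(\<lambda>n. LINT z|lborel. X z * of_real (gauss (c + e n) z)) \<longlonglongrightarrow> 0"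
    by (intro Lim_null_comparison[OF always_eventually[OF allI[OF step]]]) simp
  then have "(\<lambda>n. Re (g * (LINT z|lborel. X z * of_real (gauss (c + e n) z)))) \<longlonglongrightarrow> Re (g * 0)"
    by (intro tendsto_intros)
  moreover have "Re (g * (LINT z|lborel. X z * of_real (gauss (c + e n) z))) =
      (LINT z|lborel. gauss (1 / real (Suc n)) z *\<^sub>R (Re (g * X z) * gauss c z))" for n
  proof -
    have "Re (g * (LINT z|lborel. X z * of_real (gauss (c + e n) z))) =
        (LINT z|lborel. Re (g * (X z * of_real (gauss (c + e n) z))))"
      using integral_Re[OF integrable_mult_right[OF iXn[of n], of g]] by (simp only: integral_mult_right_zero)
    moreover have "Re (g * (X z * of_real (gauss (c + e n) z))) =
        gauss (1 / real (Suc n)) z *\<^sub>R (Re (g * X z) * gauss c z)" for z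
      unfolding gauss_mult[symmetric] e_def by (simp add: algebra_simps)
    ultimately show ?thesis by simp
  qed
  ultimately have "(\<lambda>n. LINT z|lborel. gauss (1 / real (Suc n)) z *\<^sub>R (Re (g * X z) * gauss c z)) \<longlonglongrightarrow> 0" by simp
  with gauss_damping[OF i1, folded X_def] show ?thesis unfolding X_def by (rule LIMSEQ_unique)
qed

section \<open>Differentiation and the projection\<close>

lemma mult_cnj_cmod: "z * cnj z = (of_real (cmod z))\<^sup>2"
  using complex_norm_square[of z] by simp

lemma integration_by_parts_L1:
  assumes a: "\<And>s. c / 2 < s \<Longrightarrow> gauss_growth s a" and b: "\<And>s. c / 2 < s \<Longrightarrow> gauss_growth s b" and c: "0 < c"
    and i0: "integrable lborel (\<lambda>z. a z * cnj (b z) * of_real (gauss c z))"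
    and i1: "integrable lborel (\<lambda>z. (deriv a z - of_real c * cnj z * a z) * cnj (b z) * of_real (gauss c z))"
  shows "(LINT z|lborel. (deriv a z - of_real c * cnj z * a z) * cnj (b z) * of_real (gauss c z)) = 0"
proof -
  define X where "X z = (deriv a z - of_real c * cnj z * a z) * cnj (b z) * of_real (gauss c z)" for z
  have "Re (g * ((deriv a z - of_real c * cnj z * a z) * cnj (b z))) * gauss c z = Re (g * X z)" for g z
  proof -
    have "Re (x * of_real r) = Re x * r" for x r by simp
    from this[of "g * ((deriv a z - of_real c * cnj z * a z) * cnj (b z))" "gauss c z"]
    show ?thesis unfolding X_def by (simp only: mult.assoc)
  qed
  moreover have iX: "integrable lborel X" using i1 by (simp add: X_def[abs_def])
  ultimately have "(LINT z|lborel. Re (g * X z)) = 0" for g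
    using integration_by_parts_limit[OF a b c i0, of g] by simp
  then have "Re (g * (LINT z|lborel. X z)) = 0" for g
    using integral_Re[OF integrable_mult_right[OF iX, of g]] by simp
  from this[of 1] this[of "- \<i>"] show ?thesis unfolding X_def[symmetric] by (simp add: complex_eq_iff)
qed

lemma deriv_ident_mult: "f holomorphic_on UNIV \<Longrightarrow> deriv (\<lambda>z. z * f z) z = f z + z * deriv f z"
  by (rule DERIV_imp_deriv) (auto intro!: derivative_eq_intros holomorphic_derivI[where S=UNIV])

text \<open>For weights \<open>gauss c\<close> with \<open>c > 1\<close> two integrations by parts express the norm of \<open>f'\<close> through those of \<open>z f\<close> and
  \<open>f\<close>. The monotone limit \<open>c \<rightarrow> 1\<close> gives membership of \<open>f'\<close> and the commutation relation \<open>[\<partial>, z] = 1\<close> in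
  integrated form at the same time.\<close>

lemma fock_deriv:
  assumes f: "fock f" and zf: "fock (\<lambda>z. z * f z)"
  shows "fock (deriv f)"
    and "(LINT z|lborel. (cmod (deriv f z))\<^sup>2 * gauss 1 z) =
      (LINT z|lborel. (cmod (z * f z))\<^sup>2 * gauss 1 z) - (LINT z|lborel. (cmod (f z))\<^sup>2 * gauss 1 z)"
proof -
  have hol: "f holomorphic_on UNIV" using f by (rule fock_holomorphic)
  have [measurable]: "f \<in> borel_measurable borel" "deriv f \<in> borel_measurable borel"
    using hol by (auto intro!: entire_measurable holomorphic_deriv)
  have "integrable lborel (\<lambda>z. (cmod (deriv f z))\<^sup>2 * gauss c z) \<and>
      (LINT z|lborel. (cmod (deriv f z))\<^sup>2 * gauss c z) =
      c * (c * (LINT z|lborel. (cmod (z * f z))\<^sup>2 * gauss c z) - (LINT z|lborel. (cmod (f z))\<^sup>2 * gauss c z))"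
    if c: "c > 1" for c
  proof -
    define d where "d = (c - 1) / 5"
    have d: "d > 0" "c = 1 + 5 * d" using c by (auto simp: d_def field_simps)
    note g0 = fock_gauss_growth[OF f] and g1 = fock_gauss_growth[OF zf]
    have g2: "gauss_growth (1/2 + d) (deriv f)" using gauss_growth_deriv[OF g0, of "1/2 + d"] d by simp
    have g3: "gauss_growth (d + (1/2 + d)) (\<lambda>z. z * deriv f z)"
      using d by (intro gauss_growth_mult gauss_growth_ident g2) auto
    define A where "A = (LINT z|lborel. deriv f z * cnj (deriv f z) * of_real (gauss c z))"
    define B where "B = (LINT z|lborel. f z * cnj (z * deriv f z) * of_real (gauss c z))"
    define C where "C = (LINT z|lborel. z * f z * cnj (z * f z) * of_real (gauss c z))"
    define D where "D = (LINT z|lborel. f z * cnj (f z) * of_real (gauss c z))"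
    have iA: "integrable lborel (\<lambda>z. deriv f z * cnj (deriv f z) * of_real (gauss c z))"
      by (rule gauss_growth_integrable[OF g2 g2]) (use d in auto)
    have iB: "integrable lborel (\<lambda>z. f z * cnj (z * deriv f z) * of_real (gauss c z))"
      by (rule gauss_growth_integrable[OF g0 g3]) (use d in auto)
    have iB': "integrable lborel (\<lambda>z. z * deriv f z * cnj (f z) * of_real (gauss c z))"
      by (rule gauss_growth_integrable[OF g3 g0]) (use d in auto)
    have iC: "integrable lborel (\<lambda>z. z * f z * cnj (z * f z) * of_real (gauss c z))"
      by (rule gauss_growth_integrable[OF g1 g1]) (use d in auto)
    have iD: "integrable lborel (\<lambda>z. f z * cnj (f z) * of_real (gauss c z))"
      by (rule gauss_growth_integrable[OF g0 g0]) (use d in auto)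
    have "0 = (LINT z|lborel. (deriv f z - of_real c * cnj z * f z) * cnj (deriv f z) * of_real (gauss c z))"
      by (rule gauss_growth_integration_by_parts[OF g0 g2, symmetric]) (use d in auto)
    also have "\<dots> = (LINT z|lborel. deriv f z * cnj (deriv f z) * of_real (gauss c z)
        - of_real c * (f z * cnj (z * deriv f z) * of_real (gauss c z)))"
      by (intro Bochner_Integration.integral_cong) (auto simp: algebra_simps)
    also have "\<dots> = A - of_real c * B"
      unfolding A_def B_def using iA iB
      by (subst Bochner_Integration.integral_diff) (auto intro!: integrable_mult_right simp del: complex_cnj_mult)
    finally have 1: "A = of_real c * B" by simp
    have "0 = (LINT z|lborel. (deriv (\<lambda>z. z * f z) z - of_real c * cnj z * (z * f z)) * cnj (f z) * of_real (gauss c z))"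
      by (rule gauss_growth_integration_by_parts[OF g1 g0, symmetric]) (use d in auto)
    also have "\<dots> = (LINT z|lborel. f z * cnj (f z) * of_real (gauss c z) + z * deriv f z * cnj (f z) * of_real (gauss c z)
        - of_real c * (z * f z * cnj (z * f z) * of_real (gauss c z)))"
      by (intro Bochner_Integration.integral_cong) (auto simp: deriv_ident_mult[OF hol] algebra_simps)
    also have "\<dots> = D + (LINT z|lborel. z * deriv f z * cnj (f z) * of_real (gauss c z)) - of_real c * C"
      unfolding C_def D_def using iB' iC iD
      by (subst Bochner_Integration.integral_diff) (auto intro!: integrable_mult_right simp del: complex_cnj_mult)
    also have "(LINT z|lborel. z * deriv f z * cnj (f z) * of_real (gauss c z)) = cnj B"
      unfolding B_def by (subst Bochner_Integration.integral_cnj[symmetric]) (simp add: mult_ac)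
    finally have 2: "cnj B = of_real c * C - D" by (simp add: algebra_simps)
    have sq: "h z * cnj (h z) * of_real (gauss c z) = of_real ((cmod (h z))\<^sup>2 * gauss c z)" for h z
      by (simp add: mult_cnj_cmod)
    have A': "A = of_real (LINT z|lborel. (cmod (deriv f z))\<^sup>2 * gauss c z)"
      unfolding A_def sq by (rule integral_complex_of_real)
    have C': "C = of_real (LINT z|lborel. (cmod (z * f z))\<^sup>2 * gauss c z)"
      unfolding C_def sq[of "\<lambda>z. z * f z"] by (rule integral_complex_of_real)
    have D': "D = of_real (LINT z|lborel. (cmod (f z))\<^sup>2 * gauss c z)"
      unfolding D_def sq by (rule integral_complex_of_real)
    have "cnj A = of_real c * (of_real c * C - D)" using 1 2 by simp
    then have "complex_of_real (LINT z|lborel. (cmod (deriv f z))\<^sup>2 * gauss c z) =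
      of_real (c * (c * (LINT z|lborel. (cmod (z * f z))\<^sup>2 * gauss c z) - (LINT z|lborel. (cmod (f z))\<^sup>2 * gauss c z)))"
      unfolding A' C' D' by simp
    moreover have "integrable lborel (\<lambda>z. (cmod (deriv f z))\<^sup>2 * gauss c z)"
      using iA unfolding sq[of "deriv f"] by (simp only: complex_of_real_integrable_eq)
    ultimately show ?thesis by (simp only: of_real_eq_iff)
  qed
  note main = this
  define e where "e n = 1 / real (Suc n)" for n
  define F where "F n z = (cmod (deriv f z))\<^sup>2 * gauss (1 + e n) z" for n z
  have e: "e n > 0" for n by (simp add: e_def)
  have elim: "e \<longlonglongrightarrow> 0" unfolding e_def by (rule LIMSEQ_inverse_real_of_nat[unfolded inverse_eq_divide])
  have damp: "(\<lambda>n. LINT z|lborel. (cmod (h z))\<^sup>2 * gauss (1 + e n) z) \<longlonglongrightarrow> (LINT z|lborel. (cmod (h z))\<^sup>2 * gauss 1 z)"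
    if "fock h" for h
  proof -
    have "gauss (1 / real (Suc n)) z *\<^sub>R ((cmod (h z))\<^sup>2 * gauss 1 z) = (cmod (h z))\<^sup>2 * gauss (1 + e n) z" for n z
      by (simp add: gauss_mult[symmetric] e_def)
    then show ?thesis using gauss_damping[OF fock_integrable_square[OF that]] by (simp only:)
  qed
  let ?x = "(LINT z|lborel. (cmod (z * f z))\<^sup>2 * gauss 1 z) - (LINT z|lborel. (cmod (f z))\<^sup>2 * gauss 1 z)"
  have "(\<lambda>n. (1 + e n) * ((1 + e n) * (LINT z|lborel. (cmod (z * f z))\<^sup>2 * gauss (1 + e n) z)
      - (LINT z|lborel. (cmod (f z))\<^sup>2 * gauss (1 + e n) z))) \<longlonglongrightarrow>
      (1 + 0) * ((1 + 0) * (LINT z|lborel. (cmod (z * f z))\<^sup>2 * gauss 1 z)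
      - (LINT z|lborel. (cmod (f z))\<^sup>2 * gauss 1 z))"
    by (intro tendsto_intros elim damp[OF f] damp[OF zf])
  then have lim: "(\<lambda>n. LINT z|lborel. F n z) \<longlonglongrightarrow> ?x"
    using main[of "1 + e n" for n] e unfolding F_def by simp
  have ptw: "(\<lambda>n. F n z) \<longlonglongrightarrow> (cmod (deriv f z))\<^sup>2 * gauss 1 z" for z
  proof -
    have "(\<lambda>n. F n z) \<longlonglongrightarrow> (cmod (deriv f z))\<^sup>2 * gauss (1 + 0) z"
      unfolding F_def gauss_def by (intro tendsto_intros elim)
    then show ?thesis by simp
  qed
  have mono: "mono (\<lambda>n. F n z)" for z
  proof (rule monoI)
    fix m n :: nat assume "m \<le> n"
    then have "e n \<le> e m" by (simp add: e_def frac_le)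
    then have "e n * (cmod z)\<^sup>2 \<le> e m * (cmod z)\<^sup>2" by (rule mult_right_mono) simp
    then show "F m z \<le> F n z"
      unfolding F_def gauss_def by (intro mult_left_mono) (simp_all add: algebra_simps)
  qed
  have iF: "integrable lborel (F n)" for n using main[of "1 + e n"] e[of n] by (simp add: F_def[abs_def])
  note mc = AE_I2[OF mono] AE_I2[OF ptw] lim
  have "integrable lborel (\<lambda>z. (cmod (deriv f z))\<^sup>2 * gauss 1 z)"
    by (rule integrable_monotone_convergence[OF iF mc]) measurable
  then show "fock (deriv f)" using hol by (simp add: fock_def holomorphic_deriv)
  show "(LINT z|lborel. (cmod (deriv f z))\<^sup>2 * gauss 1 z) = ?x"
    by (rule integral_monotone_convergence[OF iF mc]) measurable
qed

lemma fock_growth_any: "fock f \<Longrightarrow> 1/2 < s \<Longrightarrow> gauss_growth s f"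
  by (rule gauss_growth_mono[OF fock_gauss_growth]) auto

definition fock_inner :: "(complex \<Rightarrow> complex) \<Rightarrow> (complex \<Rightarrow> complex) \<Rightarrow> complex" where
  "fock_inner a b = (LINT z|lborel. a z * cnj (b z) * of_real (gauss 1 z))"

lemma cnj_fock_inner: "cnj (fock_inner a b) = fock_inner b a"
  unfolding fock_inner_def by (subst Bochner_Integration.integral_cnj[symmetric]) (simp add: mult_ac)

lemma fock_inner_self: "fock_inner a a = of_real (LINT z|lborel. (cmod (a z))\<^sup>2 * gauss 1 z)"
proof -
  have "a z * cnj (a z) * of_real (gauss 1 z) = of_real ((cmod (a z))\<^sup>2 * gauss 1 z)" for z
    by (simp add: mult_cnj_cmod)
  then show ?thesis unfolding fock_inner_def by (simp only: integral_complex_of_real)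
qed

lemma fock_lowering_adjoint:
  assumes f: "fock f" and zf: "fock (\<lambda>z. z * f z)" and h: "fock h"
    and zh: "integrable lborel (\<lambda>z. f z * cnj (z * h z) * of_real (gauss 1 z))"
  shows "fock_inner (deriv f) h = fock_inner f (\<lambda>z. z * h z)"
proof -
  note df = fock_deriv(1)[OF f zf]
  have i1: "integrable lborel (\<lambda>z. deriv f z * cnj (h z) * of_real (gauss 1 z))"
    by (intro integrable_fock_mult df h)
  have eq: "(deriv f z - of_real 1 * cnj z * f z) * cnj (h z) * of_real (gauss 1 z) =
      deriv f z * cnj (h z) * of_real (gauss 1 z) - f z * cnj (z * h z) * of_real (gauss 1 z)" for z
    by (simp add: algebra_simps)
  have "(LINT z|lborel. (deriv f z - of_real 1 * cnj z * f z) * cnj (h z) * of_real (gauss 1 z)) = 0"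
  proof (rule integration_by_parts_L1)
    show "integrable lborel (\<lambda>z. (deriv f z - of_real 1 * cnj z * f z) * cnj (h z) * of_real (gauss 1 z))"
      unfolding eq by (intro Bochner_Integration.integrable_diff i1 zh)
  qed (use f h in \<open>auto intro: fock_growth_any integrable_fock_mult\<close>)
  then show ?thesis unfolding eq fock_inner_def Bochner_Integration.integral_diff[OF i1 zh] by simp
qed

text \<open>Fubini's theorem and the reproducing formula. The modulus of the kernel is \<open>gauss (1/2) (z - w) / pi\<close>, which transfers a
  polynomial weight from \<open>z\<close> to \<open>w\<close> because \<open>1 + |z| \<le> (1 + |w|) (1 + |z - w|)\<close>. Thus \<open>h\<close> may grow by one power more than
  the elements of the Bargmann-Fock space, as needed for \<open>h = z f'\<close>.\<close>

lemma fock_proj_pairing: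
  assumes phi [measurable]: "\<phi> \<in> borel_measurable borel"
    and int: "integrable lborel (\<lambda>w. (1 + cmod w) * cmod (\<phi> w))"
    and h: "gauss_growth s h" "0 \<le> s" "s < 1"
    and bound: "\<And>z. cmod (h z) * gauss (1/2) z \<le> C * (1 + cmod z)"
  shows "integrable lborel (\<lambda>z. fock_proj \<phi> z * cnj (h z) * of_real (gauss (1/2) z))"
    and "(LINT z|lborel. fock_proj \<phi> z * cnj (h z) * of_real (gauss (1/2) z)) =
      (LINT w|lborel. \<phi> w * cnj (h w) * of_real (gauss (1/2) w))"
proof -
  have hol: "h holomorphic_on UNIV" using h(1) by (rule gauss_growth_holomorphic)
  have [measurable]: "h \<in> borel_measurable borel" using hol by (rule entire_measurable)
  define K where "K w z = of_real (gauss (1/2) z / pi) * (exp (cnj w * z) * of_real (gauss (1/2) w) * \<phi> w) *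
      cnj (h z) * of_real (gauss (1/2) z)" for w z
  define W where "W x = (1 + cmod x) * gauss (1/2) x" for x :: complex
  have W: "integrable lborel W"
  proof -
    have "integrable lborel (\<lambda>x. gauss (1/2) x + cmod (x * cnj 1 * of_real (gauss (1/2) x)))"
      using gauss_growth_integrable[OF gauss_growth_ident[of "1/4"] gauss_growth_const[of 0 1], of "1/2"]
      by (intro Bochner_Integration.integrable_add integrable_norm integrable_gauss) simp_all
    then show ?thesis by (simp add: W_def[abs_def] norm_mult algebra_simps)
  qed
  have [measurable]: "W \<in> borel_measurable borel" unfolding W_def by measurable
  have kernel: "cmod (of_real (gauss (1/2) z) * (exp (cnj w * z) * of_real (gauss (1/2) w))) = gauss (1/2) (z - w)" for z w
  proof -
    have "(cmod (z - w))\<^sup>2 = (cmod z)\<^sup>2 + (cmod w)\<^sup>2 - 2 * Re (cnj w * z)"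
      unfolding cmod_power2 by (simp add: power2_eq_square algebra_simps)
    then show ?thesis
      by (simp add: norm_mult gauss_def exp_add[symmetric] field_simps)
  qed
  have Kb: "norm (K w z) \<le> C / pi * ((1 + cmod w) * cmod (\<phi> w)) * W (z - w)" for w z
  proof -
    have "1 + cmod z \<le> (1 + cmod w) * (1 + cmod (z - w))"
    proof -
      have "cmod z \<le> cmod w + cmod (z - w)" by (metis add.commute diff_add_cancel norm_triangle_ineq)
      moreover have "0 \<le> cmod w * cmod (z - w)" by simp
      moreover have "(1 + cmod w) * (1 + cmod (z - w)) = 1 + cmod w + cmod (z - w) + cmod w * cmod (z - w)"
        by (simp add: algebra_simps)
      ultimately show ?thesis by linarith
    qed
    moreover have C: "0 \<le> C" using order_trans[OF _ bound[of 0], of 0] by simp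
    ultimately have hz: "cmod (h z) * gauss (1/2) z \<le> C * ((1 + cmod w) * (1 + cmod (z - w)))"
      using order_trans[OF bound] mult_left_mono by blast
    have "norm (K w z) = cmod (of_real (gauss (1/2) z) * (exp (cnj w * z) * of_real (gauss (1/2) w))) / pi *
        cmod (\<phi> w) * (cmod (h z) * gauss (1/2) z)"
      by (simp add: K_def norm_mult norm_divide)
    also have "\<dots> \<le> gauss (1/2) (z - w) / pi * cmod (\<phi> w) * (C * ((1 + cmod w) * (1 + cmod (z - w))))"
      unfolding kernel using hz by (intro mult_left_mono) auto
    finally show ?thesis by (simp add: W_def mult_ac)
  qed
  have "integrable (lborel \<Otimes>\<^sub>M lborel) (\<lambda>(w, z). C / pi * ((1 + cmod w) * cmod (\<phi> w)) * W (z - w))"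
  proof (rule lborel_pair.Fubini_integrable)
    have "(LINT z|lborel. norm (C / pi * ((1 + cmod w) * cmod (\<phi> w)) * W (z - w))) =
        \<bar>C / pi\<bar> * ((1 + cmod w) * cmod (\<phi> w)) * (LINT z|lborel. norm (W z))" for w
      using integral_translate[of "\<lambda>z. norm (W z)" "- w"] by (simp add: abs_mult)
    then show "integrable lborel (\<lambda>w. LINT z|lborel. norm (case (w, z) of (w, z) \<Rightarrow>
        C / pi * ((1 + cmod w) * cmod (\<phi> w)) * W (z - w)))"
      using int by simp
    show "AE w in lborel. integrable lborel (\<lambda>z. case (w, z) of (w, z) \<Rightarrow> C / pi * ((1 + cmod w) * cmod (\<phi> w)) * W (z - w))"
      using W integrable_translate[of W "- w" for w] by simp
  qed measurable
  then have iK: "integrable (lborel \<Otimes>\<^sub>M lborel) (\<lambda>(w, z). K w z)"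
  proof (rule integrable_dominated[rotated])
    show "(\<lambda>(w, z). K w z) \<in> borel_measurable (lborel \<Otimes>\<^sub>M lborel)" unfolding K_def by measurable
    show "norm (case p of (w, z) \<Rightarrow> K w z) \<le> (case p of (w, z) \<Rightarrow> C / pi * ((1 + cmod w) * cmod (\<phi> w)) * W (z - w))" for p
      using Kb[of "fst p" "snd p"] by (simp only: split_def)
  qed
  have inner1: "(LINT w|lborel. K w z) = fock_proj \<phi> z * cnj (h z) * of_real (gauss (1/2) z)" for z
  proof -
    have "exp (cnj w * z - of_real ((cmod w)\<^sup>2 / 2)) = exp (cnj w * z) * of_real (gauss (1/2) w)" for w
      by (simp only: gauss_def exp_of_real[symmetric] exp_add[symmetric]) simp
    then show ?thesis by (simp add: fock_proj_def K_def gauss_def)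
  qed
  have inner2: "(LINT z|lborel. K w z) = \<phi> w * cnj (h w) * of_real (gauss (1/2) w)" for w
  proof -
    have "K w z = of_real (1 / pi) * (of_real (gauss (1/2) w) * \<phi> w) *
        cnj (h z * exp (w * cnj z) * of_real (gauss 1 z))" for z
      using gauss_mult[of "1/2" z "1/2"] by (simp add: K_def exp_cnj field_simps) (simp flip: of_real_mult)
    then have "(LINT z|lborel. K w z) = of_real (1 / pi) * (of_real (gauss (1/2) w) * \<phi> w) *
        cnj (LINT z|lborel. h z * exp (w * cnj z) * of_real (gauss 1 z))" by (simp only: integral_mult_right_zero Bochner_Integration.integral_cnj)
    then show ?thesis using fock_reproducing[OF h] by simp
  qed
  show "integrable lborel (\<lambda>z. fock_proj \<phi> z * cnj (h z) * of_real (gauss (1/2) z))"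
    using lborel_pair.integrable_snd[OF iK] by (simp only: inner1)
  show "(LINT z|lborel. fock_proj \<phi> z * cnj (h z) * of_real (gauss (1/2) z)) =
      (LINT w|lborel. \<phi> w * cnj (h w) * of_real (gauss (1/2) w))"
    using lborel_pair.Fubini_integral[OF iK] by (simp only: inner1 inner2)
qed

section \<open>One equation of the stationary pair\<close>

text \<open>The density \<open>\<rho>\<close> is \<open>|V|\<^sup>2\<close> for the first equation and \<open>- |U|\<^sup>2\<close> for the second one.\<close>

locale wave_component =
  fixes f :: "complex \<Rightarrow> complex" and \<rho> :: "complex \<Rightarrow> real" and l :: real and \<alpha> :: complex
  assumes f: "fock f" and zf: "fock (\<lambda>z. z * f z)"
    and \<rho> [measurable]: "\<rho> \<in> borel_measurable borel" and \<rho>_bound: "\<exists>R. \<forall>z. \<bar>\<rho> z\<bar> \<le> R"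
    and \<rho>_int: "integrable lborel (\<lambda>z. (1 + cmod z) * (\<bar>\<rho> z\<bar> * (cmod (f z) * gauss (1/2) z)))"
    and eq: "\<And>z. fock_proj (\<lambda>w. of_real (\<rho> w) * (of_real (gauss (1/2) w) * f w)) z =
      of_real (gauss (1/2) z) * (of_real l * f z + \<i> * (\<alpha> * deriv f z - cnj \<alpha> * z * f z))"
begin

abbreviation q where "q \<equiv> fock_inner (\<lambda>z. z * f z) f"
abbreviation m where "m \<equiv> (LINT z|lborel. (cmod (f z))\<^sup>2 * gauss 1 z)"

lemma hol: "f holomorphic_on UNIV" using f by (rule fock_holomorphic)

lemma f_measurable [measurable]: "f \<in> borel_measurable borel" "deriv f \<in> borel_measurable borel"
  using hol by (auto intro!: entire_measurable holomorphic_deriv)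

lemma df: "fock (deriv f)" by (rule fock_deriv(1)[OF f zf])

lemma half_gauss: "complex_of_real (gauss (1/2) z) * (of_real (gauss (1/2) z) * x) = of_real (gauss 1 z) * x"
  using gauss_mult[of "1/2" z "1/2"] by (simp flip: mult.assoc of_real_mult)

lemma pairing_general:
  assumes h: "gauss_growth s h" "0 \<le> s" "s < 1" and bound: "\<And>z. cmod (h z) * gauss (1/2) z \<le> C * (1 + cmod z)"
  shows "integrable lborel (\<lambda>z. (of_real l * f z + \<i> * (\<alpha> * deriv f z - cnj \<alpha> * z * f z)) * cnj (h z) * of_real (gauss 1 z))"
    and "integrable lborel (\<lambda>z. of_real (\<rho> z) * (f z * cnj (h z) * of_real (gauss 1 z)))"
    and "(LINT z|lborel. (of_real l * f z + \<i> * (\<alpha> * deriv f z - cnj \<alpha> * z * f z)) * cnj (h z) * of_real (gauss 1 z)) =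
      (LINT z|lborel. of_real (\<rho> z) * (f z * cnj (h z) * of_real (gauss 1 z)))"
proof -
  let ?phi = "\<lambda>w. complex_of_real (\<rho> w) * (of_real (gauss (1/2) w) * f w)"
  have [measurable]: "h \<in> borel_measurable borel"
    using h(1) by (intro entire_measurable gauss_growth_holomorphic)
  have phi: "?phi \<in> borel_measurable borel" by measurable
  have i: "integrable lborel (\<lambda>w. (1 + cmod w) * cmod (?phi w))"
    using \<rho>_int by (simp add: norm_mult mult_ac)
  have 1: "fock_proj ?phi z * cnj (h z) * of_real (gauss (1/2) z) =
      (of_real l * f z + \<i> * (\<alpha> * deriv f z - cnj \<alpha> * z * f z)) * cnj (h z) * of_real (gauss 1 z)" for z
    unfolding eq using half_gauss[of z "(of_real l * f z + \<i> * (\<alpha> * deriv f z - cnj \<alpha> * z * f z)) * cnj (h z)"]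
    by (simp only: mult_ac)
  have 2: "?phi w * cnj (h w) * of_real (gauss (1/2) w) = of_real (\<rho> w) * (f w * cnj (h w) * of_real (gauss 1 w))" for w
    using half_gauss[of w "of_real (\<rho> w) * f w * cnj (h w)"] by (simp only: mult_ac)
  show "integrable lborel (\<lambda>z. (of_real l * f z + \<i> * (\<alpha> * deriv f z - cnj \<alpha> * z * f z)) * cnj (h z) * of_real (gauss 1 z))"
    using fock_proj_pairing(1)[OF phi i h bound] unfolding 1 .
  show "(LINT z|lborel. (of_real l * f z + \<i> * (\<alpha> * deriv f z - cnj \<alpha> * z * f z)) * cnj (h z) * of_real (gauss 1 z)) =
      (LINT z|lborel. of_real (\<rho> z) * (f z * cnj (h z) * of_real (gauss 1 z)))"
    using fock_proj_pairing(2)[OF phi i h bound] unfolding 1 2 .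
  show "integrable lborel (\<lambda>z. of_real (\<rho> z) * (f z * cnj (h z) * of_real (gauss 1 z)))"
  proof (rule integrable_dominated)
    show "integrable lborel (\<lambda>w. C * ((1 + cmod w) * cmod (?phi w)))" using i by simp
    fix w
    have "cmod (?phi w) * (cmod (h w) * gauss (1/2) w) \<le> cmod (?phi w) * (C * (1 + cmod w))"
      by (intro mult_left_mono bound) simp
    then show "norm (of_real (\<rho> w) * (f w * cnj (h w) * of_real (gauss 1 w))) \<le> C * ((1 + cmod w) * cmod (?phi w))"
      unfolding 2[symmetric] by (simp add: norm_mult mult_ac)
  qed measurable
qed

lemma pairing:
  assumes h: "fock h"
  shows "of_real l * fock_inner f h + \<i> * (\<alpha> * fock_inner (deriv f) h - cnj \<alpha> * fock_inner (\<lambda>z. z * f z) h) =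
      (LINT z|lborel. of_real (\<rho> z) * (f z * cnj (h z) * of_real (gauss 1 z)))"
proof -
  obtain C where C: "C \<ge> 0" "\<And>z. cmod (h z) * gauss (1/2) z \<le> C" using fock_bounded[OF h] by blast
  have bound: "cmod (h z) * gauss (1/2) z \<le> C * (1 + cmod z)" for z
    using C(2)[of z] mult_nonneg_nonneg[OF C(1) norm_ge_zero[of z]] by (simp add: distrib_left)
  note i = integrable_fock_mult[OF f h] integrable_fock_mult[OF df h] integrable_fock_mult[OF zf h]
  have split: "(of_real l * f z + \<i> * (\<alpha> * deriv f z - cnj \<alpha> * z * f z)) * cnj (h z) * of_real (gauss 1 z) =
      of_real l * (f z * cnj (h z) * of_real (gauss 1 z)) + \<i> * (\<alpha> * (deriv f z * cnj (h z) * of_real (gauss 1 z))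
        - cnj \<alpha> * (z * f z * cnj (h z) * of_real (gauss 1 z)))" for z
    by (simp add: algebra_simps)
  have "(LINT z|lborel. (of_real l * f z + \<i> * (\<alpha> * deriv f z - cnj \<alpha> * z * f z)) * cnj (h z) * of_real (gauss 1 z)) =
      of_real l * fock_inner f h + \<i> * (\<alpha> * fock_inner (deriv f) h - cnj \<alpha> * fock_inner (\<lambda>z. z * f z) h)"
    unfolding split fock_inner_def using i by simp
  then show ?thesis using pairing_general(3)[OF fock_gauss_growth[OF h] _ _ bound] by simp
qed

lemma inner_values:
  shows "fock_inner f f = of_real m" "fock_inner f (\<lambda>z. z * f z) = cnj q"
    "fock_inner (deriv f) f = cnj q" "fock_inner f (deriv f) = q"
    "fock_inner (deriv f) (deriv f) = fock_inner (\<lambda>z. z * f z) (\<lambda>z. z * f z) - of_real m"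
proof -
  show "fock_inner f f = of_real m" by (rule fock_inner_self)
  show 1: "fock_inner f (\<lambda>z. z * f z) = cnj q" by (rule cnj_fock_inner[symmetric])
  show 2: "fock_inner (deriv f) f = cnj q"
    unfolding 1[symmetric] by (rule fock_lowering_adjoint[OF f zf f integrable_fock_mult[OF f zf]])
  show "fock_inner f (deriv f) = q" using 2 cnj_fock_inner[of "deriv f" f] by simp
  show "fock_inner (deriv f) (deriv f) = fock_inner (\<lambda>z. z * f z) (\<lambda>z. z * f z) - of_real m"
    unfolding fock_inner_self fock_deriv(2)[OF f zf] by simp
qed

lemma i_complex: "\<i> * (x * cnj y - cnj x * y) = of_real (2 * Im (cnj x * y))"
  by (simp add: complex_eq_iff)

lemma energy_identity:
  "(LINT z|lborel. \<rho> z * ((cmod (f z))\<^sup>2 * gauss 1 z)) = l * m + 2 * Im (cnj \<alpha> * q)"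
proof -
  have e: "of_real (\<rho> z) * (f z * cnj (f z) * of_real (gauss 1 z)) =
      complex_of_real (\<rho> z * ((cmod (f z))\<^sup>2 * gauss 1 z))" for z
    by (simp add: mult_cnj_cmod)
  have "complex_of_real (LINT z|lborel. \<rho> z * ((cmod (f z))\<^sup>2 * gauss 1 z)) = of_real (l * m) + \<i> * (\<alpha> * cnj q - cnj \<alpha> * q)"
    using pairing[OF f] unfolding e integral_complex_of_real by (simp only: inner_values of_real_mult)
  then show ?thesis unfolding i_complex of_real_add[symmetric] of_real_eq_iff .
qed

text \<open>The difference of the tests with \<open>f'\<close> and \<open>z f\<close>. All terms cancel except the commutator of \<open>\<partial>\<close> and \<open>z\<close>, which enters
  through the norm of \<open>f'\<close>.\<close>

lemma speed_identity:
  "(LINT z|lborel. of_real (\<rho> z) * ((f z * cnj (deriv f z) - z * f z * cnj (f z)) * of_real (gauss 1 z))) = - \<i> * \<alpha> * of_real m"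
proof -
  let ?S = "fock_inner (\<lambda>z. z * f z) (\<lambda>z. z * f z)" and ?X = "fock_inner (\<lambda>z. z * f z) (deriv f)"
  let ?Z = "LINT z|lborel. of_real (\<rho> z) * (f z * cnj (z * f z) * of_real (gauss 1 z))"
  obtain R where R: "\<And>z. \<bar>\<rho> z\<bar> \<le> R" using \<rho>_bound by blast
  have rho: "(\<lambda>z. complex_of_real (\<rho> z)) \<in> borel_measurable borel" "\<And>z. cmod (of_real (\<rho> z)) \<le> R"
    using R by auto
  have i1: "integrable lborel (\<lambda>z. of_real (\<rho> z) * (f z * cnj (deriv f z) * of_real (gauss 1 z)))"
    and i2: "integrable lborel (\<lambda>z. of_real (\<rho> z) * (z * f z * cnj (f z) * of_real (gauss 1 z)))"
    by (rule integrable_fock_mult_bounded[OF f df rho], rule integrable_fock_mult_bounded[OF zf f rho])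
  have 1: "of_real l * q + \<i> * (\<alpha> * (?S - of_real m) - cnj \<alpha> * ?X) =
      (LINT z|lborel. of_real (\<rho> z) * (f z * cnj (deriv f z) * of_real (gauss 1 z)))"
    using pairing[OF df] by (simp only: inner_values)
  have 2: "of_real l * cnj q + \<i> * (\<alpha> * cnj ?X - cnj \<alpha> * ?S) = ?Z"
    using pairing[OF zf] cnj_fock_inner[of "\<lambda>z. z * f z" "deriv f"] by (simp only: inner_values)
  have S: "cnj ?S = ?S" by (rule cnj_fock_inner)
  have "cnj ?Z = (LINT z|lborel. of_real (\<rho> z) * (z * f z * cnj (f z) * of_real (gauss 1 z)))"
    by (subst Bochner_Integration.integral_cnj[symmetric]) (simp add: mult_ac)
  moreover have "cnj (of_real l * cnj q + \<i> * (\<alpha> * cnj ?X - cnj \<alpha> * ?S)) =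
      of_real l * q - \<i> * (cnj \<alpha> * ?X - \<alpha> * ?S)" by (simp add: S algebra_simps)
  ultimately have 3: "of_real l * q - \<i> * (cnj \<alpha> * ?X - \<alpha> * ?S) =
      (LINT z|lborel. of_real (\<rho> z) * (z * f z * cnj (f z) * of_real (gauss 1 z)))"
    using 2 by simp
  have "(LINT z|lborel. of_real (\<rho> z) * ((f z * cnj (deriv f z) - z * f z * cnj (f z)) * of_real (gauss 1 z))) =
      (LINT z|lborel. of_real (\<rho> z) * (f z * cnj (deriv f z) * of_real (gauss 1 z))
         - of_real (\<rho> z) * (z * f z * cnj (f z) * of_real (gauss 1 z)))"
    by (intro Bochner_Integration.integral_cong) (auto simp: algebra_simps)
  also have "\<dots> = (of_real l * q + \<i> * (\<alpha> * (?S - of_real m) - cnj \<alpha> * ?X)) - (of_real l * q - \<i> * (cnj \<alpha> * ?X - \<alpha> * ?S))"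
    unfolding 1 3 by (rule Bochner_Integration.integral_diff[OF i1 i2])
  finally show ?thesis by (simp add: algebra_simps)
qed

lemma integrable_second_moment: "integrable lborel (\<lambda>z. (cmod z)\<^sup>2 * ((cmod (f z))\<^sup>2 * gauss 1 z))"
  using fock_integrable_square[OF zf] by (simp add: norm_mult power_mult_distrib mult.assoc)

text \<open>The test with \<open>z f\<close>: for the Gaussian weight \<open>\<i> T\<close> acts on pairings as multiplication by \<open>2 Im (cnj \<alpha> z)\<close>.\<close>

lemma moment_identity:
  "(LINT z|lborel. of_real (\<rho> z) * (z * of_real ((cmod (f z))\<^sup>2 * gauss 1 z))) =
    of_real l * q + (LINT z|lborel. of_real (2 * Im (cnj \<alpha> * z)) * z * of_real ((cmod (f z))\<^sup>2 * gauss 1 z))"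
proof -
  let ?S = "fock_inner (\<lambda>z. z * f z) (\<lambda>z. z * f z)" and ?X = "fock_inner f (\<lambda>z. z * (z * f z))"
  let ?Z = "LINT z|lborel. of_real (\<rho> z) * (f z * cnj (z * f z) * of_real (gauss 1 z))"
  have sq: "x * f z * cnj (f z) * of_real (gauss 1 z) = x * of_real ((cmod (f z))\<^sup>2 * gauss 1 z)" for x z
    by (simp add: mult_cnj_cmod)
  have i: "integrable lborel (\<lambda>z. r z * of_real ((cmod (f z))\<^sup>2 * gauss 1 z))"
    if r: "r \<in> borel_measurable borel" "\<And>z. cmod (r z) \<le> (cmod z)\<^sup>2" for r :: "complex \<Rightarrow> complex"
  proof (rule integrable_dominated[OF _ integrable_second_moment])
    have [measurable]: "r \<in> borel_measurable borel" by fact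
    show "(\<lambda>z. r z * of_real ((cmod (f z))\<^sup>2 * gauss 1 z)) \<in> borel_measurable lborel" by measurable
    show "norm (r z * of_real ((cmod (f z))\<^sup>2 * gauss 1 z)) \<le> (cmod z)\<^sup>2 * ((cmod (f z))\<^sup>2 * gauss 1 z)" for z
      using mult_right_mono[OF r(2)[of z], of "(cmod (f z))\<^sup>2 * gauss 1 z"] by (simp add: norm_mult norm_power)
  qed
  have i1: "integrable lborel (\<lambda>z. cnj z * z * of_real ((cmod (f z))\<^sup>2 * gauss 1 z))"
    and i2: "integrable lborel (\<lambda>z. z\<^sup>2 * of_real ((cmod (f z))\<^sup>2 * gauss 1 z))"
    and i3: "integrable lborel (\<lambda>z. (cnj z)\<^sup>2 * of_real ((cmod (f z))\<^sup>2 * gauss 1 z))"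
    by (intro i; simp add: norm_mult norm_power power2_eq_square)+
  have X: "?X = (LINT z|lborel. (cnj z)\<^sup>2 * of_real ((cmod (f z))\<^sup>2 * gauss 1 z))"
    unfolding fock_inner_def sq[symmetric] by (intro Bochner_Integration.integral_cong) (auto simp: power2_eq_square mult_ac)
  have X': "cnj ?X = (LINT z|lborel. z\<^sup>2 * of_real ((cmod (f z))\<^sup>2 * gauss 1 z))"
    unfolding X by (subst Bochner_Integration.integral_cnj[symmetric]) simp
  have S: "?S = (LINT z|lborel. cnj z * z * of_real ((cmod (f z))\<^sup>2 * gauss 1 z))"
    unfolding fock_inner_def sq[symmetric] by (intro Bochner_Integration.integral_cong) (auto simp: mult_ac)
  have "fock_inner (deriv f) (\<lambda>z. z * f z) = ?X"
  proof (rule fock_lowering_adjoint[OF f zf zf])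
    show "integrable lborel (\<lambda>z. f z * cnj (z * (z * f z)) * of_real (gauss 1 z))"
      using i3 unfolding sq[symmetric] by (simp add: power2_eq_square mult_ac)
  qed
  then have "of_real l * cnj q + \<i> * (\<alpha> * ?X - cnj \<alpha> * ?S) = ?Z"
    using pairing[OF zf] by (simp only: inner_values)
  then have "cnj ?Z = cnj (of_real l * cnj q + \<i> * (\<alpha> * ?X - cnj \<alpha> * ?S))" by simp
  also have "\<dots> = of_real l * q + \<i> * (\<alpha> * ?S - cnj \<alpha> * cnj ?X)"
    by (simp add: cnj_fock_inner algebra_simps)
  also have "\<i> * (\<alpha> * ?S - cnj \<alpha> * cnj ?X) =
      (LINT z|lborel. \<i> * (\<alpha> * (cnj z * z * of_real ((cmod (f z))\<^sup>2 * gauss 1 z))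
        - cnj \<alpha> * (z\<^sup>2 * of_real ((cmod (f z))\<^sup>2 * gauss 1 z))))"
    unfolding S X' using i1 i2 by simp
  also have "\<dots> = (LINT z|lborel. of_real (2 * Im (cnj \<alpha> * z)) * z * of_real ((cmod (f z))\<^sup>2 * gauss 1 z))"
    unfolding i_complex[symmetric] by (intro Bochner_Integration.integral_cong) (auto simp: power2_eq_square algebra_simps)
  also have "cnj ?Z = (LINT z|lborel. of_real (\<rho> z) * (z * of_real ((cmod (f z))\<^sup>2 * gauss 1 z)))"
    unfolding sq[symmetric] by (subst Bochner_Integration.integral_cnj[symmetric]) (simp add: mult_ac)
  finally show ?thesis .
qed

lemma integrable_quadratic_moment:
  assumes [measurable]: "r \<in> borel_measurable borel" and r: "\<And>z. \<bar>r z\<bar> \<le> C * (1 + (cmod z)\<^sup>2)"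
  shows "integrable lborel (\<lambda>z. r z * ((cmod (f z))\<^sup>2 * gauss 1 z))"
proof (rule integrable_dominated)
  show "integrable lborel (\<lambda>z. C * ((cmod (f z))\<^sup>2 * gauss 1 z + (cmod z)\<^sup>2 * ((cmod (f z))\<^sup>2 * gauss 1 z)))"
    by (intro integrable_mult_right Bochner_Integration.integrable_add integrable_second_moment fock_integrable_square f)
  show "norm (r z * ((cmod (f z))\<^sup>2 * gauss 1 z)) \<le>
      C * ((cmod (f z))\<^sup>2 * gauss 1 z + (cmod z)\<^sup>2 * ((cmod (f z))\<^sup>2 * gauss 1 z))" for z
    using mult_right_mono[OF r[of z], of "(cmod (f z))\<^sup>2 * gauss 1 z"] by (simp add: abs_mult algebra_simps)
qed measurable

lemma Im_cnj_mult_bound: "\<bar>Im (cnj \<alpha> * z)\<bar> \<le> cmod \<alpha> * cmod z"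
  using abs_Im_le_cmod[of "cnj \<alpha> * z"] by (simp add: norm_mult)

lemma first_moment: "(LINT z|lborel. Im (cnj \<alpha> * z) * ((cmod (f z))\<^sup>2 * gauss 1 z)) = Im (cnj \<alpha> * q)"
proof -
  have e: "Im (cnj \<alpha> * (z * f z * cnj (f z) * of_real (gauss 1 z))) = Im (cnj \<alpha> * z) * ((cmod (f z))\<^sup>2 * gauss 1 z)" for z
  proof -
    have "cnj \<alpha> * (z * f z * cnj (f z) * of_real (gauss 1 z)) = (cnj \<alpha> * z) * of_real ((cmod (f z))\<^sup>2 * gauss 1 z)"
      using mult_cnj_cmod[of "f z"] by (simp add: mult_ac)
    moreover have "Im (x * of_real r) = Im x * r" for x r by simp
    ultimately show ?thesis by (simp only:)
  qed
  show ?thesis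
    using integral_Im[OF integrable_mult_right[OF integrable_fock_mult[OF zf f], of "cnj \<alpha>"]]
    unfolding e fock_inner_def by (simp only: integral_mult_right_zero)
qed

lemma imaginary_moment_identity:
  "(LINT z|lborel. \<rho> z * (Im (cnj \<alpha> * z) * ((cmod (f z))\<^sup>2 * gauss 1 z))) =
    l * Im (cnj \<alpha> * q) + 2 * (LINT z|lborel. (Im (cnj \<alpha> * z))\<^sup>2 * ((cmod (f z))\<^sup>2 * gauss 1 z))"
proof -
  let ?F = "\<lambda>z. (cmod (f z))\<^sup>2 * gauss 1 z"
  obtain R where R: "\<And>z. \<bar>\<rho> z\<bar> \<le> R" using \<rho>_bound by blast
  have R0: "R \<ge> 0" using order_trans[OF abs_ge_zero R] .
  have sq: "cmod z \<le> 1 + (cmod z)\<^sup>2" for z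
    using zero_le_power2[of "cmod z - 1/2"] by (simp add: power2_eq_square algebra_simps)
  have iF: "integrable lborel (\<lambda>z. r z * of_real (?F z))"
    if [measurable]: "r \<in> borel_measurable borel" and r: "\<And>z. cmod (r z) \<le> C * (1 + (cmod z)\<^sup>2)" for r :: "complex \<Rightarrow> complex" and C
  proof (rule integrable_dominated[OF _ integrable_quadratic_moment[of "\<lambda>z. cmod (r z)" C]])
    show "norm (r z * of_real (?F z)) \<le> cmod (r z) * ?F z" for z by (simp add: norm_mult norm_power)
  qed (use r in auto)
  have i1: "integrable lborel (\<lambda>z. (of_real (\<rho> z) * z) * of_real (?F z))"
    by (rule iF[of _ R]) (use R R0 sq in \<open>auto simp: norm_mult intro!: mult_mono\<close>)
  have i2: "integrable lborel (\<lambda>z. (of_real (2 * Im (cnj \<alpha> * z)) * z) * of_real (?F z))"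
  proof (rule iF[of _ "2 * cmod \<alpha>"])
    fix z
    have "\<bar>Im (cnj \<alpha> * z)\<bar> * cmod z \<le> (cmod \<alpha> * cmod z) * cmod z"
      by (rule mult_right_mono[OF Im_cnj_mult_bound]) simp
    also have "\<dots> \<le> cmod \<alpha> * (1 + (cmod z)\<^sup>2)" by (simp add: power2_eq_square distrib_left mult.assoc)
    finally show "cmod (of_real (2 * Im (cnj \<alpha> * z)) * z) \<le> 2 * cmod \<alpha> * (1 + (cmod z)\<^sup>2)"
      by (simp add: norm_mult del: times_complex.sel)
  qed measurable
  have ImR: "Im (x * of_real r) = Im x * r" "Im (of_real r * x) = r * Im x" for x r by simp_all
  have e1: "Im (cnj \<alpha> * ((of_real (\<rho> z) * z) * of_real (?F z))) = \<rho> z * (Im (cnj \<alpha> * z) * ?F z)" for z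
    using ImR(1)[of "cnj \<alpha> * z" "\<rho> z * ?F z"] by (simp only: of_real_mult mult_ac)
  have e2: "Im (cnj \<alpha> * ((of_real (2 * Im (cnj \<alpha> * z)) * z) * of_real (?F z))) = 2 * ((Im (cnj \<alpha> * z))\<^sup>2 * ?F z)" for z
    using ImR(1)[of "cnj \<alpha> * z" "2 * Im (cnj \<alpha> * z) * ?F z"] by (simp only: of_real_mult mult_ac power2_eq_square)
  have I1: "Im (cnj \<alpha> * (LINT z|lborel. (of_real (\<rho> z) * z) * of_real (?F z))) = (LINT z|lborel. \<rho> z * (Im (cnj \<alpha> * z) * ?F z))"
    using integral_Im[OF integrable_mult_right[OF i1, of "cnj \<alpha>"]] unfolding e1 by (simp only: integral_mult_right_zero)
  have I2: "Im (cnj \<alpha> * (LINT z|lborel. (of_real (2 * Im (cnj \<alpha> * z)) * z) * of_real (?F z))) =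
      2 * (LINT z|lborel. (Im (cnj \<alpha> * z))\<^sup>2 * ?F z)"
    using integral_Im[OF integrable_mult_right[OF i2, of "cnj \<alpha>"]] unfolding e2 by (simp only: integral_mult_right_zero)
  have "(LINT z|lborel. (of_real (\<rho> z) * z) * of_real (?F z)) =
      of_real l * q + (LINT z|lborel. (of_real (2 * Im (cnj \<alpha> * z)) * z) * of_real (?F z))"
    using moment_identity by (simp only: mult.assoc)
  then have "Im (cnj \<alpha> * (LINT z|lborel. (of_real (\<rho> z) * z) * of_real (?F z))) =
      l * Im (cnj \<alpha> * q) + Im (cnj \<alpha> * (LINT z|lborel. (of_real (2 * Im (cnj \<alpha> * z)) * z) * of_real (?F z)))"
    using ImR(2)[of l "cnj \<alpha> * q"] by (simp add: distrib_left mult.left_commute del: times_complex.sel)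
  then show ?thesis unfolding I1 I2 .
qed

text \<open>The test with \<open>z f'\<close>. The pairing of \<open>T f\<close> with \<open>z f'\<close> is integrable because the equation equates it, up to
  integrable terms, with the pairing of \<open>\<Pi> (\<rho> U)\<close>, but its summands \<open>|f'|\<^sup>2 z\<close> and \<open>|z|\<^sup>2 f (cnj f')\<close> need not be. The
  integration by parts is therefore made for the combination that occurs, with \<open>a = z f\<close>, \<open>b = f'\<close> and the factor \<open>cnj \<alpha>\<close>.\<close>

lemma angular_identity:
  shows "integrable lborel (\<lambda>z. \<rho> z * (Im (f z * cnj (z * deriv f z)) * gauss 1 z))"
    and "(LINT z|lborel. \<rho> z * (Im (f z * cnj (z * deriv f z)) * gauss 1 z)) = - Re (cnj \<alpha> * q)"
proof -
  obtain C where C: "C \<ge> 0" "\<And>z. cmod (deriv f z) * gauss (1/2) z \<le> C" using fock_bounded[OF df] by blast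
  have bound: "cmod (z * deriv f z) * gauss (1/2) z \<le> C * (1 + cmod z)" for z
    using mult_left_mono[OF C(2)[of z] norm_ge_zero[of z]] C(1) by (simp add: norm_mult algebra_simps)
  have growth: "gauss_growth (1/4 + 1/2) (\<lambda>z. z * deriv f z)"
    by (intro gauss_growth_mult gauss_growth_ident fock_gauss_growth df) simp
  define T where "T z = \<alpha> * deriv f z - cnj \<alpha> * z * f z" for z
  have P1: "integrable lborel (\<lambda>z. (of_real l * f z + \<i> * T z) * cnj (z * deriv f z) * of_real (gauss 1 z))"
    and P2: "integrable lborel (\<lambda>z. of_real (\<rho> z) * (f z * cnj (z * deriv f z) * of_real (gauss 1 z)))"
    and P3: "(LINT z|lborel. (of_real l * f z + \<i> * T z) * cnj (z * deriv f z) * of_real (gauss 1 z)) =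
      (LINT z|lborel. of_real (\<rho> z) * (f z * cnj (z * deriv f z) * of_real (gauss 1 z)))"
    using pairing_general[OF growth _ _ bound, folded T_def] by auto
  have i0: "integrable lborel (\<lambda>z. z * f z * cnj (deriv f z) * of_real (gauss 1 z))"
    by (rule integrable_fock_mult[OF zf df])
  have i1: "integrable lborel (\<lambda>z. f z * cnj (z * deriv f z) * of_real (gauss 1 z))"
  proof (rule integrable_dominated[OF _ integrable_norm[OF i0]])
    show "(\<lambda>z. f z * cnj (z * deriv f z) * of_real (gauss 1 z)) \<in> borel_measurable lborel" by measurable
  qed (simp add: norm_mult)
  have i2: "integrable lborel (\<lambda>z. f z * cnj (deriv f z) * of_real (gauss 1 z))"
    by (rule integrable_fock_mult[OF f df])
  have i3: "integrable lborel (\<lambda>z. \<i> * T z * cnj (z * deriv f z) * of_real (gauss 1 z))"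
  proof -
    have "integrable lborel (\<lambda>z. (of_real l * f z + \<i> * T z) * cnj (z * deriv f z) * of_real (gauss 1 z)
        - of_real l * (f z * cnj (z * deriv f z) * of_real (gauss 1 z)))"
      by (intro Bochner_Integration.integrable_diff integrable_mult_right P1 i1)
    then show ?thesis by (simp add: algebra_simps)
  qed
  have ReIm: "Im (x * of_real r) = Im x * r" "Re (x * of_real r) = Re x * r" for x r by simp_all
  have gf: "gauss_growth s f" "gauss_growth s (\<lambda>z. z * f z)" "gauss_growth s (deriv f)" if "1 / 2 < s" for s
    using that by (auto intro!: fock_growth_any f zf df)
  have A: "(LINT z|lborel. Im (f z * cnj (z * deriv f z)) * gauss 1 z) = 0"
  proof -
    have e: "Re (\<i> * ((deriv f z - of_real 1 * cnj z * f z) * cnj (deriv f z))) * gauss 1 z =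
        Im (f z * cnj (z * deriv f z)) * gauss 1 z" for z
      by (simp add: algebra_simps)
    have "integrable lborel (\<lambda>z. Im (f z * cnj (z * deriv f z)) * gauss 1 z)"
      using integrable_Im[OF i1] unfolding ReIm .
    then show ?thesis
      using integration_by_parts_limit[of 1 f "deriv f" \<i>] gf i2 unfolding e by simp
  qed
  have B: "(LINT z|lborel. Im (\<i> * T z * cnj (z * deriv f z)) * gauss 1 z) = - Re (cnj \<alpha> * q)"
  proof -
    define X where "X z = Re (cnj \<alpha> * ((deriv (\<lambda>z. z * f z) z - of_real 1 * cnj z * (z * f z)) * cnj (deriv f z))) * gauss 1 z" for z
    have e: "Im (\<i> * T z * cnj (z * deriv f z)) * gauss 1 z =
        X z - Re (cnj \<alpha> * (f z * cnj (deriv f z) * of_real (gauss 1 z)))" for z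
      unfolding X_def deriv_ident_mult[OF hol] T_def by (simp add: algebra_simps)
    have iA: "integrable lborel (\<lambda>z. Im (\<i> * T z * cnj (z * deriv f z)) * gauss 1 z)"
      using integrable_Im[OF i3] unfolding ReIm .
    have iB: "integrable lborel (\<lambda>z. Re (cnj \<alpha> * (f z * cnj (deriv f z) * of_real (gauss 1 z))))"
      by (intro integrable_Re integrable_mult_right i2)
    have iX: "integrable lborel X"
      using Bochner_Integration.integrable_add[OF iA iB] unfolding e by simp
    have "(LINT z|lborel. X z) = 0"
      unfolding X_def by (rule integration_by_parts_limit) (use gf i0 iX in \<open>simp_all add: X_def[abs_def]\<close>)
    moreover have "(LINT z|lborel. Re (cnj \<alpha> * (f z * cnj (deriv f z) * of_real (gauss 1 z)))) = Re (cnj \<alpha> * q)"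
      using integral_Re[OF integrable_mult_right[OF i2, of "cnj \<alpha>"]] inner_values(4)
      unfolding fock_inner_def[of f] by (simp only: integral_mult_right_zero)
    ultimately show ?thesis
      unfolding e by (subst Bochner_Integration.integral_diff[OF iX iB]) simp
  qed
  have r: "\<rho> z * (Im (f z * cnj (z * deriv f z)) * gauss 1 z) = Im (of_real (\<rho> z) * (f z * cnj (z * deriv f z) * of_real (gauss 1 z)))" for z
    by simp
  show "integrable lborel (\<lambda>z. \<rho> z * (Im (f z * cnj (z * deriv f z)) * gauss 1 z))"
    unfolding r by (rule integrable_Im[OF P2])
  have "(LINT z|lborel. \<rho> z * (Im (f z * cnj (z * deriv f z)) * gauss 1 z)) =
      (LINT z|lborel. Im ((of_real l * f z + \<i> * T z) * cnj (z * deriv f z) * of_real (gauss 1 z)))"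
    unfolding r integral_Im[OF P2] integral_Im[OF P1] P3 ..
  also have "\<dots> = (LINT z|lborel. l * (Im (f z * cnj (z * deriv f z)) * gauss 1 z) + Im (\<i> * T z * cnj (z * deriv f z)) * gauss 1 z)"
    by (intro Bochner_Integration.integral_cong) (auto simp: algebra_simps)
  also have "\<dots> = l * (LINT z|lborel. Im (f z * cnj (z * deriv f z)) * gauss 1 z) + (LINT z|lborel. Im (\<i> * T z * cnj (z * deriv f z)) * gauss 1 z)"
  proof -
    have "integrable lborel (\<lambda>z. Im (f z * cnj (z * deriv f z)) * gauss 1 z)"
      "integrable lborel (\<lambda>z. Im (\<i> * T z * cnj (z * deriv f z)) * gauss 1 z)"
      using integrable_Im[OF i1] integrable_Im[OF i3] unfolding ReIm .
    then show ?thesis by (subst Bochner_Integration.integral_add) simp_all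
  qed
  finally show "(LINT z|lborel. \<rho> z * (Im (f z * cnj (z * deriv f z)) * gauss 1 z)) = - Re (cnj \<alpha> * q)"
    unfolding A B by simp
qed

end

section \<open>A bound for products and Wronskians\<close>

lemma gaussian_affine_pairing:
  assumes p: "gauss_growth s p" and s: "0 \<le> s" "s < 2"
  shows "integrable lborel (\<lambda>w. p w * cnj (a + b * w) * of_real (gauss 2 w))"
    and "(LINT w|lborel. p w * cnj (a + b * w) * of_real (gauss 2 w)) =
      of_real (pi / 2) * (p 0 * cnj a) + of_real (pi / 4) * (deriv p 0 * cnj b)"
proof -
  define d where "d = (2 - s) / 2"
  have d: "d > 0" "s + d < 2" "s < s + d" using s by (auto simp: d_def field_simps)
  have hol: "p holomorphic_on UNIV" using p by (rule gauss_growth_holomorphic)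
  note one = gauss_growth_const[of 0 1] and idg = gauss_growth_ident[of d]
  have dp: "gauss_growth (s + d) (deriv p)" using gauss_growth_deriv[OF p s(1) d(3)] .
  have i0: "integrable lborel (\<lambda>w. p w * of_real (gauss 2 w))"
    using gauss_growth_integrable[OF p one, of 2] s by simp
  have i1: "integrable lborel (\<lambda>w. p w * cnj w * of_real (gauss 2 w))"
    using gauss_growth_integrable[OF p idg, of 2] d by simp
  have i2: "integrable lborel (\<lambda>w. deriv p w * of_real (gauss 2 w))"
    using gauss_growth_integrable[OF dp one, of 2] d by simp
  have 1: "(LINT w|lborel. p w * of_real (gauss 2 w)) = of_real (pi / 2) * p 0"
    by (rule entire_gaussian_mean[OF hol _ i0]) simp
  have 2: "(LINT w|lborel. deriv p w * of_real (gauss 2 w)) = of_real (pi / 2) * deriv p 0"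
    using hol by (intro entire_gaussian_mean[OF _ _ i2] holomorphic_deriv) auto
  have "0 = (LINT w|lborel. (deriv p w - of_real 2 * cnj w * p w) * cnj 1 * of_real (gauss 2 w))"
    using gauss_growth_integration_by_parts[OF p one, of 2] s by simp
  also have "\<dots> = (LINT w|lborel. deriv p w * of_real (gauss 2 w) - 2 * (p w * cnj w * of_real (gauss 2 w)))"
    by (intro Bochner_Integration.integral_cong) (auto simp: algebra_simps)
  also have "\<dots> = of_real (pi / 2) * deriv p 0 - 2 * (LINT w|lborel. p w * cnj w * of_real (gauss 2 w))"
    using i1 i2 by (simp add: 2)
  finally have 3: "(LINT w|lborel. p w * cnj w * of_real (gauss 2 w)) = of_real (pi / 4) * deriv p 0"
    by (simp add: field_simps)
  have e: "p w * cnj (a + b * w) * of_real (gauss 2 w) =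
      cnj a * (p w * of_real (gauss 2 w)) + cnj b * (p w * cnj w * of_real (gauss 2 w))" for w
    by (simp add: algebra_simps)
  show "integrable lborel (\<lambda>w. p w * cnj (a + b * w) * of_real (gauss 2 w))"
    unfolding e by (intro Bochner_Integration.integrable_add integrable_mult_right i0 i1)
  show "(LINT w|lborel. p w * cnj (a + b * w) * of_real (gauss 2 w)) =
      of_real (pi / 2) * (p 0 * cnj a) + of_real (pi / 4) * (deriv p 0 * cnj b)"
    unfolding e Bochner_Integration.integral_add[OF integrable_mult_right[OF i0] integrable_mult_right[OF i1]]
      integral_mult_right_zero 1 3 by (simp add: mult_ac)
qed

text \<open>The squared norms of \<open>1\<close> and \<open>w\<close> for the weight \<open>gauss 2\<close> are \<open>pi / 2\<close> and \<open>pi / 4\<close>, and \<open>P\<close> is the orthogonal projection of \<open>p\<close>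
  to their span.\<close>

lemma gaussian_bessel:
  assumes p: "gauss_growth s p" and s: "0 \<le> s" "s < 2"
    and int: "integrable lborel (\<lambda>w. (cmod (p w))\<^sup>2 * gauss 2 w)"
  shows "pi / 2 * (cmod (p 0))\<^sup>2 + pi / 4 * (cmod (deriv p 0))\<^sup>2 \<le> (LINT w|lborel. (cmod (p w))\<^sup>2 * gauss 2 w)"
proof -
  define P where "P w = p 0 + deriv p 0 * w" for w
  have gP: "gauss_growth 1 P"
    unfolding P_def by (intro gauss_growth_add gauss_growth_cmult gauss_growth_const gauss_growth_ident) auto
  have P0: "P 0 = p 0" "deriv P 0 = deriv p 0"
    unfolding P_def by (auto intro!: DERIV_imp_deriv derivative_eq_intros)
  let ?T = "pi / 2 * (cmod (p 0))\<^sup>2 + pi / 4 * (cmod (deriv p 0))\<^sup>2"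
  have T: "of_real (pi / 2) * (p 0 * cnj (p 0)) + of_real (pi / 4) * (deriv p 0 * cnj (deriv p 0)) = complex_of_real ?T"
    by (simp add: mult_cnj_cmod)
  have A1: "integrable lborel (\<lambda>w. p w * cnj (P w) * of_real (gauss 2 w))"
    and A2: "(LINT w|lborel. p w * cnj (P w) * of_real (gauss 2 w)) = of_real ?T"
    using gaussian_affine_pairing[OF p s, of "p 0" "deriv p 0"] unfolding T P_def by auto
  have B1: "integrable lborel (\<lambda>w. P w * cnj (P w) * of_real (gauss 2 w))"
    and B2: "(LINT w|lborel. P w * cnj (P w) * of_real (gauss 2 w)) = of_real ?T"
    using gaussian_affine_pairing[OF gP, of "p 0" "deriv p 0"] unfolding P0 T P_def[symmetric] by auto
  have e: "(cmod (p w - P w))\<^sup>2 * gauss 2 w = (cmod (p w))\<^sup>2 * gauss 2 w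
      - 2 * Re (p w * cnj (P w) * of_real (gauss 2 w)) + Re (P w * cnj (P w) * of_real (gauss 2 w))" for w
    unfolding cmod_power2 by (simp add: power2_eq_square algebra_simps)
  have "0 \<le> (LINT w|lborel. (cmod (p w - P w))\<^sup>2 * gauss 2 w)" by (rule Bochner_Integration.integral_nonneg) simp
  also have "\<dots> = (LINT w|lborel. (cmod (p w))\<^sup>2 * gauss 2 w) - 2 * Re (of_real ?T) + Re (of_real ?T)"
    unfolding e A2[symmetric]
    by (subst Bochner_Integration.integral_add Bochner_Integration.integral_diff,
        (intro Bochner_Integration.integrable_diff integrable_mult_right integrable_Re int A1 B1)+)+
       (simp add: integral_Re[OF A1] integral_Re[OF B1] A2 B2 del: times_complex.sel)
  finally show ?thesis by simp
qed

text \<open>For fixed \<open>z\<close> the function \<open>p w = f (z + w) g (z - w)\<close> has value \<open>f g\<close> and derivative \<open>f' g - f g'\<close> at zero, and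
  \<open>|z + w|\<^sup>2 + |z - w|\<^sup>2 = 2 |z|\<^sup>2 + 2 |w|\<^sup>2\<close> matches the weights. Bessel's inequality is followed by an integration over \<open>z\<close>; the map
  \<open>(z, w) \<mapsto> (z + w, z - w)\<close> has Jacobian \<open>4\<close>.\<close>

lemma wronskian_bound:
  assumes f: "fock f" and g: "fock g"
  defines "F \<equiv> \<lambda>z. (cmod (f z))\<^sup>2 * gauss 1 z" and "G \<equiv> \<lambda>z. (cmod (g z))\<^sup>2 * gauss 1 z"
  shows "cmod (LINT z|lborel. f z * g z * cnj (deriv f z * g z - f z * deriv g z) * of_real (gauss 2 z)) \<le>
    (LINT z|lborel. F z) * (LINT z|lborel. G z) / (2 * sqrt 2 * pi)"
proof -
  have hol: "f holomorphic_on UNIV" "g holomorphic_on UNIV" using f g by (auto intro: fock_holomorphic)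
  have [measurable]: "f \<in> borel_measurable borel" "g \<in> borel_measurable borel"
    "deriv f \<in> borel_measurable borel" "deriv g \<in> borel_measurable borel"
    using hol by (auto intro!: entire_measurable holomorphic_deriv)
  have [measurable]: "F \<in> borel_measurable borel" "G \<in> borel_measurable borel"
    unfolding F_def G_def by measurable
  define X where "X z = f z * g z * cnj (deriv f z * g z - f z * deriv g z) * of_real (gauss 2 z)" for z
  have FG: "F z \<ge> 0" "G z \<ge> 0" for z by (auto simp: F_def G_def)
  have pointwise: "ennreal (cmod (X z)) \<le> ennreal (sqrt 2 / pi) * (\<integral>\<^sup>+w. ennreal (F (z + w) * G (z - w)) \<partial>lborel)" for z
  proof -
    define p where "p w = f (z + w) * g (z - w)" for w
    have eq: "F (z + w) * G (z - w) = gauss 2 z * ((cmod (p w))\<^sup>2 * gauss 2 w)" for w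
    proof -
      have "(cmod (z + w))\<^sup>2 + (cmod (z - w))\<^sup>2 = 2 * (cmod z)\<^sup>2 + 2 * (cmod w)\<^sup>2"
        unfolding cmod_power2 by (simp add: power2_eq_square algebra_simps)
      then have "gauss 1 (z + w) * gauss 1 (z - w) = gauss 2 z * gauss 2 w"
        unfolding gauss_def exp_add[symmetric] by simp
      moreover have "F (z + w) * G (z - w) = (cmod (p w))\<^sup>2 * (gauss 1 (z + w) * gauss 1 (z - w))"
        by (simp add: F_def G_def p_def norm_mult power_mult_distrib mult_ac)
      ultimately show ?thesis by (simp add: mult_ac)
    qed
    have gp: "gauss_growth (3/4 + 3/4) p"
    proof -
      have 1: "gauss_growth (3/4) (\<lambda>w. f (w + z))"
        by (rule gauss_growth_shift[OF fock_gauss_growth[OF f]]) auto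
      have 2: "gauss_growth (3/4) (\<lambda>w. g (- w + z))"
        using gauss_growth_uminus[OF gauss_growth_shift[OF fock_gauss_growth[OF g]], of "3/4" z] by simp
      show ?thesis using gauss_growth_mult[OF 1 2] by (simp add: p_def[abs_def] add.commute)
    qed
    have p0: "p 0 = f z * g z" "deriv p 0 = deriv f z * g z - f z * deriv g z"
    proof -
      have "((\<lambda>w. f (z + w)) has_field_derivative deriv f z * 1) (at 0)"
        by (rule DERIV_chain2) (auto intro!: derivative_eq_intros holomorphic_derivI[OF hol(1)])
      moreover have "((\<lambda>w. g (z - w)) has_field_derivative deriv g z * (-1)) (at 0)"
        by (rule DERIV_chain2) (auto intro!: derivative_eq_intros holomorphic_derivI[OF hol(2)])
      ultimately have "(p has_field_derivative (deriv f z * 1 * g (z - 0) + deriv g z * (-1) * f (z + 0))) (at 0)"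
        unfolding p_def[abs_def] by (rule DERIV_mult)
      then show "deriv p 0 = deriv f z * g z - f z * deriv g z"
        by (intro DERIV_imp_deriv) (simp add: mult.commute)
    qed (simp add: p_def)
    show ?thesis
    proof (cases "integrable lborel (\<lambda>w. (cmod (p w))\<^sup>2 * gauss 2 w)")
      case True
      define x where "x = cmod (p 0)"
      define y where "y = cmod (deriv p 0)"
      \<comment> \<open>The inequality between the means, weighted so that the coefficients are those of the Bessel inequality.\<close>
      have "0 \<le> pi / 4 * (sqrt 2 * x - y)\<^sup>2" by simp
      also have "\<dots> = pi / 2 * x\<^sup>2 + pi / 4 * y\<^sup>2 - pi / 2 * sqrt 2 * (x * y)"
        by (simp add: power2_eq_square algebra_simps)
      finally have "pi / 2 * sqrt 2 * (x * y) \<le> (LINT w|lborel. (cmod (p w))\<^sup>2 * gauss 2 w)"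
        using gaussian_bessel[OF gp _ _ True] by (simp add: x_def y_def)
      then have "sqrt 2 / pi * (pi / 2 * sqrt 2 * (x * y)) \<le> sqrt 2 / pi * (LINT w|lborel. (cmod (p w))\<^sup>2 * gauss 2 w)"
        by (rule mult_left_mono) simp
      then have "x * y \<le> sqrt 2 / pi * (LINT w|lborel. (cmod (p w))\<^sup>2 * gauss 2 w)"
        by (simp add: field_simps)
      then have "x * y * gauss 2 z \<le> sqrt 2 / pi * (LINT w|lborel. (cmod (p w))\<^sup>2 * gauss 2 w) * gauss 2 z"
        by (rule mult_right_mono) simp
      then have "cmod (X z) \<le> sqrt 2 / pi * (LINT w|lborel. F (z + w) * G (z - w))"
      proof -
        have "cmod (X z) = x * y * gauss 2 z"
          by (simp only: X_def x_def y_def p0 norm_mult complex_mod_cnj norm_of_real abs_of_nonneg[OF gauss_nonneg])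
        moreover have "(LINT w|lborel. F (z + w) * G (z - w)) = gauss 2 z * (LINT w|lborel. (cmod (p w))\<^sup>2 * gauss 2 w)"
          unfolding eq by (rule integral_mult_right_zero)
        ultimately show ?thesis
          using \<open>x * y * gauss 2 z \<le> _\<close> by (simp only: mult_ac)
      qed
      then have "ennreal (cmod (X z)) \<le> ennreal (sqrt 2 / pi * (LINT w|lborel. F (z + w) * G (z - w)))"
        by (rule ennreal_leI)
      also have "\<dots> = ennreal (sqrt 2 / pi) * ennreal (LINT w|lborel. F (z + w) * G (z - w))"
        by (rule ennreal_mult) (auto intro!: Bochner_Integration.integral_nonneg FG mult_nonneg_nonneg)
      also have "ennreal (LINT w|lborel. F (z + w) * G (z - w)) = (\<integral>\<^sup>+w. ennreal (F (z + w) * G (z - w)) \<partial>lborel)"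
        by (rule nn_integral_eq_integral[symmetric]) (use True in \<open>auto simp: eq\<close>)
      finally show ?thesis .
    next
      case False
      have [measurable]: "p \<in> borel_measurable borel" by (rule entire_measurable[OF gauss_growth_holomorphic[OF gp]])
      have "\<not> integrable lborel (\<lambda>w. F (z + w) * G (z - w))"
        unfolding eq using False by simp
      moreover have "(\<lambda>w. F (z + w) * G (z - w)) \<in> borel_measurable lborel" by measurable
      ultimately have "(\<integral>\<^sup>+w. ennreal (F (z + w) * G (z - w)) \<partial>lborel) = \<infinity>"
        using FG by (simp add: integrable_iff_bounded top.not_eq_extremum[symmetric])
      then show ?thesis by (simp add: ennreal_mult_top)
    qed
  qed
  have total: "(\<integral>\<^sup>+z. \<integral>\<^sup>+w. ennreal (F (z + w) * G (z - w)) \<partial>lborel \<partial>lborel) =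
      ennreal ((LINT z|lborel. F z) * (LINT z|lborel. G z) / 4)"
  proof -
    have iF: "(\<integral>\<^sup>+z. ennreal (F z) \<partial>lborel) = ennreal (LINT z|lborel. F z)"
      using fock_integrable_square[OF f] FG by (intro nn_integral_eq_integral) (auto simp: F_def)
    have iG: "(\<integral>\<^sup>+z. ennreal (G z) \<partial>lborel) = ennreal (LINT z|lborel. G z)"
      using fock_integrable_square[OF g] FG by (intro nn_integral_eq_integral) (auto simp: G_def)
    have "(\<integral>\<^sup>+z. \<integral>\<^sup>+w. ennreal (F (z + w) * G (z - w)) \<partial>lborel \<partial>lborel) =
        (\<integral>\<^sup>+w. \<integral>\<^sup>+z. ennreal (F (z + w) * G (z - w)) \<partial>lborel \<partial>lborel)"
      by (rule lborel_pair.Fubini'[symmetric]) measurable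
    also have "\<dots> = (\<integral>\<^sup>+w. \<integral>\<^sup>+z. ennreal (F z * G (z - 2 * w)) \<partial>lborel \<partial>lborel)"
    proof (rule nn_integral_cong)
      fix w
      show "(\<integral>\<^sup>+z. ennreal (F (z + w) * G (z - w)) \<partial>lborel) = (\<integral>\<^sup>+z. ennreal (F z * G (z - 2 * w)) \<partial>lborel)"
        using nn_integral_scaled[of "\<lambda>z. ennreal (F z * G (z - 2 * w))" 1 w] by (simp add: add.commute)
    qed
    also have "\<dots> = (\<integral>\<^sup>+z. \<integral>\<^sup>+w. ennreal (F z * G (z - 2 * w)) \<partial>lborel \<partial>lborel)"
      by (rule lborel_pair.Fubini') measurable
    also have "\<dots> = (\<integral>\<^sup>+z. ennreal (F z) * ennreal ((LINT z|lborel. G z) / 4) \<partial>lborel)"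
    proof (rule nn_integral_cong)
      fix z
      have "ennreal (LINT z|lborel. G z) = 4 * (\<integral>\<^sup>+w. ennreal (G (z - 2 * w)) \<partial>lborel)"
        using nn_integral_scaled[of "\<lambda>z. ennreal (G z)" "-2" z] by (simp add: iG scaleR_conv_of_real)
      then have "ennreal (1/4) * ennreal (LINT z|lborel. G z) = ennreal (1/4) * 4 * (\<integral>\<^sup>+w. ennreal (G (z - 2 * w)) \<partial>lborel)"
        by (simp add: mult.assoc)
      also have "ennreal (1/4) * 4 = 1" by (simp add: ennreal_mult[symmetric] flip: ennreal_numeral)
      finally have "(\<integral>\<^sup>+w. ennreal (G (z - 2 * w)) \<partial>lborel) = ennreal ((LINT z|lborel. G z) / 4)"
        by (simp add: ennreal_mult'[symmetric])
      then show "(\<integral>\<^sup>+w. ennreal (F z * G (z - 2 * w)) \<partial>lborel) = ennreal (F z) * ennreal ((LINT z|lborel. G z) / 4)"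
        using FG by (simp add: ennreal_mult nn_integral_cmult)
    qed
    also have "\<dots> = ennreal ((LINT z|lborel. F z) * (LINT z|lborel. G z) / 4)"
    proof -
      have "0 \<le> (LINT z|lborel. F z)" "0 \<le> (LINT z|lborel. G z) / 4"
        using FG by (auto intro!: Bochner_Integration.integral_nonneg)
      then show ?thesis by (simp add: nn_integral_multc iF ennreal_mult[symmetric])
    qed
    finally show ?thesis .
  qed
  have nonneg: "0 \<le> (LINT z|lborel. F z) * (LINT z|lborel. G z) / (2 * sqrt 2 * pi)"
    using FG by (auto intro!: Bochner_Integration.integral_nonneg mult_nonneg_nonneg divide_nonneg_pos)
  show ?thesis
  proof (cases "integrable lborel X")
    case True
    have "ennreal (norm (LINT z|lborel. X z)) \<le> (\<integral>\<^sup>+z. ennreal (norm (X z)) \<partial>lborel)"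
      by (rule integral_norm_bound_ennreal[OF True])
    also have "\<dots> \<le> (\<integral>\<^sup>+z. ennreal (sqrt 2 / pi) * (\<integral>\<^sup>+w. ennreal (F (z + w) * G (z - w)) \<partial>lborel) \<partial>lborel)"
      by (intro nn_integral_mono pointwise)
    also have "\<dots> = ennreal (sqrt 2 / pi) * ennreal ((LINT z|lborel. F z) * (LINT z|lborel. G z) / 4)"
      unfolding total[symmetric] by (rule nn_integral_cmult) measurable
    also have "\<dots> = ennreal (sqrt 2 / pi * ((LINT z|lborel. F z) * (LINT z|lborel. G z) / 4))"
      by (rule ennreal_mult'[symmetric]) simp
    also have "sqrt 2 / pi * ((LINT z|lborel. F z) * (LINT z|lborel. G z) / 4) = (LINT z|lborel. F z) * (LINT z|lborel. G z) / (2 * sqrt 2 * pi)"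
      by (simp add: field_simps)
    finally show ?thesis using nonneg unfolding X_def by (simp add: ennreal_le_iff)
  next
    case False
    then show ?thesis using nonneg unfolding X_def by (simp add: not_integrable_integral_eq)
  qed
qed

section \<open>The stationary pair\<close>

lemma null_line:
  assumes "\<alpha> \<noteq> 0" shows "AE z in lborel. Im (cnj \<alpha> * z) \<noteq> c"
proof -
  have eq: "{z. Im (cnj \<alpha> * z) = c} = {z. (\<i> * \<alpha>) \<bullet> z = c}"
    by (auto simp: inner_complex_def)
  have "negligible {z. Im (cnj \<alpha> * z) = c}"
    unfolding eq using assms by (intro negligible_hyperplane) auto
  moreover have "{z. Im (cnj \<alpha> * z) = c} \<in> sets lborel"
    unfolding eq by (auto intro!: borel_closed closed_hyperplane)
  ultimately have "{z. Im (cnj \<alpha> * z) = c} \<in> null_sets lborel"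
    by (simp add: negligible_iff_null_sets null_sets_completion_iff)
  from AE_not_in[OF this] show ?thesis by simp
qed

context wave_component
begin

text \<open>The right-hand side is the integral of \<open>(Im (cnj \<alpha> z) - c)\<^sup>2\<close> for the density \<open>|U|\<^sup>2\<close>; it
  could only vanish if the density were carried by a line.\<close>

lemma variance_positive:
  assumes \<alpha>: "\<alpha> \<noteq> 0" and m: "m \<noteq> 0"
  shows "0 < (LINT z|lborel. (Im (cnj \<alpha> * z))\<^sup>2 * ((cmod (f z))\<^sup>2 * gauss 1 z)) - 2 * c * Im (cnj \<alpha> * q) + c\<^sup>2 * m"
proof -
  let ?y = "\<lambda>z. Im (cnj \<alpha> * z)" and ?F = "\<lambda>z. (cmod (f z))\<^sup>2 * gauss 1 z"
  have [measurable]: "(\<lambda>z. cnj \<alpha> * z) \<in> borel_measurable borel" by measurable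
  have y: "\<bar>?y z\<bar> \<le> cmod \<alpha> * (1 + (cmod z)\<^sup>2)" for z
  proof -
    have "cmod z \<le> 1 + (cmod z)\<^sup>2"
      using zero_le_power2[of "cmod z - 1/2"] by (simp add: power2_eq_square algebra_simps)
    then show ?thesis using Im_cnj_mult_bound[of z] mult_left_mono[OF _ norm_ge_zero[of \<alpha>]] order_trans by blast
  qed
  have y2: "\<bar>(?y z)\<^sup>2\<bar> \<le> (cmod \<alpha>)\<^sup>2 * (1 + (cmod z)\<^sup>2)" for z
  proof -
    have "\<bar>?y z\<bar>\<^sup>2 \<le> (cmod \<alpha> * cmod z)\<^sup>2" by (rule power_mono[OF Im_cnj_mult_bound]) simp
    also have "\<dots> \<le> (cmod \<alpha>)\<^sup>2 * (1 + (cmod z)\<^sup>2)" by (simp add: power_mult_distrib mult_left_mono)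
    finally show ?thesis by (simp del: times_complex.sel)
  qed
  have i1: "integrable lborel (\<lambda>z. ?y z * ?F z)" by (rule integrable_quadratic_moment[OF _ y]) measurable
  have i2: "integrable lborel (\<lambda>z. (?y z)\<^sup>2 * ?F z)" by (rule integrable_quadratic_moment[OF _ y2]) measurable
  note i0 = fock_integrable_square[OF f]
  have e: "(?y z - c)\<^sup>2 * ?F z = (?y z)\<^sup>2 * ?F z - 2 * c * (?y z * ?F z) + c\<^sup>2 * ?F z" for z
    by (simp only: power2_diff) (simp add: algebra_simps del: times_complex.sel)
  have i: "integrable lborel (\<lambda>z. (?y z - c)\<^sup>2 * ?F z)"
    unfolding e by (intro Bochner_Integration.integrable_add Bochner_Integration.integrable_diff integrable_mult_right i0 i1 i2)
  have I: "(LINT z|lborel. (?y z - c)\<^sup>2 * ?F z) = (LINT z|lborel. (?y z)\<^sup>2 * ?F z) - 2 * c * Im (cnj \<alpha> * q) + c\<^sup>2 * m"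
  proof -
    have "(LINT z|lborel. (?y z - c)\<^sup>2 * ?F z) =
        (LINT z|lborel. (?y z)\<^sup>2 * ?F z) - (LINT z|lborel. 2 * c * (?y z * ?F z)) + (LINT z|lborel. c\<^sup>2 * ?F z)"
      unfolding e Bochner_Integration.integral_add[OF Bochner_Integration.integrable_diff[OF i2 integrable_mult_right[OF i1, of "2 * c"]] integrable_mult_right[OF i0, of "c\<^sup>2"]]
        Bochner_Integration.integral_diff[OF i2 integrable_mult_right[OF i1, of "2 * c"]] ..
    then show ?thesis unfolding integral_mult_right_zero first_moment .
  qed
  have "(LINT z|lborel. (?y z - c)\<^sup>2 * ?F z) \<noteq> 0"
  proof
    assume "(LINT z|lborel. (?y z - c)\<^sup>2 * ?F z) = 0"
    then have "AE z in lborel. (?y z - c)\<^sup>2 * ?F z = 0"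
      by (subst (asm) integral_nonneg_eq_0_iff_AE[OF i]) auto
    with null_line[OF \<alpha>, of c] have "AE z in lborel. ?F z = 0"
      by eventually_elim (simp del: times_complex.sel)
    then have "m = (LINT z::complex|lborel. 0)" by (intro Bochner_Integration.integral_cong_AE) auto
    with m show False by simp
  qed
  moreover have "0 \<le> (LINT z|lborel. (?y z - c)\<^sup>2 * ?F z)" by (rule Bochner_Integration.integral_nonneg) simp
  ultimately show ?thesis unfolding I by simp
qed

end

locale wave_pair =
  fixes f g :: "complex \<Rightarrow> complex" and l \<mu> :: real and \<alpha> :: complex
  assumes f: "fock f" and zf: "fock (\<lambda>z. z * f z)" and g: "fock g" and zg: "fock (\<lambda>z. z * g z)"
    and eq_f: "\<And>z. fock_proj (\<lambda>w. of_real ((cmod (g w))\<^sup>2 * gauss 1 w) * (of_real (gauss (1/2) w) * f w)) z =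
      of_real (gauss (1/2) z) * (of_real l * f z + \<i> * (\<alpha> * deriv f z - cnj \<alpha> * z * f z))"
    and eq_g: "\<And>z. fock_proj (\<lambda>w. of_real (- ((cmod (f w))\<^sup>2 * gauss 1 w)) * (of_real (gauss (1/2) w) * g w)) z =
      of_real (gauss (1/2) z) * (of_real \<mu> * g z + \<i> * (\<alpha> * deriv g z - cnj \<alpha> * z * g z))"
    and \<alpha>: "\<alpha> \<noteq> 0"
begin

lemma density_bounded:
  assumes h: "fock h" shows "\<exists>R. \<forall>z. \<bar>(cmod (h z))\<^sup>2 * gauss 1 z\<bar> \<le> R"
  using fock_pointwise_bound[OF h] by (intro exI[of _ "(LINT z|lborel. (cmod (h z))\<^sup>2 * gauss 1 z) / pi"]) simp

lemma density_integrable: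
  assumes a: "fock a" "fock (\<lambda>z. z * a z)" and b: "fock b"
  shows "integrable lborel (\<lambda>z. (1 + cmod z) * (\<bar>(cmod (b z))\<^sup>2 * gauss 1 z\<bar> * (cmod (a z) * gauss (1/2) z)))"
proof -
  obtain C where C: "C \<ge> 0" "\<And>z. cmod (b z) * gauss (1/2) z \<le> C" using fock_bounded[OF b] by blast
  have [measurable]: "a \<in> borel_measurable borel" "b \<in> borel_measurable borel"
    using a b by (auto intro!: entire_measurable fock_holomorphic)
  show ?thesis
  proof (rule integrable_dominated)
    show "integrable lborel (\<lambda>z. C * (norm (a z * cnj (b z) * of_real (gauss 1 z)) + norm (z * a z * cnj (b z) * of_real (gauss 1 z))))"
      by (intro integrable_mult_right Bochner_Integration.integrable_add integrable_norm integrable_fock_mult a b)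
    fix z
    have "(cmod (b z) * gauss (1/2) z) * ((1 + cmod z) * cmod (a z) * cmod (b z) * gauss 1 z) \<le>
        C * ((1 + cmod z) * cmod (a z) * cmod (b z) * gauss 1 z)"
      by (rule mult_right_mono[OF C(2)]) simp
    then show "norm ((1 + cmod z) * (\<bar>(cmod (b z))\<^sup>2 * gauss 1 z\<bar> * (cmod (a z) * gauss (1/2) z))) \<le>
        C * (norm (a z * cnj (b z) * of_real (gauss 1 z)) + norm (z * a z * cnj (b z) * of_real (gauss 1 z)))"
      by (simp add: norm_mult power2_eq_square algebra_simps)
  qed measurable
qed

lemma density_measurable: "fock h \<Longrightarrow> (\<lambda>z. (cmod (h z))\<^sup>2 * gauss 1 z) \<in> borel_measurable borel"
  using entire_measurable[OF fock_holomorphic] by measurable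

sublocale F: wave_component f "\<lambda>z. (cmod (g z))\<^sup>2 * gauss 1 z" l \<alpha>
  by unfold_locales (use f zf density_measurable[OF g] density_bounded[OF g] density_integrable[OF f zf g] eq_f in auto)

sublocale G: wave_component g "\<lambda>z. - ((cmod (f z))\<^sup>2 * gauss 1 z)" \<mu> \<alpha>
  using g zg density_measurable[OF f] density_bounded[OF f] density_integrable[OF g zg f] eq_g
  by unfold_locales (auto simp: abs_minus_cancel)

abbreviation k where "k \<equiv> \<lambda>z. f z * g z"

lemma deriv_k: "deriv k z = deriv f z * g z + f z * deriv g z"
  by (rule DERIV_imp_deriv) (auto intro!: derivative_eq_intros holomorphic_derivI[OF F.hol] holomorphic_derivI[OF G.hol])

lemma k_growth: "1 < s \<Longrightarrow> gauss_growth s k" "1 < s \<Longrightarrow> gauss_growth s (deriv k)"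
proof -
  have k: "gauss_growth 1 k" using gauss_growth_mult[OF fock_gauss_growth[OF f] fock_gauss_growth[OF g]] by simp
  then show "1 < s \<Longrightarrow> gauss_growth s k" "1 < s \<Longrightarrow> gauss_growth s (deriv k)"
    by (auto intro: gauss_growth_mono gauss_growth_deriv)
qed

lemma gauss2: "complex_of_real (gauss 2 z) = of_real (gauss 1 z) * of_real (gauss 1 z)"
  using gauss_mult[of 1 z 1] by (simp flip: of_real_mult)

text \<open>The integrands of \<open>|V|\<^sup>2 \<partial>\<^bsub>zbar\<^esub>(|U|\<^sup>2)\<close> and \<open>|U|\<^sup>2 \<partial>\<^bsub>zbar\<^esub>(|V|\<^sup>2)\<close>.\<close>

abbreviation A where "A z \<equiv> complex_of_real ((cmod (g z))\<^sup>2 * gauss 1 z) * ((f z * cnj (deriv f z) - z * f z * cnj (f z)) * of_real (gauss 1 z))"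
abbreviation B where "B z \<equiv> complex_of_real ((cmod (f z))\<^sup>2 * gauss 1 z) * ((g z * cnj (deriv g z) - z * g z * cnj (g z)) * of_real (gauss 1 z))"

lemma integrable_density_mult:
  assumes h: "fock h" and a: "fock a" "fock b"
  shows "integrable lborel (\<lambda>z. complex_of_real ((cmod (h z))\<^sup>2 * gauss 1 z) * (a z * cnj (b z) * of_real (gauss 1 z)))"
proof -
  obtain R where "\<And>z. \<bar>(cmod (h z))\<^sup>2 * gauss 1 z\<bar> \<le> R" using density_bounded[OF h] by blast
  then have R: "cmod (complex_of_real ((cmod (h z))\<^sup>2 * gauss 1 z)) \<le> R" for z unfolding norm_of_real .
  have [measurable]: "h \<in> borel_measurable borel" by (rule entire_measurable[OF fock_holomorphic[OF h]])
  show ?thesis by (rule integrable_fock_mult_bounded[OF a _ R]) measurable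
qed

lemma A_int: "integrable lborel A" and B_int: "integrable lborel B"
proof -
  have "integrable lborel (\<lambda>z. complex_of_real ((cmod (g z))\<^sup>2 * gauss 1 z) * (f z * cnj (deriv f z) * of_real (gauss 1 z))
      - complex_of_real ((cmod (g z))\<^sup>2 * gauss 1 z) * (z * f z * cnj (f z) * of_real (gauss 1 z)))"
    by (intro Bochner_Integration.integrable_diff integrable_density_mult f g zf F.df)
  then show "integrable lborel A" by (simp add: algebra_simps)
  have "integrable lborel (\<lambda>z. complex_of_real ((cmod (f z))\<^sup>2 * gauss 1 z) * (g z * cnj (deriv g z) * of_real (gauss 1 z))
      - complex_of_real ((cmod (f z))\<^sup>2 * gauss 1 z) * (z * g z * cnj (g z) * of_real (gauss 1 z)))"
    by (intro Bochner_Integration.integrable_diff integrable_density_mult f g zg G.df)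
  then show "integrable lborel B" by (simp add: algebra_simps)
qed

lemma A_value: "(LINT z|lborel. A z) = - \<i> * \<alpha> * of_real F.m" by (rule F.speed_identity)

lemma B_value: "(LINT z|lborel. B z) = \<i> * \<alpha> * of_real G.m"
proof -
  have "(LINT z|lborel. - B z) = - \<i> * \<alpha> * of_real G.m"
    using G.speed_identity by simp
  then show ?thesis by (simp only: Bochner_Integration.integral_minus) (simp add: minus_equation_iff)
qed

text \<open>\<open>A + B\<close> is the \<open>zbar\<close>-derivative of \<open>|f g|\<^sup>2 gauss 2\<close>, so its integral vanishes, while the two speed identities have opposite
  signs.\<close>

lemma masses_equal: "F.m = G.m"
proof -
  have e: "(deriv k z - of_real 2 * cnj z * k z) * cnj (k z) * of_real (gauss 2 z) = cnj (A z + B z)" for z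
    unfolding deriv_k gauss2 of_real_mult complex_norm_square by (simp add: algebra_simps)
  have i0: "integrable lborel (\<lambda>z. k z * cnj (k z) * of_real (gauss 2 z))"
  proof -
    have k2: "k z * cnj (k z) * of_real (gauss 2 z) = complex_of_real ((cmod (g z))\<^sup>2 * gauss 1 z) * (f z * cnj (f z) * of_real (gauss 1 z))" for z
      unfolding gauss2 by (simp add: mult_cnj_cmod[symmetric] mult_ac)
    show ?thesis unfolding k2 by (rule integrable_density_mult[OF g f f])
  qed
  have "(LINT z|lborel. (deriv k z - of_real 2 * cnj z * k z) * cnj (k z) * of_real (gauss 2 z)) = 0"
    by (rule integration_by_parts_L1[OF _ _ _ i0]) (use k_growth A_int B_int in \<open>auto simp only: e complex_integrable_cnj intro: Bochner_Integration.integrable_add\<close>)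
  then have "(LINT z|lborel. A z + B z) = 0"
    unfolding e Bochner_Integration.integral_cnj by (simp only: complex_cnj_zero_iff)
  then have "(LINT z|lborel. A z) + (LINT z|lborel. B z) = 0"
    by (simp only: Bochner_Integration.integral_add[OF A_int B_int])
  then have "\<i> * \<alpha> * (of_real G.m - of_real F.m) = 0"
    unfolding A_value B_value by (simp add: algebra_simps)
  then show ?thesis using \<alpha> by simp
qed

text \<open>The sum of the angular integrands of the two components is the one of the product \<open>k = f g\<close> for the weight
  \<open>gauss 2\<close>. It is a total derivative: with \<open>a = k\<close>, \<open>b = k'\<close> and the factor \<open>\<i>\<close>, the term \<open>|k'|\<^sup>2\<close> drops out of the
  integration by parts.\<close>

lemma Re_dipole_eq_0: "Re (cnj \<alpha> * (F.q - G.q)) = 0"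
proof -
  let ?a = "\<lambda>z. (cmod (g z))\<^sup>2 * gauss 1 z * (Im (f z * cnj (z * deriv f z)) * gauss 1 z)"
  let ?b = "\<lambda>z. - ((cmod (f z))\<^sup>2 * gauss 1 z) * (Im (g z * cnj (z * deriv g z)) * gauss 1 z)"
  have e: "Re (\<i> * ((deriv k z - of_real 2 * cnj z * k z) * cnj (deriv k z))) * gauss 2 z = 2 * (?a z - ?b z)" for z
  proof -
    have "Re (\<i> * ((d - of_real 2 * c * y) * cnj d)) = 2 * Im (c * y * cnj d)" for d c y
      by (simp add: algebra_simps)
    then have 1: "Re (\<i> * ((deriv k z - of_real 2 * cnj z * k z) * cnj (deriv k z))) = 2 * Im (cnj z * k z * cnj (deriv k z))" .
    have 2: "cnj z * k z * cnj (deriv k z) = (of_real ((cmod (g z))\<^sup>2) * (f z * cnj (z * deriv f z))) + of_real ((cmod (f z))\<^sup>2) * (g z * cnj (z * deriv g z))"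
      unfolding deriv_k complex_norm_square by (simp add: algebra_simps)
    have R: "Im (of_real r * x) = r * Im x" for r x by simp
    have 3: "Im (cnj z * k z * cnj (deriv k z)) = (cmod (g z))\<^sup>2 * Im (f z * cnj (z * deriv f z)) + (cmod (f z))\<^sup>2 * Im (g z * cnj (z * deriv g z))"
      unfolding 2 plus_complex.sel R ..
    show ?thesis unfolding 1 3 gauss_mult[of 1 z 1, simplified, symmetric] by (simp add: algebra_simps del: times_complex.sel complex_cnj_mult)
  qed
  have i0: "integrable lborel (\<lambda>z. k z * cnj (deriv k z) * of_real (gauss 2 z))"
  proof -
    have "k z * cnj (deriv k z) * of_real (gauss 2 z) =
        complex_of_real ((cmod (g z))\<^sup>2 * gauss 1 z) * (f z * cnj (deriv f z) * of_real (gauss 1 z)) +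
        complex_of_real ((cmod (f z))\<^sup>2 * gauss 1 z) * (g z * cnj (deriv g z) * of_real (gauss 1 z))" for z
      unfolding gauss2 deriv_k of_real_mult complex_norm_square by (simp add: algebra_simps)
    then show ?thesis using integrable_density_mult[OF g f F.df] integrable_density_mult[OF f g G.df] by simp
  qed
  have i1: "integrable lborel (\<lambda>z. Re (\<i> * ((deriv k z - of_real 2 * cnj z * k z) * cnj (deriv k z))) * gauss 2 z)"
    unfolding e by (intro integrable_mult_right Bochner_Integration.integrable_diff F.angular_identity(1) G.angular_identity(1))
  have "(LINT z|lborel. Re (\<i> * ((deriv k z - of_real 2 * cnj z * k z) * cnj (deriv k z))) * gauss 2 z) = 0"
    by (rule integration_by_parts_limit[OF _ _ _ i0 i1]) (use k_growth in auto)
  then have "2 * ((LINT z|lborel. ?a z) - (LINT z|lborel. ?b z)) = 0"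
    unfolding e by (simp only: integral_mult_right_zero Bochner_Integration.integral_diff[OF F.angular_identity(1) G.angular_identity(1)])
  then show ?thesis unfolding F.angular_identity(2) G.angular_identity(2) by (simp add: algebra_simps)
qed

abbreviation H where "H \<equiv> (LINT z|lborel. (cmod (g z))\<^sup>2 * gauss 1 z * ((cmod (f z))\<^sup>2 * gauss 1 z))"

lemma energy_f: "H = l * F.m + 2 * Im (cnj \<alpha> * F.q)" by (rule F.energy_identity)

lemma energy_g: "- H = \<mu> * G.m + 2 * Im (cnj \<alpha> * G.q)"
proof -
  have "(LINT z|lborel. - ((cmod (g z))\<^sup>2 * gauss 1 z * ((cmod (f z))\<^sup>2 * gauss 1 z))) = \<mu> * G.m + 2 * Im (cnj \<alpha> * G.q)"
    unfolding G.energy_identity[symmetric] by (intro Bochner_Integration.integral_cong) auto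
  then show ?thesis by (simp only: Bochner_Integration.integral_minus)
qed

lemma parameter_relation: "(l - \<mu>) * F.m + 2 * Im (cnj \<alpha> * (F.q - G.q)) = 2 * H"
  using energy_f energy_g masses_equal by (simp add: algebra_simps)

text \<open>Suppose the means of \<open>y = Im (cnj \<alpha> z)\<close> for the two densities coincide, with \<open>Y\<close> the common value of the unnormalised
  means and \<open>M\<close> the common mass. The energy balances give \<open>(l + \<mu>) M = - 4 Y\<close>, the moment identities give \<open>(l + \<mu>) Y + 2 J = 0\<close> for the
  second moment \<open>J\<close>, and together they state that \<open>y\<close> has variance zero.\<close>

lemma Im_dipole_nonzero:
  assumes m: "F.m \<noteq> 0"
  shows "Im (cnj \<alpha> * (F.q - G.q)) \<noteq> 0"
proof
  assume Im0: "Im (cnj \<alpha> * (F.q - G.q)) = 0"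
  define Y where "Y = Im (cnj \<alpha> * F.q)"
  have Yg: "Im (cnj \<alpha> * G.q) = Y" using Im0 by (simp add: Y_def algebra_simps)
  define M where "M = F.m"
  have Mg: "G.m = M" using masses_equal by (simp add: M_def)
  define J where "J = (LINT z|lborel. (Im (cnj \<alpha> * z))\<^sup>2 * ((cmod (f z))\<^sup>2 * gauss 1 z)) +
    (LINT z|lborel. (Im (cnj \<alpha> * z))\<^sup>2 * ((cmod (g z))\<^sup>2 * gauss 1 z))"
  have M0: "M \<noteq> 0" using m by (simp add: M_def)
  have sum: "(l + \<mu>) * M = - 4 * Y"
    using energy_f energy_g unfolding Yg Y_def[symmetric] Mg M_def[symmetric] by (simp add: algebra_simps)
  have "(LINT z|lborel. - ((cmod (f z))\<^sup>2 * gauss 1 z) * (Im (cnj \<alpha> * z) * ((cmod (g z))\<^sup>2 * gauss 1 z))) =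
      - (LINT z|lborel. (cmod (g z))\<^sup>2 * gauss 1 z * (Im (cnj \<alpha> * z) * ((cmod (f z))\<^sup>2 * gauss 1 z)))"
    by (subst Bochner_Integration.integral_minus[symmetric], intro Bochner_Integration.integral_cong) (auto simp: mult_ac simp del: times_complex.sel)
  then have mom: "(l + \<mu>) * Y + 2 * J = 0"
    unfolding F.imaginary_moment_identity G.imaginary_moment_identity Yg Y_def[symmetric] J_def by (simp add: algebra_simps)
  have "0 < J - 2 * (Y / M) * (2 * Y) + (Y / M)\<^sup>2 * (2 * M)"
    using F.variance_positive[OF \<alpha>, of "Y / M"] G.variance_positive[OF \<alpha>, of "Y / M"] M0
    unfolding Yg Y_def[symmetric] Mg M_def[symmetric] J_def by simp
  also have "\<dots> = J - 2 * Y\<^sup>2 / M" using M0 by (simp add: field_simps power2_eq_square)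
  finally have "0 < J - 2 * Y\<^sup>2 / M" .
  moreover have "J = 2 * Y\<^sup>2 / M"
  proof -
    have "(l + \<mu>) = - 4 * Y / M" using sum M0 by (simp add: field_simps)
    then show ?thesis using mom by (simp add: power2_eq_square)
  qed
  ultimately show False by simp
qed

text \<open>Subtracting the speed identities of the components turns the \<open>zbar\<close>-derivatives into a Wronskian.\<close>

lemma speed_bound:
  assumes m: "F.m \<noteq> 0"
  shows "cmod \<alpha> \<le> F.m / (4 * sqrt 2 * pi)"
proof -
  have m0: "F.m > 0" using m by (simp add: less_le Bochner_Integration.integral_nonneg)
  have e: "A z - B z = f z * g z * cnj (deriv f z * g z - f z * deriv g z) * of_real (gauss 2 z)" for z
    unfolding gauss2 of_real_mult complex_norm_square by (simp add: algebra_simps)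
  have "(LINT z|lborel. f z * g z * cnj (deriv f z * g z - f z * deriv g z) * of_real (gauss 2 z)) = - 2 * \<i> * \<alpha> * of_real F.m"
    unfolding e[symmetric] Bochner_Integration.integral_diff[OF A_int B_int] A_value B_value masses_equal[symmetric] by simp
  then have "2 * cmod \<alpha> * F.m \<le> F.m * F.m / (2 * sqrt 2 * pi)"
    using wronskian_bound[OF f g] m0 unfolding masses_equal[symmetric] by (simp add: norm_mult)
  then have "(2 * cmod \<alpha>) * F.m \<le> (F.m / (2 * sqrt 2 * pi)) * F.m" by simp
  then have "2 * cmod \<alpha> \<le> F.m / (2 * sqrt 2 * pi)" using m0 by (rule mult_right_le_imp_le)
  then show ?thesis by (simp add: field_simps)
qed

end

section \<open>Symmetries of the system\<close>

lemma gauss_half: "exp (- (cmod z)\<^sup>2 / 2) = gauss (1/2) z"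
  by (simp add: gauss_def)

lemma cmod_square_gauss_half: "(cmod (of_real (gauss (1/2) z) * x))\<^sup>2 = (cmod x)\<^sup>2 * gauss 1 z"
  using gauss_mult[of "1/2" z "1/2"] by (simp add: norm_mult power_mult_distrib power2_eq_square[of "gauss _ _"])

lemma bargmann_fock_iff:
  "u \<in> bargmann_fock \<longleftrightarrow> (\<exists>f. fock f \<and> u = (\<lambda>z. of_real (gauss (1/2) z) * f z))"
proof -
  have "(\<lambda>z. of_real (gauss (1/2) z) * f z) \<in> L2 \<longleftrightarrow> integrable lborel (\<lambda>z. (cmod (f z))\<^sup>2 * gauss 1 z)"
    if "f holomorphic_on UNIV" for f
  proof -
    have [measurable]: "f \<in> borel_measurable borel" using that by (rule entire_measurable)
    have "(\<lambda>z. complex_of_real (gauss (1/2) z) * f z) \<in> borel_measurable lborel" by measurable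
    then show ?thesis by (simp add: L2_def cmod_square_gauss_half)
  qed
  then show ?thesis unfolding bargmann_fock_def fock_def gauss_half by auto
qed

lemma bargmann_fockI: "fock f \<Longrightarrow> (\<And>z. u z = of_real (gauss (1/2) z) * f z) \<Longrightarrow> u \<in> bargmann_fock"
  unfolding bargmann_fock_iff by (rule exI[of _ f]) auto

lemma L21_iff:
  "u \<in> L21 \<longleftrightarrow> (\<exists>f. fock f \<and> fock (\<lambda>z. z * f z) \<and> u = (\<lambda>z. of_real (gauss (1/2) z) * f z))"
proof -
  have key: "(\<lambda>z. of_real (bracket z) * (of_real (gauss (1/2) z) * f z)) \<in> L2 \<longleftrightarrow> fock (\<lambda>z. z * f z)"
    if f: "fock f" for f
  proof -
    have [measurable]: "f \<in> borel_measurable borel" using f by (intro entire_measurable fock_holomorphic)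
    have m: "(\<lambda>z. complex_of_real (bracket z) * (of_real (gauss (1/2) z) * f z)) \<in> borel_measurable lborel"
      unfolding bracket_def by measurable
    have "(cmod (of_real (bracket z) * (of_real (gauss (1/2) z) * f z)))\<^sup>2 =
        (cmod (f z))\<^sup>2 * gauss 1 z + (cmod (z * f z))\<^sup>2 * gauss 1 z" for z
    proof -
      have "(cmod (of_real (bracket z) * (of_real (gauss (1/2) z) * f z)))\<^sup>2 = (bracket z)\<^sup>2 * ((cmod (f z))\<^sup>2 * gauss 1 z)"
        unfolding norm_mult[of "of_real (bracket z)"] power_mult_distrib cmod_square_gauss_half by simp
      also have "(bracket z)\<^sup>2 = 1 + (cmod z)\<^sup>2" by (simp add: bracket_def)
      finally show ?thesis by (simp add: norm_mult power_mult_distrib algebra_simps)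
    qed
    then have "(\<lambda>z. of_real (bracket z) * (of_real (gauss (1/2) z) * f z)) \<in> L2 \<longleftrightarrow>
        integrable lborel (\<lambda>z. (cmod (f z))\<^sup>2 * gauss 1 z + (cmod (z * f z))\<^sup>2 * gauss 1 z)"
      using m by (simp add: L2_def)
    also have "\<dots> \<longleftrightarrow> integrable lborel (\<lambda>z. (cmod (z * f z))\<^sup>2 * gauss 1 z)"
    proof
      assume "integrable lborel (\<lambda>z. (cmod (f z))\<^sup>2 * gauss 1 z + (cmod (z * f z))\<^sup>2 * gauss 1 z)"
      from Bochner_Integration.integrable_diff[OF this fock_integrable_square[OF f]]
      show "integrable lborel (\<lambda>z. (cmod (z * f z))\<^sup>2 * gauss 1 z)" by simp
    qed (rule Bochner_Integration.integrable_add[OF fock_integrable_square[OF f]])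
    also have "\<dots> \<longleftrightarrow> fock (\<lambda>z. z * f z)"
      using fock_holomorphic[OF f] by (simp add: fock_def holomorphic_intros)
    finally show ?thesis .
  qed
  show ?thesis
  proof
    assume u: "u \<in> L21"
    then obtain f where f: "fock f" "u = (\<lambda>z. of_real (gauss (1/2) z) * f z)"
      unfolding L21_def bargmann_fock_iff by auto
    moreover have "fock (\<lambda>z. z * f z)" using u key[OF f(1)] unfolding L21_def f(2) by simp
    ultimately show "\<exists>f. fock f \<and> fock (\<lambda>z. z * f z) \<and> u = (\<lambda>z. of_real (gauss (1/2) z) * f z)" by blast
  next
    assume "\<exists>f. fock f \<and> fock (\<lambda>z. z * f z) \<and> u = (\<lambda>z. of_real (gauss (1/2) z) * f z)"
    then obtain f where f: "fock f" "fock (\<lambda>z. z * f z)" "u = (\<lambda>z. of_real (gauss (1/2) z) * f z)" by blast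
    then show "u \<in> L21" using key[OF f(1)] unfolding L21_def bargmann_fock_iff by auto
  qed
qed

lemma fock_cmult: assumes "fock f" shows "fock (\<lambda>z. c * f z)"
proof -
  have "integrable lborel (\<lambda>z. (cmod c)\<^sup>2 * ((cmod (f z))\<^sup>2 * gauss 1 z))"
    using assms by (intro integrable_mult_right fock_integrable_square)
  then show ?thesis using fock_holomorphic[OF assms]
    by (simp add: fock_def norm_mult power_mult_distrib mult.assoc holomorphic_intros)
qed

lemma fock_rotate: assumes f: "fock f" and c: "cmod c = 1" shows "fock (\<lambda>z. f (c * z))"
proof -
  have hol: "f holomorphic_on UNIV" using f by (rule fock_holomorphic)
  have [measurable]: "f \<in> borel_measurable borel" using hol by (rule entire_measurable)
  have "integrable lborel (\<lambda>z. (cmod (f (c * z)))\<^sup>2 * gauss 1 (c * z))"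
    using integrable_rotate[of "\<lambda>z. (cmod (f z))\<^sup>2 * gauss 1 z" c] c fock_integrable_square[OF f] by simp
  then have "integrable lborel (\<lambda>z. (cmod (f (c * z)))\<^sup>2 * gauss 1 z)"
    using c by (simp add: gauss_def norm_mult)
  moreover have "(\<lambda>z. f (c * z)) holomorphic_on UNIV"
    by (intro holomorphic_on_compose_gen[OF _ hol, unfolded o_def] holomorphic_intros) auto
  ultimately show ?thesis by (simp add: fock_def)
qed

text \<open>The magnetic translation, transported to the entire factor.\<close>

definition fock_shift :: "complex \<Rightarrow> (complex \<Rightarrow> complex) \<Rightarrow> complex \<Rightarrow> complex" where
  "fock_shift b f z = of_real (gauss (1/2) b) * exp (- z * cnj b) * f (z + b)"

lemma half_gauss_shift:
  "complex_of_real (gauss (1/2) (z + b)) * exp ((1/2) * (cnj z * b - z * cnj b)) =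
    of_real (gauss (1/2) z) * (of_real (gauss (1/2) b) * exp (- z * cnj b))"
  unfolding of_real_gauss exp_add[symmetric] by (rule arg_cong[of _ _ exp]) (simp add: field_simps)

lemma cmod_phase: "cmod (exp ((1/2) * (cnj z * b - z * cnj b))) = 1"
  by (simp add: algebra_simps)

lemma fock_shift: assumes f: "fock f" shows "fock (fock_shift b f)"
proof -
  have hol: "f holomorphic_on UNIV" using f by (rule fock_holomorphic)
  have [measurable]: "f \<in> borel_measurable borel" using hol by (rule entire_measurable)
  have e: "(cmod (fock_shift b f z))\<^sup>2 * gauss 1 z = (cmod (f (z + b)))\<^sup>2 * gauss 1 (z + b)" for z
  proof -
    have "of_real (gauss (1/2) z) * fock_shift b f z =
        of_real (gauss (1/2) (z + b)) * (exp ((1/2) * (cnj z * b - z * cnj b)) * f (z + b))"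
      using half_gauss_shift[of z b] by (simp add: fock_shift_def flip: mult.assoc)
    then have "(cmod (fock_shift b f z))\<^sup>2 * gauss 1 z =
        (cmod (exp ((1/2) * (cnj z * b - z * cnj b)) * f (z + b)))\<^sup>2 * gauss 1 (z + b)"
      unfolding cmod_square_gauss_half[symmetric] by simp
    then show ?thesis unfolding norm_mult cmod_phase by simp
  qed
  have "integrable lborel (\<lambda>z. (cmod (fock_shift b f z))\<^sup>2 * gauss 1 z)"
    unfolding e using integrable_translate[of "\<lambda>z. (cmod (f z))\<^sup>2 * gauss 1 z" b] fock_integrable_square[OF f] by simp
  moreover have "fock_shift b f holomorphic_on UNIV"
    unfolding fock_shift_def
    by (intro holomorphic_intros holomorphic_on_compose_gen[OF _ hol, unfolded o_def]) auto
  ultimately show ?thesis by (simp add: fock_def)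
qed

lemma bargmann_fock_cmult:
  assumes "u \<in> bargmann_fock" shows "(\<lambda>z. c * u z) \<in> bargmann_fock"
proof -
  obtain f where f: "fock f" "u = (\<lambda>z. of_real (gauss (1/2) z) * f z)"
    using assms unfolding bargmann_fock_iff by blast
  show ?thesis by (rule bargmann_fockI[OF fock_cmult[OF f(1), of c]]) (simp add: f(2) mult_ac)
qed

lemma L21_cmult: "u \<in> L21 \<Longrightarrow> (\<lambda>z. c * u z) \<in> L21"
proof -
  assume "u \<in> L21"
  then obtain f where f: "fock f" "fock (\<lambda>z. z * f z)" "u = (\<lambda>z. of_real (gauss (1/2) z) * f z)"
    unfolding L21_iff by blast
  have "fock (\<lambda>z. c * f z)" "fock (\<lambda>z. z * (c * f z))"
    using fock_cmult[OF f(1), of c] fock_cmult[OF f(2), of c] by (simp_all add: mult_ac)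
  then show ?thesis unfolding L21_iff f(3) by (intro exI[of _ "\<lambda>z. c * f z"]) (simp add: mult_ac)
qed

lemma gauss_rotate: "cmod c = 1 \<Longrightarrow> gauss s (c * z) = gauss s z"
  by (simp add: gauss_def norm_mult)

lemma bargmann_fock_rotate:
  assumes "u \<in> bargmann_fock" "cmod c = 1" shows "(\<lambda>z. u (c * z)) \<in> bargmann_fock"
proof -
  obtain f where f: "fock f" "u = (\<lambda>z. of_real (gauss (1/2) z) * f z)"
    using assms(1) unfolding bargmann_fock_iff by blast
  show ?thesis by (rule bargmann_fockI[OF fock_rotate[OF f(1) assms(2)]]) (simp add: f(2) gauss_rotate[OF assms(2)])
qed

lemma L21_rotate:
  assumes "u \<in> L21" and c: "cmod c = 1" shows "(\<lambda>z. u (c * z)) \<in> L21"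
proof -
  obtain f where f: "fock f" "fock (\<lambda>z. z * f z)" "u = (\<lambda>z. of_real (gauss (1/2) z) * f z)"
    using assms(1) unfolding L21_iff by blast
  have "c \<noteq> 0" using c by auto
  then have "fock (\<lambda>z. z * f (c * z))"
    using fock_cmult[OF fock_rotate[OF f(2) c], of "1 / c"] by simp
  then show ?thesis unfolding L21_iff f(3) using fock_rotate[OF f(1) c]
    by (intro exI[of _ "\<lambda>z. f (c * z)"]) (simp add: gauss_rotate[OF c])
qed

lemma shifted_half_gauss:
  "complex_of_real (gauss (1/2) (z + b)) * f (z + b) * exp ((1/2) * (cnj z * b - z * cnj b)) =
    of_real (gauss (1/2) z) * fock_shift b f z"
  using half_gauss_shift[of z b] unfolding fock_shift_def by (metis mult.assoc mult.commute)

lemma bargmann_fock_translate: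
  assumes "u \<in> bargmann_fock"
  shows "(\<lambda>z. u (z + b) * exp ((1/2) * (cnj z * b - z * cnj b))) \<in> bargmann_fock"
proof -
  obtain f where f: "fock f" "u = (\<lambda>z. of_real (gauss (1/2) z) * f z)"
    using assms(1) unfolding bargmann_fock_iff by blast
  show ?thesis by (rule bargmann_fockI[OF fock_shift[OF f(1)]]) (simp only: f(2) shifted_half_gauss)
qed

lemma L21_translate:
  assumes "u \<in> L21"
  shows "(\<lambda>z. u (z + b) * exp ((1/2) * (cnj z * b - z * cnj b))) \<in> L21"
proof -
  obtain f where f: "fock f" "fock (\<lambda>z. z * f z)" "u = (\<lambda>z. of_real (gauss (1/2) z) * f z)"
    using assms(1) unfolding L21_iff by blast
  have "fock (\<lambda>z. fock_shift b (\<lambda>z. z * f z) z + (- b) * fock_shift b f z)"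
    by (intro fock_add fock_cmult fock_shift f)
  moreover have "fock_shift b (\<lambda>z. z * f z) z + (- b) * fock_shift b f z = z * fock_shift b f z" for z
    by (simp add: fock_shift_def algebra_simps)
  ultimately have "fock (\<lambda>z. z * fock_shift b f z)" by simp
  then show ?thesis unfolding L21_iff f(3) using fock_shift[OF f(1)]
    by (intro exI[of _ "fock_shift b f"]) (simp only: shifted_half_gauss simp_thms)
qed

lemma fock_proj_cmult: "fock_proj (\<lambda>w. c * \<phi> w) z = c * fock_proj \<phi> z"
proof -
  have "(LINT w|lborel. exp (cnj w * z - of_real ((cmod w)\<^sup>2 / 2)) * (c * \<phi> w)) =
      c * (LINT w|lborel. exp (cnj w * z - of_real ((cmod w)\<^sup>2 / 2)) * \<phi> w)"
    unfolding integral_mult_right_zero[symmetric] by (simp only: mult_ac)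
  then show ?thesis unfolding fock_proj_def by (simp only: mult_ac)
qed

lemma fock_proj_rotate:
  assumes [measurable]: "\<phi> \<in> borel_measurable borel" and c: "cmod c = 1"
  shows "fock_proj (\<lambda>w. \<phi> (c * w)) z = fock_proj \<phi> (c * z)"
proof -
  have cc: "cnj c * c = 1" using complex_norm_square[of c] c by (simp add: mult.commute)
  have "cnj (c * w) * (c * z) = cnj w * z" for w
  proof -
    have "cnj (c * w) * (c * z) = (cnj c * c) * (cnj w * z)" by (simp add: mult_ac)
    then show ?thesis unfolding cc by simp
  qed
  then have e: "exp (cnj w * z - of_real ((cmod w)\<^sup>2 / 2)) * \<phi> (c * w) =
      (\<lambda>w. exp (cnj w * (c * z) - of_real ((cmod w)\<^sup>2 / 2)) * \<phi> w) (c * w)" for w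
    using c by (simp only: norm_mult mult_1)
  have "(LINT w|lborel. (\<lambda>w. exp (cnj w * (c * z) - of_real ((cmod w)\<^sup>2 / 2)) * \<phi> w) (c * w)) =
      (LINT w|lborel. exp (cnj w * (c * z) - of_real ((cmod w)\<^sup>2 / 2)) * \<phi> w)"
    by (rule integral_rotate[OF _ c]) measurable
  then show ?thesis unfolding fock_proj_def e using c by (simp add: norm_mult)
qed

lemma fock_proj_translate:
  assumes [measurable]: "\<phi> \<in> borel_measurable borel"
  shows "fock_proj (\<lambda>w. \<phi> (w + b) * exp ((1/2) * (cnj w * b - w * cnj b))) z =
    fock_proj \<phi> (z + b) * exp ((1/2) * (cnj z * b - z * cnj b))"
proof -
  have sq: "of_real ((cmod w)\<^sup>2 / 2) = (1/2) * (w * cnj w)" for w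
    using complex_norm_square[of w] by simp
  have sq': "complex_of_real (exp (- (cmod w)\<^sup>2 / 2)) = exp (- (1/2) * (w * cnj w))" for w
    using sq[of w] by (simp add: exp_of_real[symmetric] minus_divide_left[symmetric])
  define E where "E = exp (- z * cnj b - (1/2) * (b * cnj b))"
  have e: "exp (cnj w * z - of_real ((cmod w)\<^sup>2 / 2)) * (\<phi> (w + b) * exp ((1/2) * (cnj w * b - w * cnj b))) =
      E * (\<lambda>w. exp (cnj w * (z + b) - of_real ((cmod w)\<^sup>2 / 2)) * \<phi> w) (w + b)" for w
  proof -
    have "exp (cnj w * z - (1/2) * (w * cnj w)) * exp ((1/2) * (cnj w * b - w * cnj b)) =
        E * exp (cnj (w + b) * (z + b) - (1/2) * ((w + b) * cnj (w + b)))"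
      unfolding E_def exp_add[symmetric] by (rule arg_cong[of _ _ exp]) (simp add: field_simps)
    then show ?thesis unfolding sq by (simp add: mult_ac)
  qed
  define J where "J = (LINT w|lborel. exp (cnj w * (z + b) - of_real ((cmod w)\<^sup>2 / 2)) * \<phi> w)"
  have "(LINT w|lborel. (\<lambda>w. exp (cnj w * (z + b) - of_real ((cmod w)\<^sup>2 / 2)) * \<phi> w) (w + b)) = J"
    unfolding J_def by (rule integral_translate) measurable
  then have I: "(LINT w|lborel. exp (cnj w * z - of_real ((cmod w)\<^sup>2 / 2)) *
      (\<phi> (w + b) * exp ((1/2) * (cnj w * b - w * cnj b)))) = E * J"
    unfolding e integral_mult_right_zero by simp
  have P: "of_real (exp (- (cmod z)\<^sup>2 / 2)) * E =
      of_real (exp (- (cmod (z + b))\<^sup>2 / 2)) * exp ((1/2) * (cnj z * b - z * cnj b))"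
    unfolding sq' E_def exp_add[symmetric] by (rule arg_cong[of _ _ exp]) (simp add: field_simps)
  have "of_real (exp (- (cmod z)\<^sup>2 / 2) / pi) * (E * J) = (of_real (exp (- (cmod z)\<^sup>2 / 2)) * E) * J / of_real pi"
    by simp
  also have "\<dots> = of_real (exp (- (cmod (z + b))\<^sup>2 / 2) / pi) * J * exp ((1/2) * (cnj z * b - z * cnj b))"
    unfolding P of_real_divide by (simp only: times_divide_eq_left times_divide_eq_right mult_ac)
  finally show ?thesis unfolding fock_proj_def I J_def .
qed

lemma bargmann_fock_measurable: "u \<in> bargmann_fock \<Longrightarrow> u \<in> borel_measurable borel"
  by (simp add: bargmann_fock_def L2_def)

text \<open>The equations solved for the time derivatives, which is the form that is stable under the chain rule.\<close>

lemma solution_iff: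
  "solution u v \<longleftrightarrow> (\<forall>t. u t \<in> bargmann_fock \<and> v t \<in> bargmann_fock) \<and>
    (\<forall>t z. ((\<lambda>s. u s z) has_vector_derivative - \<i> * fock_proj (\<lambda>w. of_real ((cmod (v t w))\<^sup>2) * u t w) z) (at t) \<and>
           ((\<lambda>s. v s z) has_vector_derivative \<i> * fock_proj (\<lambda>w. of_real ((cmod (u t w))\<^sup>2) * v t w) z) (at t))"
proof -
  have 1: "(h differentiable (at t) \<and> \<i> * vector_derivative h (at t) = X) \<longleftrightarrow> (h has_vector_derivative - \<i> * X) (at t)"
    for h :: "real \<Rightarrow> complex" and t X
  proof
    assume "h differentiable (at t) \<and> \<i> * vector_derivative h (at t) = X"
    then have h: "(h has_vector_derivative vector_derivative h (at t)) (at t)" and "\<i> * vector_derivative h (at t) = X"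
      by (simp_all add: vector_derivative_works)
    then have "vector_derivative h (at t) = - \<i> * X" by (metis complex_i_mult_minus mult_minus_left minus_minus)
    with h show "(h has_vector_derivative - \<i> * X) (at t)" by simp
  next
    assume h: "(h has_vector_derivative - \<i> * X) (at t)"
    then have "vector_derivative h (at t) = - \<i> * X" by (rule vector_derivative_at)
    with h show "h differentiable (at t) \<and> \<i> * vector_derivative h (at t) = X"
      by (auto simp: differentiableI_vector)
  qed
  have 2: "(h differentiable (at t) \<and> \<i> * vector_derivative h (at t) = - X) \<longleftrightarrow> (h has_vector_derivative \<i> * X) (at t)"
    for h :: "real \<Rightarrow> complex" and t X
    using 1[of h t "- X"] by simp
  show ?thesis unfolding solution_def 1[symmetric] 2[symmetric] by blast
qed

lemma has_vector_derivative_rescale: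
  fixes h :: "real \<Rightarrow> complex"
  assumes "(h has_vector_derivative D) (at (a * t))"
  shows "((\<lambda>s. h (a * s)) has_vector_derivative of_real a * D) (at t)"
proof -
  have "((\<lambda>s. a * s) has_vector_derivative a) (at t)"
    unfolding has_real_derivative_iff_has_vector_derivative[symmetric] by (auto intro!: derivative_eq_intros)
  from vector_diff_chain_at[OF this assms] show ?thesis by (simp add: o_def scaleR_conv_of_real)
qed

lemma solution_scale:
  assumes sol: "solution u v" and K: "K \<ge> 0"
  shows "solution (\<lambda>t z. of_real K * exp (\<i> * of_real \<theta>1) * u (K\<^sup>2 * t) z) (\<lambda>t z. of_real K * exp (\<i> * of_real \<theta>2) * v (K\<^sup>2 * t) z)"
proof -
  have sq: "complex_of_real ((cmod (of_real K * exp (\<i> * of_real \<theta>) * x))\<^sup>2) = of_real (K\<^sup>2) * of_real ((cmod x)\<^sup>2)" for \<theta> x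
    using K by (simp add: norm_mult power_mult_distrib)
  have P: "fock_proj (\<lambda>w. of_real ((cmod (of_real K * exp (\<i> * of_real \<theta>) * a w))\<^sup>2) * (c * b w)) z =
      of_real (K\<^sup>2) * c * fock_proj (\<lambda>w. of_real ((cmod (a w))\<^sup>2) * b w) z" for \<theta> a b c z
    unfolding sq fock_proj_cmult[symmetric] by (simp only: mult_ac)
  have S: "\<And>t. u t \<in> bargmann_fock" "\<And>t. v t \<in> bargmann_fock"
    "\<And>t z. ((\<lambda>s. u s z) has_vector_derivative - \<i> * fock_proj (\<lambda>w. of_real ((cmod (v t w))\<^sup>2) * u t w) z) (at t)"
    "\<And>t z. ((\<lambda>s. v s z) has_vector_derivative \<i> * fock_proj (\<lambda>w. of_real ((cmod (u t w))\<^sup>2) * v t w) z) (at t)"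
    using sol unfolding solution_iff by blast+
  have D: "((\<lambda>s. c * h (K\<^sup>2 * s) z) has_vector_derivative x * (of_real (K\<^sup>2) * c * y)) (at t)"
    if "((\<lambda>s. h s z) has_vector_derivative x * y) (at (K\<^sup>2 * t))" for h :: "real \<Rightarrow> complex \<Rightarrow> complex" and c x y z t
    using has_vector_derivative_mult_right[OF has_vector_derivative_rescale[OF that], of c] by (simp only: mult_ac)
  show ?thesis
    unfolding solution_iff P by (intro allI conjI D[where h=u] D[where h=v] bargmann_fock_cmult S)
qed

lemma solution_rotate:
  assumes sol: "solution u v" and c: "cmod c = 1"
  shows "solution (\<lambda>t z. u t (c * z)) (\<lambda>t z. v t (c * z))"
proof -
  have m: "u t \<in> borel_measurable borel" "v t \<in> borel_measurable borel" for t
    using sol bargmann_fock_measurable unfolding solution_def by auto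
  have P: "fock_proj (\<lambda>w. of_real ((cmod (a (c * w)))\<^sup>2) * b (c * w)) z =
      fock_proj (\<lambda>w. of_real ((cmod (a w))\<^sup>2) * b w) (c * z)"
    if [measurable]: "a \<in> borel_measurable borel" "b \<in> borel_measurable borel" for a b z
    by (rule fock_proj_rotate[OF _ c]) measurable
  show ?thesis using sol unfolding solution_iff P[OF m(2) m(1)] P[OF m(1) m(2)]
    by (auto intro: bargmann_fock_rotate c)
qed

lemma solution_translate:
  assumes sol: "solution u v"
  shows "solution (\<lambda>t z. u t (z + b) * exp ((1/2) * (cnj z * b - z * cnj b))) (\<lambda>t z. v t (z + b) * exp ((1/2) * (cnj z * b - z * cnj b)))"
proof -
  have m: "u t \<in> borel_measurable borel" "v t \<in> borel_measurable borel" for t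
    using sol bargmann_fock_measurable unfolding solution_def by auto
  have P: "fock_proj (\<lambda>w. of_real ((cmod (x (w + b) * exp ((1/2) * (cnj w * b - w * cnj b))))\<^sup>2) *
        (y (w + b) * exp ((1/2) * (cnj w * b - w * cnj b)))) z =
      fock_proj (\<lambda>w. of_real ((cmod (x w))\<^sup>2) * y w) (z + b) * exp ((1/2) * (cnj z * b - z * cnj b))"
    if [measurable]: "x \<in> borel_measurable borel" "y \<in> borel_measurable borel" for x y z
  proof -
    have "(\<lambda>w. of_real ((cmod (x w))\<^sup>2) * y w) \<in> borel_measurable borel" by measurable
    from fock_proj_translate[OF this, of b z] show ?thesis
      unfolding norm_mult cmod_phase mult_1_right by (simp only: mult.assoc)
  qed
  have D: "((\<lambda>s. h s * e) has_vector_derivative x * (y * e)) (at t)"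
    if "(h has_vector_derivative x * y) (at t)" for h :: "real \<Rightarrow> complex" and e x y t
    using has_vector_derivative_mult_left[OF that, of e] by (simp only: mult.assoc)
  have S: "\<And>t. u t \<in> bargmann_fock" "\<And>t. v t \<in> bargmann_fock"
    "\<And>t z. ((\<lambda>s. u s z) has_vector_derivative - \<i> * fock_proj (\<lambda>w. of_real ((cmod (v t w))\<^sup>2) * u t w) z) (at t)"
    "\<And>t z. ((\<lambda>s. v s z) has_vector_derivative \<i> * fock_proj (\<lambda>w. of_real ((cmod (u t w))\<^sup>2) * v t w) z) (at t)"
    using sol unfolding solution_iff by blast+
  show ?thesis unfolding solution_iff P[OF m(2) m(1)] P[OF m(1) m(2)]
    by (intro allI conjI D bargmann_fock_translate S)
qed

lemma solution_swap:
  assumes sol: "solution u v" shows "solution (\<lambda>t. v (- t)) (\<lambda>t. u (- t))"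
proof -
  have S: "\<And>t. u t \<in> bargmann_fock" "\<And>t. v t \<in> bargmann_fock"
    "\<And>t z. ((\<lambda>s. u s z) has_vector_derivative - \<i> * fock_proj (\<lambda>w. of_real ((cmod (v t w))\<^sup>2) * u t w) z) (at t)"
    "\<And>t z. ((\<lambda>s. v s z) has_vector_derivative \<i> * fock_proj (\<lambda>w. of_real ((cmod (u t w))\<^sup>2) * v t w) z) (at t)"
    using sol unfolding solution_iff by blast+
  have D: "((\<lambda>s. h (- s) z) has_vector_derivative - D) (at t)"
    if "((\<lambda>s. h s z) has_vector_derivative D) (at (- t))" for h :: "real \<Rightarrow> complex \<Rightarrow> complex" and D z t
    using has_vector_derivative_rescale[of "\<lambda>s. h s z" D "-1" t] that by simp
  have "((\<lambda>s. v (- s) z) has_vector_derivative - \<i> * fock_proj (\<lambda>w. of_real ((cmod (u (- t) w))\<^sup>2) * v (- t) w) z) (at t)"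
    "((\<lambda>s. u (- s) z) has_vector_derivative \<i> * fock_proj (\<lambda>w. of_real ((cmod (v (- t) w))\<^sup>2) * u (- t) w) z) (at t)" for t z
    using D[of v z _ t, OF S(4)] D[of u z _ t, OF S(3)] by simp_all
  then show ?thesis unfolding solution_iff using S(1,2) by blast
qed

lemma wave_symmetries:
  assumes UV: "U \<in> L21" "V \<in> L21" and wave: "progressive_wave u v (U, V) lam \<mu> \<alpha>"
  shows "K \<ge> 0 \<Longrightarrow> wave_initial
            ((\<lambda>z. of_real K * exp (\<i> * of_real \<theta>1) * U z), (\<lambda>z. of_real K * exp (\<i> * of_real \<theta>2) * V z))
            (K\<^sup>2 * lam) (K\<^sup>2 * \<mu>) (of_real (K\<^sup>2) * \<alpha>)"
    and "wave_initial (L_rotate \<theta> (U, V)) lam \<mu> (\<alpha> * exp (- \<i> * of_real \<theta>))"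
    and "wave_initial (R_translate \<beta> (U, V)) (lam + 2 * Im (\<beta> * cnj \<alpha>)) (\<mu> + 2 * Im (\<beta> * cnj \<alpha>)) \<alpha>"
    and "wave_initial (V, U) (- \<mu>) (- lam) (- \<alpha>)"
proof -
  have sol: "solution u v"
    and u: "\<And>t z. u t z = exp (- \<i> * of_real (lam * t)) * U (z + \<alpha> * of_real t) *
              exp ((1/2) * (cnj z * \<alpha> - z * cnj \<alpha>) * of_real t)"
    and v: "\<And>t z. v t z = exp (- \<i> * of_real (\<mu> * t)) * V (z + \<alpha> * of_real t) *
              exp ((1/2) * (cnj z * \<alpha> - z * cnj \<alpha>) * of_real t)"
    using wave unfolding progressive_wave_def by auto
  show "wave_initial ((\<lambda>z. of_real K * exp (\<i> * of_real \<theta>1) * U z), (\<lambda>z. of_real K * exp (\<i> * of_real \<theta>2) * V z))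
            (K\<^sup>2 * lam) (K\<^sup>2 * \<mu>) (of_real (K\<^sup>2) * \<alpha>)" if K: "K \<ge> 0"
    unfolding wave_initial_def progressive_wave_def
  proof (intro conjI exI)
    show "solution (\<lambda>t z. of_real K * exp (\<i> * of_real \<theta>1) * u (K\<^sup>2 * t) z) (\<lambda>t z. of_real K * exp (\<i> * of_real \<theta>2) * v (K\<^sup>2 * t) z)"
      by (rule solution_scale[OF sol K])
    show "((\<lambda>z. of_real K * exp (\<i> * of_real \<theta>1) * U z), (\<lambda>z. of_real K * exp (\<i> * of_real \<theta>2) * V z)) \<in> L21 \<times> L21"
      using L21_cmult[OF UV(1), of "of_real K * exp (\<i> * of_real \<theta>1)"] L21_cmult[OF UV(2), of "of_real K * exp (\<i> * of_real \<theta>2)"]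
      by (simp only: mem_Times_iff fst_conv snd_conv simp_thms)
  qed (auto simp: u v algebra_simps)
  define c where "c = exp (\<i> * of_real \<theta>)"
  have c: "cmod c = 1" "exp (- \<i> * of_real \<theta>) = cnj c" by (simp_all add: c_def exp_cnj)
  have cc: "c * cnj c = 1" using complex_norm_square[of c] c by simp
  have rot: "c * (z + \<alpha> * cnj c * x) = c * z + \<alpha> * x" for z x
  proof -
    have "c * (z + \<alpha> * cnj c * x) = c * z + (c * cnj c) * (\<alpha> * x)" by (simp add: algebra_simps)
    then show ?thesis unfolding cc by simp
  qed
  have phase: "cnj (c * z) * \<alpha> - (c * z) * cnj \<alpha> = cnj z * (\<alpha> * cnj c) - z * cnj (\<alpha> * cnj c)" for z
    by (simp add: algebra_simps)
  show "wave_initial (L_rotate \<theta> (U, V)) lam \<mu> (\<alpha> * exp (- \<i> * of_real \<theta>))"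
    unfolding wave_initial_def progressive_wave_def L_rotate_def c_def[symmetric] c(2)
  proof (intro conjI exI)
    show "solution (\<lambda>t z. u t (c * z)) (\<lambda>t z. v t (c * z))" by (rule solution_rotate[OF sol c(1)])
  qed (use UV in \<open>simp_all only: mem_Times_iff fst_conv snd_conv L21_rotate[OF _ c(1)] rot phase[symmetric] u v simp_thms\<close>)
  \<comment> \<open>Both translations commute up to a phase that is linear in time, which shifts the frequencies.\<close>
  have I: "complex_of_real (2 * Im (\<beta> * cnj \<alpha>)) = - \<i> * (\<beta> * cnj \<alpha> - cnj \<beta> * \<alpha>)"
    by (simp add: complex_eq_iff)
  have E: "exp (- \<i> * of_real (x * t)) * y * exp ((1/2) * (cnj (z + \<beta>) * \<alpha> - (z + \<beta>) * cnj \<alpha>) * of_real t) *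
        exp ((1/2) * (cnj z * \<beta> - z * cnj \<beta>)) =
      exp (- \<i> * of_real ((x + 2 * Im (\<beta> * cnj \<alpha>)) * t)) *
        (y * exp ((1/2) * (cnj (z + \<alpha> * of_real t) * \<beta> - (z + \<alpha> * of_real t) * cnj \<beta>))) *
        exp ((1/2) * (cnj z * \<alpha> - z * cnj \<alpha>) * of_real t)" for x t y z
  proof -
    have "exp (- \<i> * of_real (x * t)) * exp ((1/2) * (cnj (z + \<beta>) * \<alpha> - (z + \<beta>) * cnj \<alpha>) * of_real t) *
        exp ((1/2) * (cnj z * \<beta> - z * cnj \<beta>)) =
      exp (- \<i> * of_real ((x + 2 * Im (\<beta> * cnj \<alpha>)) * t)) *
        exp ((1/2) * (cnj (z + \<alpha> * of_real t) * \<beta> - (z + \<alpha> * of_real t) * cnj \<beta>)) *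
        exp ((1/2) * (cnj z * \<alpha> - z * cnj \<alpha>) * of_real t)"
      unfolding exp_add[symmetric] of_real_mult[of _ t] of_real_add[of x] I
      by (rule arg_cong[of _ _ exp]) (simp add: field_simps)
    then show ?thesis by (simp only: mult_ac)
  qed
  have sh: "z + \<beta> + \<alpha> * x = z + \<alpha> * x + \<beta>" for z x by (simp add: add_ac)
  show "wave_initial (R_translate \<beta> (U, V)) (lam + 2 * Im (\<beta> * cnj \<alpha>)) (\<mu> + 2 * Im (\<beta> * cnj \<alpha>)) \<alpha>"
    unfolding wave_initial_def progressive_wave_def R_translate_def
  proof (intro conjI exI)
    show "solution (\<lambda>t z. u t (z + \<beta>) * exp ((1/2) * (cnj z * \<beta> - z * cnj \<beta>))) (\<lambda>t z. v t (z + \<beta>) * exp ((1/2) * (cnj z * \<beta> - z * cnj \<beta>)))"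
      by (rule solution_translate[OF sol])
  qed (use UV in \<open>simp_all only: mem_Times_iff fst_conv snd_conv L21_translate u v E sh simp_thms\<close>)
  show "wave_initial (V, U) (- \<mu>) (- lam) (- \<alpha>)"
    unfolding wave_initial_def progressive_wave_def
  proof (intro conjI exI)
    show "solution (\<lambda>t. v (- t)) (\<lambda>t. u (- t))" by (rule solution_swap[OF sol])
  qed (use UV in \<open>auto simp: u v algebra_simps\<close>)
qed

section \<open>Progressive waves\<close>

lemma wave_time_derivative:
  assumes f: "f holomorphic_on UNIV"
  shows "((\<lambda>t. exp (- \<i> * of_real (l * t)) * (of_real (gauss (1/2) (z + \<alpha> * of_real t)) * f (z + \<alpha> * of_real t)) *
      exp ((1/2) * (cnj z * \<alpha> - z * cnj \<alpha>) * of_real t)) has_vector_derivative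
    of_real (gauss (1/2) z) * (\<alpha> * deriv f z - cnj \<alpha> * z * f z - \<i> * of_real l * f z)) (at 0)"
proof -
  have G: "((\<lambda>t. f (z + of_real t * \<alpha>) * cnj 1 * of_real (gauss (1/2) (z + of_real t * \<alpha>))) has_vector_derivative
      (\<alpha> * ((deriv f z - of_real (1/2) * cnj z * f z) * cnj 1 * of_real (gauss (1/2) z)) +
       cnj \<alpha> * (f z * cnj (deriv (\<lambda>_. 1) z - of_real (1/2) * cnj z * 1) * of_real (gauss (1/2) z)))) (at 0)"
    by (rule has_vector_derivative_gaussian_product[OF f]) (intro holomorphic_intros)
  have E1: "((\<lambda>t. exp (- \<i> * of_real (l * t))) has_vector_derivative - \<i> * of_real l) (at 0)"
    by (rule has_vector_derivative_eq_rhs[OF has_vector_derivative_real_field[of "\<lambda>t. exp (- \<i> * (of_real l * t))" "- \<i> * of_real l" 0, simplified of_real_mult[symmetric]]])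
       (auto intro!: derivative_eq_intros)
  have E2: "((\<lambda>t. exp ((1/2) * (cnj z * \<alpha> - z * cnj \<alpha>) * of_real t)) has_vector_derivative (1/2) * (cnj z * \<alpha> - z * cnj \<alpha>)) (at 0)"
    by (rule has_vector_derivative_real_field) (auto intro!: derivative_eq_intros)
  show ?thesis
    using has_vector_derivative_mult[OF has_vector_derivative_mult[OF E1 G] E2]
    by (simp add: algebra_simps)
qed

lemma wave_stationary_equation:
  assumes f: "f holomorphic_on UNIV"
    and w: "\<And>t. w t = exp (- \<i> * of_real (l * t)) * (of_real (gauss (1/2) (z + \<alpha> * of_real t)) * f (z + \<alpha> * of_real t)) *
      exp ((1/2) * (cnj z * \<alpha> - z * cnj \<alpha>) * of_real t)"
    and X: "(w has_vector_derivative - \<i> * X) (at 0)"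
  shows "X = of_real (gauss (1/2) z) * (of_real l * f z + \<i> * (\<alpha> * deriv f z - cnj \<alpha> * z * f z))"
proof -
  have "(w has_vector_derivative of_real (gauss (1/2) z) * (\<alpha> * deriv f z - cnj \<alpha> * z * f z - \<i> * of_real l * f z)) (at 0)"
    unfolding w[abs_def] by (rule wave_time_derivative[OF f])
  with X have "- \<i> * X = of_real (gauss (1/2) z) * (\<alpha> * deriv f z - cnj \<alpha> * z * f z - \<i> * of_real l * f z)"
    by (rule vector_derivative_unique_at)
  then have "\<i> * (- \<i> * X) = \<i> * (of_real (gauss (1/2) z) * (\<alpha> * deriv f z - cnj \<alpha> * z * f z - \<i> * of_real l * f z))" by simp
  then show ?thesis by (simp add: algebra_simps)
qed

lemma dbar_density:
  assumes f: "f holomorphic_on UNIV"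
  shows "dbar (\<lambda>w. of_real ((cmod (of_real (gauss (1/2) w) * f w))\<^sup>2)) z =
    (f z * cnj (deriv f z) - z * f z * cnj (f z)) * of_real (gauss 1 z)"
proof -
  define F where "F w = f w * cnj (f w) * complex_of_real (gauss 1 w)" for w
  define D1 where "D1 = (deriv f z - of_real 1 * cnj z * f z) * cnj (f z) * of_real (gauss 1 z)"
  define D2 where "D2 = f z * cnj (deriv f z - of_real 1 * cnj z * f z) * of_real (gauss 1 z)"
  have F: "complex_of_real ((cmod (of_real (gauss (1/2) w) * f w))\<^sup>2) = F w" for w
    unfolding cmod_square_gauss_half F_def by (simp add: mult_cnj_cmod)
  have D: "((\<lambda>t. F (z + of_real (t - s) * e)) has_vector_derivative e * D1 + cnj e * D2) (at s)" for e s
  proof -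
    have "((\<lambda>t. t - s) has_vector_derivative 1) (at s)"
      by (auto intro!: derivative_eq_intros)
    moreover have "((\<lambda>t. F (z + of_real t * e)) has_vector_derivative e * D1 + cnj e * D2) (at (s - s))"
      unfolding F_def D1_def D2_def using has_vector_derivative_gaussian_product[OF f f, of z e 1] by simp
    ultimately show ?thesis using vector_diff_chain_at by (fastforce simp: o_def)
  qed
  have x: "Complex x (Im z) = z + of_real (x - Re z) * 1" for x by (simp add: complex_eq_iff)
  have y: "Complex (Re z) y = z + of_real (y - Im z) * \<i>" for y by (simp add: complex_eq_iff)
  have "dbar F z = (1/2) * ((1 * D1 + cnj 1 * D2) + \<i> * (\<i> * D1 + cnj \<i> * D2))"
    unfolding dbar_def x y vector_derivative_at[OF D] ..
  also have "\<dots> = D2" by (simp add: algebra_simps)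
  finally show ?thesis unfolding F[abs_def] by (simp add: D2_def algebra_simps)
qed

theorem proposition1p8:
  fixes u v :: "real \<Rightarrow> complex \<Rightarrow> complex"
    and U V :: "complex \<Rightarrow> complex"
    and lam \<mu> :: real
    and \<alpha> :: complex
  assumes "U \<in> L21" and "V \<in> L21"
    and "\<alpha> \<noteq> 0"
    and "(U, V) \<noteq> (\<lambda>z. 0, \<lambda>z. 0)"
    and "progressive_wave u v (U, V) lam \<mu> \<alpha>"
  shows "mass U = mass V
    \<and> Re (cnj \<alpha> * Q_minus U V) = 0
    \<and> Im (cnj \<alpha> * Q_minus U V) \<noteq> 0
    \<and> (\<forall>(K::real) (\<theta>::real) (\<theta>1::real) (\<theta>2::real) (\<beta>::complex). K \<ge> 0 \<longrightarrow>
          wave_initial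
            ((\<lambda>z. of_real K * exp (\<i> * of_real \<theta>1) * U z), (\<lambda>z. of_real K * exp (\<i> * of_real \<theta>2) * V z))
            (K\<^sup>2 * lam) (K\<^sup>2 * \<mu>) (of_real (K\<^sup>2) * \<alpha>)
        \<and> wave_initial (L_rotate \<theta> (U, V)) lam \<mu> (\<alpha> * exp (- \<i> * of_real \<theta>))
        \<and> wave_initial (R_translate \<beta> (U, V))
            (lam + 2 * Im (\<beta> * cnj \<alpha>)) (\<mu> + 2 * Im (\<beta> * cnj \<alpha>)) \<alpha>
        \<and> wave_initial (V, U) (- \<mu>) (- lam) (- \<alpha>))
    \<and> \<alpha> = \<i> / of_real (mass U) *
          (LINT z|lborel. of_real ((cmod (V z))\<^sup>2) * dbar (\<lambda>w. of_real ((cmod (U w))\<^sup>2)) z)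
    \<and> cmod \<alpha> \<le> mass U / (2 * sqrt 2 * pi)
    \<and> of_real ((lam - \<mu>) * mass U) - 2 * \<i> * cnj \<alpha> * Q_minus U V = of_real (2 * energy U V)"
proof -
  obtain f where ff: "fock f" "fock (\<lambda>z. z * f z)" and U: "U = (\<lambda>z. of_real (gauss (1/2) z) * f z)"
    using assms(1) unfolding L21_iff by blast
  obtain g where gg: "fock g" "fock (\<lambda>z. z * g z)" and V: "V = (\<lambda>z. of_real (gauss (1/2) z) * g z)"
    using assms(2) unfolding L21_iff by blast
  have sol: "solution u v"
    and u: "\<And>t z. u t z = exp (- \<i> * of_real (lam * t)) * U (z + \<alpha> * of_real t) *
              exp ((1/2) * (cnj z * \<alpha> - z * cnj \<alpha>) * of_real t)"
    and v: "\<And>t z. v t z = exp (- \<i> * of_real (\<mu> * t)) * V (z + \<alpha> * of_real t) *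
              exp ((1/2) * (cnj z * \<alpha> - z * cnj \<alpha>) * of_real t)"
    using assms(5) unfolding progressive_wave_def by auto
  have u0: "u 0 = U" "v 0 = V" by (auto simp: u v)
  have sqU: "(cmod (U z))\<^sup>2 = (cmod (f z))\<^sup>2 * gauss 1 z" and sqV: "(cmod (V z))\<^sup>2 = (cmod (g z))\<^sup>2 * gauss 1 z" for z
    unfolding U V by (rule cmod_square_gauss_half)+
  have eq_f: "fock_proj (\<lambda>w. of_real ((cmod (g w))\<^sup>2 * gauss 1 w) * (of_real (gauss (1/2) w) * f w)) z =
      of_real (gauss (1/2) z) * (of_real lam * f z + \<i> * (\<alpha> * deriv f z - cnj \<alpha> * z * f z))" for z
  proof (rule wave_stationary_equation[OF fock_holomorphic[OF ff(1)] u[unfolded U]])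
    have "((\<lambda>s. u s z) has_vector_derivative - \<i> * fock_proj (\<lambda>w. of_real ((cmod (V w))\<^sup>2) * U w) z) (at 0)"
      using sol unfolding solution_iff u0[symmetric] by blast
    then show "((\<lambda>s. u s z) has_vector_derivative - \<i> *
        fock_proj (\<lambda>w. of_real ((cmod (g w))\<^sup>2 * gauss 1 w) * (of_real (gauss (1/2) w) * f w)) z) (at 0)"
      unfolding sqV unfolding U .
  qed
  have eq_g: "fock_proj (\<lambda>w. of_real (- ((cmod (f w))\<^sup>2 * gauss 1 w)) * (of_real (gauss (1/2) w) * g w)) z =
      of_real (gauss (1/2) z) * (of_real \<mu> * g z + \<i> * (\<alpha> * deriv g z - cnj \<alpha> * z * g z))" for z
  proof (rule wave_stationary_equation[OF fock_holomorphic[OF gg(1)] v[unfolded V]])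
    have "((\<lambda>s. v s z) has_vector_derivative \<i> * fock_proj (\<lambda>w. of_real ((cmod (U w))\<^sup>2) * V w) z) (at 0)"
      using sol unfolding solution_iff u0[symmetric] by blast
    then have "((\<lambda>s. v s z) has_vector_derivative - \<i> * (- 1 * fock_proj (\<lambda>w. of_real ((cmod (U w))\<^sup>2) * V w) z)) (at 0)"
      by simp
    then show "((\<lambda>s. v s z) has_vector_derivative - \<i> *
        fock_proj (\<lambda>w. of_real (- ((cmod (f w))\<^sup>2 * gauss 1 w)) * (of_real (gauss (1/2) w) * g w)) z) (at 0)"
      unfolding fock_proj_cmult[symmetric] sqU unfolding V by simp
  qed
  interpret wave_pair f g lam \<mu> \<alpha>
    by unfold_locales (fact ff gg eq_f eq_g assms(3))+
  have mU: "mass U = F.m" and mV: "mass V = G.m" unfolding mass_def sqU sqV by (rule refl)+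
  have Q: "Q_minus U V = F.q - G.q"
  proof -
    have "z * of_real ((cmod (U z))\<^sup>2 - (cmod (V z))\<^sup>2) =
        z * f z * cnj (f z) * of_real (gauss 1 z) - z * g z * cnj (g z) * of_real (gauss 1 z)" for z
      unfolding sqU sqV by (simp add: mult.assoc mult_cnj_cmod[symmetric] algebra_simps)
    then show ?thesis unfolding Q_minus_def fock_inner_def
      by (simp only: Bochner_Integration.integral_diff[OF integrable_fock_mult[OF ff(2) ff(1)] integrable_fock_mult[OF gg(2) gg(1)]])
  qed
  have en: "energy U V = H" unfolding energy_def sqU sqV by (simp only: mult.commute)
  have mass_zero: "\<And>z. h z = 0" if "fock h" "(LINT z|lborel. (cmod (h z))\<^sup>2 * gauss 1 z) = 0" for h
  proof -
    fix z
    have "(cmod (h z))\<^sup>2 * gauss 1 z \<le> 0" using fock_pointwise_bound[OF that(1), of z] that(2) by simp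
    then have "(cmod (h z))\<^sup>2 * gauss 1 z = 0" by (intro antisym) auto
    then show "h z = 0" by simp
  qed
  have m: "F.m \<noteq> 0"
  proof
    assume F0: "F.m = 0"
    then have G0: "G.m = 0" unfolding masses_equal .
    have "U = (\<lambda>z. 0)" "V = (\<lambda>z. 0)"
      unfolding U V mass_zero[OF ff(1) F0] mass_zero[OF gg(1) G0] by simp_all
    then show False using assms(4) by simp
  qed
  have v: "\<alpha> = \<i> / of_real (mass U) * (LINT z|lborel. of_real ((cmod (V z))\<^sup>2) * dbar (\<lambda>w. of_real ((cmod (U w))\<^sup>2)) z)"
  proof -
    have "(LINT z|lborel. of_real ((cmod (V z))\<^sup>2) * dbar (\<lambda>w. of_real ((cmod (U w))\<^sup>2)) z) = - \<i> * \<alpha> * of_real F.m"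
      unfolding A_value[symmetric] sqV unfolding U dbar_density[OF fock_holomorphic[OF ff(1)]] by (rule refl)
    then show ?thesis using m unfolding mU by simp
  qed
  have vi: "cmod \<alpha> \<le> mass U / (2 * sqrt 2 * pi)"
  proof -
    have "0 \<le> F.m" by (rule Bochner_Integration.integral_nonneg) simp
    then have "F.m / (4 * sqrt 2 * pi) \<le> F.m / (2 * sqrt 2 * pi)" by (intro divide_left_mono) auto
    then show ?thesis using speed_bound[OF m] unfolding mU by linarith
  qed
  have vii: "of_real ((lam - \<mu>) * mass U) - 2 * \<i> * cnj \<alpha> * Q_minus U V = of_real (2 * energy U V)"
  proof -
    define y where "y = Im (cnj \<alpha> * (F.q - G.q))"
    have "cnj \<alpha> * Q_minus U V = \<i> * of_real y"
      using Re_dipole_eq_0 unfolding Q y_def by (simp add: complex_eq_iff)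
    then have "of_real ((lam - \<mu>) * mass U) - 2 * \<i> * (cnj \<alpha> * Q_minus U V) =
        complex_of_real ((lam - \<mu>) * F.m + 2 * y)"
      unfolding mU by (simp add: complex_eq_iff)
    then show ?thesis unfolding y_def parameter_relation en by (simp only: mult.assoc)
  qed
  show ?thesis
    using masses_equal Re_dipole_eq_0 Im_dipole_nonzero[OF m] wave_symmetries[OF assms(1,2,5)] v vi vii
    unfolding mU mV Q by blast
qed

end
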